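(* Let $(M,g)=(B\times_f F,\ g_B+f^2g_F)$ be a warped product manifold, let $(\overline{M},\overline{g})=(\overline{M}(c),E,\overline{g})$ be a quaternionic space form of constant quaternionic sectional curvature $c$, and let $\psi:(M,g)\to(\overline{M},\overline{g})$ be an isometric immersion. Let $m_1=\dim B$, $m_2=\dim F$ and $m=m_1+m_2$. If $c\ge 0$, then $$\frac{m_1 m^2}{2(m-1)}H^2-\frac{m_1}{2}\|h\|^2+m_1\frac{c}{4}\ \le\ \frac{\triangle f}{f}\ \le\ \frac{m^2}{4m_2}H^2+m_1c,$$ and if $c<0$, then $$\frac{m_1 m^2}{2(m-1)}H^2-\frac{m_1}{2}\|h\|^2+m_1c\ \le\ \frac{\triangle f}{f}\ \le\ \frac{m^2}{4m_2}H^2+m_1\frac{c}{4}.$$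
   Context: $(B,g_B)$ and $(F,g_F)$ are Riemannian manifolds (of positive dimension), $f:B\to\mathbb{R}^+$ is a smooth positive function (the warping function), and $B\times_f F$ is the product $B\times F$ with the metric $g=g_B+f^2g_F$; $f$ is also regarded as a function on $M$ via the projection to $B$. All dimensions are real. The Laplacian is $\triangle f=\sum_{i=1}^m\big((\nabla_{v_i}v_i)f-v_i^2f\big)$ for a local orthonormal frame $v_1,\dots,v_m$ of $TM$, where $\nabla$ is the Levi-Civita connection of $M$ (note the sign). $h$ is the second fundamental form of $M$ in $\overline{M}$, the mean curvature vector is $H=\frac1m\sum_{i=1}^m h(v_i,v_i)$, $H^2=\overline{g}(H,H)$, and $\|h\|^2=\sum_{i,j=1}^m\overline{g}(h(v_i,v_j),h(v_i,v_j))$. The inequalities are between functions on $M$, at every point. A quaternionic space form $(\overline{M}(c),E,\overline{g})$ is a quaternionic Kähler manifold, where $E\subset\mathrm{End}(T\overline{M})$ is the rank-3 bundle locally spanned by almost Hermitian structures $J_1,J_2,J_3$ satisfying the quaternion relations, of constant quaternionic sectional curvature $c$; its curvature tensor is $$\overline{R}(X,Y)Z=\tfrac{c}{4}\Big(\overline{g}(Y,Z)X-\overline{g}(X,Z)Y+\sum_{\alpha=1}^3\big(\overline{g}(J_\alpha Y,Z)J_\alpha X-\overline{g}(J_\alpha X,Z)J_\alpha Y-2\overline{g}(J_\alpha X,Y)J_\alpha Z\big)\Big).$$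
   Formalization: Here △f is the Laplacian of f on the base (B, g_B), not of f regarded as a function on M; with the Laplacian of M the lower bound fails (e.g. the flat plane in polar coordinates, f(r)=r, c=0, h=0), while the upper bound for M follows from the one proved. *)

theory Defs
  imports "HOL-Analysis.Analysis"
begin

section \<open>Smooth maps between Euclidean spaces\<close>

text \<open>For an open set \<open>S\<close> of a Euclidean space this is the usual notion of a map of class \<open>C\<^sup>k\<close>.\<close>

fun Ck_on :: "nat \<Rightarrow> 'a::euclidean_space set \<Rightarrow> ('a \<Rightarrow> 'b::real_normed_vector) \<Rightarrow> bool" where
  "Ck_on 0 S F \<longleftrightarrow> continuous_on S F"
| "Ck_on (Suc k) S F \<longleftrightarrow>
     (\<forall>x\<in>S. F differentiable (at x)) \<and>
     (\<forall>u. Ck_on k S (\<lambda>x. frechet_derivative F (at x) u))"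

definition smooth_on :: "'a::euclidean_space set \<Rightarrow> ('a \<Rightarrow> 'b::real_normed_vector) \<Rightarrow> bool" where
  "smooth_on S F \<longleftrightarrow> (\<forall>k. Ck_on k S F)"


section \<open>Smooth manifolds\<close>

text \<open>A manifold with point type \<open>'p\<close> (all of whose elements are points) modelled on \<open>'e\<close> is
  given by an atlas that contains a chosen chart \<open>(U, \<phi>)\<close> around each point. Every smooth structure
  arises from such an atlas. The tangent space at \<open>p\<close> is the model space \<open>'e\<close>, a tangent vector
  being identified with its components in the chart chosen at \<open>p\<close>; hence vector fields are
  functions \<open>'p \<Rightarrow> 'e\<close>, whose values at different points refer to different charts.
  Model spaces of type class \<open>euclidean_space\<close> have positive dimension.\<close>

type_synonym ('p, 'e) atlas = "'p \<Rightarrow> 'p set \<times> ('p \<Rightarrow> 'e)"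

definition chart_dom :: "('p, 'e) atlas \<Rightarrow> 'p \<Rightarrow> 'p set" where
  "chart_dom A a = fst (A a)"

definition chart :: "('p, 'e) atlas \<Rightarrow> 'p \<Rightarrow> 'p \<Rightarrow> 'e" where
  "chart A a = snd (A a)"

definition chart_inv :: "('p, 'e) atlas \<Rightarrow> 'p \<Rightarrow> 'e \<Rightarrow> 'p" where
  "chart_inv A a = inv_into (chart_dom A a) (chart A a)"

definition smooth_manifold ::
  "('p::{t2_space,second_countable_topology}, 'e::euclidean_space) atlas \<Rightarrow> bool" where
  "smooth_manifold A \<longleftrightarrow>
     (\<forall>a. open (chart_dom A a) \<and> a \<in> chart_dom A a \<and>
          open (chart A a ` chart_dom A a) \<and>
          homeomorphism (chart_dom A a) (chart A a ` chart_dom A a) (chart A a) (chart_inv A a)) \<and>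
     (\<forall>a b. smooth_on (chart A a ` (chart_dom A a \<inter> chart_dom A b)) (chart A b \<circ> chart_inv A a))"

definition smooth_fun ::
  "('p::topological_space, 'e::euclidean_space) atlas \<Rightarrow> 'p set \<Rightarrow> ('p \<Rightarrow> real) \<Rightarrow> bool" where
  "smooth_fun A W F \<longleftrightarrow> (\<forall>a. smooth_on (chart A a ` (W \<inter> chart_dom A a)) (F \<circ> chart_inv A a))"

definition smooth_map ::
  "('p::topological_space, 'e::euclidean_space) atlas \<Rightarrow>
   ('n::topological_space, 'q::euclidean_space) atlas \<Rightarrow> ('p \<Rightarrow> 'n) \<Rightarrow> bool" where
  "smooth_map A N F \<longleftrightarrow> continuous_on UNIV F \<and>
     (\<forall>a b. smooth_on (chart A a ` (chart_dom A a \<inter> F -` chart_dom N b))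
                      (chart N b \<circ> F \<circ> chart_inv A a))"

definition differential ::
  "('p, 'e::euclidean_space) atlas \<Rightarrow> ('n, 'q::euclidean_space) atlas \<Rightarrow> ('p \<Rightarrow> 'n) \<Rightarrow>
   'p \<Rightarrow> 'e \<Rightarrow> 'q" where
  "differential A N F p u =
     frechet_derivative (chart N (F p) \<circ> F \<circ> chart_inv A p) (at (chart A p p)) u"

text \<open>The directional derivative \<open>u F\<close> of a function \<open>F\<close> by the tangent vector \<open>u\<close> at \<open>p\<close>.\<close>

definition dir_deriv ::
  "('p, 'e::euclidean_space) atlas \<Rightarrow> ('p \<Rightarrow> real) \<Rightarrow> 'p \<Rightarrow> 'e \<Rightarrow> real" where
  "dir_deriv A F p u = frechet_derivative (F \<circ> chart_inv A p) (at (chart A p p)) u"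

text \<open>Components, in the chart chosen at \<open>a\<close>, of the tangent vector \<open>u\<close> at the point \<open>q\<close> in the
  domain of that chart.\<close>

definition components ::
  "('p, 'e::euclidean_space) atlas \<Rightarrow> 'p \<Rightarrow> 'p \<Rightarrow> 'e \<Rightarrow> 'e" where
  "components A a q u = frechet_derivative (chart A a \<circ> chart_inv A q) (at (chart A q q)) u"

definition local_rep ::
  "('p, 'e::euclidean_space) atlas \<Rightarrow> 'p \<Rightarrow> ('p \<Rightarrow> 'e) \<Rightarrow> 'e \<Rightarrow> 'e" where
  "local_rep A a X x = components A a (chart_inv A a x) (X (chart_inv A a x))"

definition smooth_vector_field ::
  "('p::topological_space, 'e::euclidean_space) atlas \<Rightarrow> 'p set \<Rightarrow> ('p \<Rightarrow> 'e) \<Rightarrow> bool" where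
  "smooth_vector_field A W X \<longleftrightarrow>
     (\<forall>a. smooth_on (chart A a ` (W \<inter> chart_dom A a)) (local_rep A a X))"

text \<open>The vector field on \<open>chart_dom A a\<close> that has the constant components \<open>w\<close> in the chart chosen
  at \<open>a\<close>, i.e. a linear combination of the coordinate vector fields.\<close>

definition coord_field ::
  "('p, 'e::euclidean_space) atlas \<Rightarrow> 'p \<Rightarrow> 'e \<Rightarrow> 'p \<Rightarrow> 'e" where
  "coord_field A a w q = frechet_derivative (chart A q \<circ> chart_inv A a) (at (chart A a q)) w"

text \<open>\<open>[X, Y]\<close> at \<open>p\<close>, computed in the chart chosen at \<open>p\<close>.\<close>

definition lie_bracket ::
  "('p, 'e::euclidean_space) atlas \<Rightarrow> ('p \<Rightarrow> 'e) \<Rightarrow> ('p \<Rightarrow> 'e) \<Rightarrow> 'p \<Rightarrow> 'e" where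
  "lie_bracket A X Y p =
     frechet_derivative (local_rep A p Y) (at (chart A p p)) (X p) -
     frechet_derivative (local_rep A p X) (at (chart A p p)) (Y p)"


section \<open>Riemannian metrics and the Levi-Civita connection\<close>

definition riemannian_manifold ::
  "('p::{t2_space,second_countable_topology}, 'e::euclidean_space) atlas \<Rightarrow>
   ('p \<Rightarrow> 'e \<Rightarrow> 'e \<Rightarrow> real) \<Rightarrow> bool" where
  "riemannian_manifold A g \<longleftrightarrow> smooth_manifold A \<and>
     (\<forall>p. bilinear (g p) \<and> (\<forall>u w. g p u w = g p w u) \<and> (\<forall>u. u \<noteq> 0 \<longrightarrow> g p u u > 0)) \<and>
     (\<forall>W X Y. open W \<and> smooth_vector_field A W X \<and> smooth_vector_field A W Y \<longrightarrow>
        smooth_fun A W (\<lambda>p. g p (X p) (Y p)))"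

text \<open>\<open>D p u Y\<close> stands for \<open>\<nabla>\<^sub>u Y\<close>, where \<open>u\<close> is a tangent vector at \<open>p\<close> and \<open>Y\<close> is a vector
  field that is smooth near \<open>p\<close>. Vector fields are total functions, so that locality has to be
  demanded.\<close>

type_synonym ('p, 'e) connection = "'p \<Rightarrow> 'e \<Rightarrow> ('p \<Rightarrow> 'e) \<Rightarrow> 'e"

definition affine_connection ::
  "('p::topological_space, 'e::euclidean_space) atlas \<Rightarrow> ('p, 'e) connection \<Rightarrow> bool" where
  "affine_connection A D \<longleftrightarrow>
     (\<forall>W X Y. open W \<and> smooth_vector_field A W X \<and> smooth_vector_field A W Y \<longrightarrow>
        (\<forall>p\<in>W. linear (\<lambda>u. D p u Y) \<and>
               (\<forall>u. D p u (\<lambda>q. X q + Y q) = D p u X + D p u Y) \<and>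
               (\<forall>F u. smooth_fun A W F \<longrightarrow>
                  D p u (\<lambda>q. F q *\<^sub>R Y q) = dir_deriv A F p u *\<^sub>R Y p + F p *\<^sub>R D p u Y) \<and>
               ((\<forall>q\<in>W. X q = Y q) \<longrightarrow> (\<forall>u. D p u X = D p u Y))) \<and>
        smooth_vector_field A W (\<lambda>p. D p (X p) Y))"

definition levi_civita ::
  "('p::topological_space, 'e::euclidean_space) atlas \<Rightarrow> ('p \<Rightarrow> 'e \<Rightarrow> 'e \<Rightarrow> real) \<Rightarrow>
   ('p, 'e) connection \<Rightarrow> bool" where
  "levi_civita A g D \<longleftrightarrow> affine_connection A D \<and>
     (\<forall>W X Y. open W \<and> smooth_vector_field A W X \<and> smooth_vector_field A W Y \<longrightarrow>
        (\<forall>p\<in>W. (\<forall>u. dir_deriv A (\<lambda>q. g q (X q) (Y q)) p u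
                      = g p (D p u X) (Y p) + g p (X p) (D p u Y)) \<and>
               D p (X p) Y - D p (Y p) X = lie_bracket A X Y p))"

text \<open>\<open>R(X,Y)Z = \<nabla>\<^sub>X \<nabla>\<^sub>Y Z - \<nabla>\<^sub>Y \<nabla>\<^sub>X Z - \<nabla>\<^bsub>[X,Y]\<^esub> Z\<close>\<close>

definition curvature ::
  "('p, 'e::euclidean_space) atlas \<Rightarrow> ('p, 'e) connection \<Rightarrow>
   ('p \<Rightarrow> 'e) \<Rightarrow> ('p \<Rightarrow> 'e) \<Rightarrow> ('p \<Rightarrow> 'e) \<Rightarrow> 'p \<Rightarrow> 'e" where
  "curvature A D X Y Z p =
     D p (X p) (\<lambda>q. D q (Y q) Z) - D p (Y p) (\<lambda>q. D q (X q) Z) - D p (lie_bracket A X Y p) Z"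

definition orthonormal_frame ::
  "('p::topological_space, 'e::euclidean_space) atlas \<Rightarrow> ('p \<Rightarrow> 'e \<Rightarrow> 'e \<Rightarrow> real) \<Rightarrow> 'p set \<Rightarrow>
   (nat \<Rightarrow> 'p \<Rightarrow> 'e) \<Rightarrow> bool" where
  "orthonormal_frame A g W v \<longleftrightarrow>
     (\<forall>i\<in>{1..DIM('e)}. smooth_vector_field A W (v i)) \<and>
     (\<forall>p\<in>W. \<forall>i\<in>{1..DIM('e)}. \<forall>j\<in>{1..DIM('e)}. g p (v i p) (v j p) = (if i = j then 1 else 0))"

text \<open>The Laplacian with the sign convention \<open>\<triangle>F = \<Sum>\<^sub>i ((\<nabla>\<^bsub>v\<^sub>i\<^esub> v\<^sub>i) F - v\<^sub>i (v\<^sub>i F))\<close>, i.e. minus the trace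
  of the Hessian, evaluated in a local orthonormal frame \<open>v\<close> around \<open>p\<close>. For a warping function
  \<open>f\<close> on the base \<open>B\<close>, \<open>\<triangle>f\<close> is the Laplacian of \<open>(B, g\<^sub>B)\<close>, so that \<open>\<triangle>f / f\<close> is the sum of the
  sectional curvatures of the planes spanned by \<open>e\<^sub>1, ..., e\<^sub>n\<close> (an orthonormal basis tangent to \<open>B\<close>,
  of dimension \<open>n\<close>) and a fixed unit vector tangent to the fibre. The Laplacian of the pullback of
  \<open>f\<close> to the warped product would differ from it by \<open>- dim F \<cdot> |grad f|\<^sup>2 / f\<close>.\<close>

definition laplacian ::
  "('p, 'e::euclidean_space) atlas \<Rightarrow> ('p, 'e) connection \<Rightarrow> (nat \<Rightarrow> 'p \<Rightarrow> 'e) \<Rightarrow>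
   ('p \<Rightarrow> real) \<Rightarrow> 'p \<Rightarrow> real" where
  "laplacian A D v F p =
     (\<Sum>i=1..DIM('e). dir_deriv A F p (D p (v i p) (v i))
                     - dir_deriv A (\<lambda>q. dir_deriv A F q (v i q)) p (v i p))"


section \<open>Warped products\<close>

definition product_atlas ::
  "('b, 'e) atlas \<Rightarrow> ('f, 'k) atlas \<Rightarrow> ('b \<times> 'f, 'e \<times> 'k) atlas" where
  "product_atlas A B = (\<lambda>(a, b). (chart_dom A a \<times> chart_dom B b, map_prod (chart A a) (chart B b)))"

definition warped_metric ::
  "('b \<Rightarrow> 'e \<Rightarrow> 'e \<Rightarrow> real) \<Rightarrow> ('b \<Rightarrow> real) \<Rightarrow> ('f \<Rightarrow> 'k \<Rightarrow> 'k \<Rightarrow> real) \<Rightarrow>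
   'b \<times> 'f \<Rightarrow> 'e \<times> 'k \<Rightarrow> 'e \<times> 'k \<Rightarrow> real" where
  "warped_metric gB f gF =
     (\<lambda>p u w. gB (fst p) (fst u) (fst w) + (f (fst p))\<^sup>2 * gF (snd p) (snd u) (snd w))"


section \<open>Isometric immersions\<close>

definition isometric_immersion ::
  "('p::topological_space, 'e::euclidean_space) atlas \<Rightarrow> ('p \<Rightarrow> 'e \<Rightarrow> 'e \<Rightarrow> real) \<Rightarrow>
   ('n::topological_space, 'q::euclidean_space) atlas \<Rightarrow> ('n \<Rightarrow> 'q \<Rightarrow> 'q \<Rightarrow> real) \<Rightarrow>
   ('p \<Rightarrow> 'n) \<Rightarrow> bool" where
  "isometric_immersion A g N gN \<psi> \<longleftrightarrow>
     smooth_map A N \<psi> \<and>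
     (\<forall>p. inj (differential A N \<psi> p)) \<and>
     (\<forall>p u w. gN (\<psi> p) (differential A N \<psi> p u) (differential A N \<psi> p w) = g p u w)"

text \<open>The covariant derivative along \<open>\<psi>\<close> of a vector field \<open>V\<close> along \<open>\<psi>\<close> (so \<open>V q\<close> is tangent to
  the target at \<open>\<psi> q\<close>). If \<open>V = \<Sum>\<^sub>k V\<^sup>k \<cdot> (\<partial>\<^sub>k \<circ> \<psi>)\<close> with the coordinate fields of the chart chosen
  at \<open>\<psi> p\<close>, it is \<open>\<Sum>\<^sub>k ((u V\<^sup>k) \<partial>\<^sub>k + V\<^sup>k \<nabla>\<^bsub>d\<psi> u\<^esub> \<partial>\<^sub>k)\<close>. For \<open>V = Z \<circ> \<psi>\<close> this is \<open>\<nabla>\<^bsub>d\<psi> u\<^esub> Z\<close>.\<close>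

definition covariant_deriv_along ::
  "('p, 'e::euclidean_space) atlas \<Rightarrow> ('n, 'q::euclidean_space) atlas \<Rightarrow> ('n, 'q) connection \<Rightarrow>
   ('p \<Rightarrow> 'n) \<Rightarrow> 'p \<Rightarrow> 'e \<Rightarrow> ('p \<Rightarrow> 'q) \<Rightarrow> 'q" where
  "covariant_deriv_along A N DN \<psi> p u V =
     frechet_derivative
       (\<lambda>x. components N (\<psi> p) (\<psi> (chart_inv A p x)) (V (chart_inv A p x))) (at (chart A p p)) u
     + DN (\<psi> p) (differential A N \<psi> p u) (coord_field N (\<psi> p) (V p))"

text \<open>The second fundamental form by the Gauss formula: \<open>h(X,Y) = \<nabla>'\<^sub>X (d\<psi> Y) - d\<psi> (\<nabla>\<^sub>X Y)\<close>, with
  the connection \<open>\<nabla>'\<close> of the ambient manifold.\<close>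

definition second_fundamental_form ::
  "('p, 'e::euclidean_space) atlas \<Rightarrow> ('p, 'e) connection \<Rightarrow>
   ('n, 'q::euclidean_space) atlas \<Rightarrow> ('n, 'q) connection \<Rightarrow> ('p \<Rightarrow> 'n) \<Rightarrow>
   ('p \<Rightarrow> 'e) \<Rightarrow> ('p \<Rightarrow> 'e) \<Rightarrow> 'p \<Rightarrow> 'q" where
  "second_fundamental_form A D N DN \<psi> X Y p =
     covariant_deriv_along A N DN \<psi> p (X p) (\<lambda>q. differential A N \<psi> q (Y q))
     - differential A N \<psi> p (D p (X p) Y)"

definition mean_curvature_vector ::
  "('p, 'e::euclidean_space) atlas \<Rightarrow> ('p, 'e) connection \<Rightarrow>
   ('n, 'q::euclidean_space) atlas \<Rightarrow> ('n, 'q) connection \<Rightarrow> ('p \<Rightarrow> 'n) \<Rightarrow>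
   (nat \<Rightarrow> 'p \<Rightarrow> 'e) \<Rightarrow> 'p \<Rightarrow> 'q" where
  "mean_curvature_vector A D N DN \<psi> v p =
     (1 / real DIM('e)) *\<^sub>R (\<Sum>i=1..DIM('e). second_fundamental_form A D N DN \<psi> (v i) (v i) p)"

definition sff_norm_sq ::
  "('p, 'e::euclidean_space) atlas \<Rightarrow> ('p, 'e) connection \<Rightarrow>
   ('n, 'q::euclidean_space) atlas \<Rightarrow> ('n \<Rightarrow> 'q \<Rightarrow> 'q \<Rightarrow> real) \<Rightarrow> ('n, 'q) connection \<Rightarrow>
   ('p \<Rightarrow> 'n) \<Rightarrow> (nat \<Rightarrow> 'p \<Rightarrow> 'e) \<Rightarrow> 'p \<Rightarrow> real" where
  "sff_norm_sq A D N gN DN \<psi> v p =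
     (\<Sum>i=1..DIM('e). \<Sum>j=1..DIM('e).
        gN (\<psi> p) (second_fundamental_form A D N DN \<psi> (v i) (v j) p)
                 (second_fundamental_form A D N DN \<psi> (v i) (v j) p))"


section \<open>Quaternionic space forms\<close>

text \<open>Three almost Hermitian structures at the point \<open>p\<close> that satisfy the quaternion relations.\<close>

definition quaternionic_triple ::
  "('n \<Rightarrow> 'q::euclidean_space \<Rightarrow> 'q \<Rightarrow> real) \<Rightarrow> 'n \<Rightarrow> (nat \<Rightarrow> 'q \<Rightarrow>\<^sub>L 'q) \<Rightarrow> bool" where
  "quaternionic_triple g p J \<longleftrightarrow>
     (\<forall>\<alpha>\<in>{1..3}. J \<alpha> o\<^sub>L J \<alpha> = - id_blinfun \<and> (\<forall>u w. g p (J \<alpha> u) (J \<alpha> w) = g p u w)) \<and>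
     J 1 o\<^sub>L J 2 = J 3 \<and> J 2 o\<^sub>L J 1 = - J 3"

text \<open>A section of the endomorphism bundle is smooth iff it maps smooth vector fields to smooth
  vector fields.\<close>

definition smooth_endomorphism_field ::
  "('n::topological_space, 'q::euclidean_space) atlas \<Rightarrow> 'n set \<Rightarrow> ('n \<Rightarrow> 'q \<Rightarrow>\<^sub>L 'q) \<Rightarrow> bool" where
  "smooth_endomorphism_field N W S \<longleftrightarrow>
     (\<forall>V Y. open V \<and> V \<subseteq> W \<and> smooth_vector_field N V Y \<longrightarrow>
        smooth_vector_field N V (\<lambda>q. S q (Y q)))"

text \<open>\<open>E p\<close> is the fibre at \<open>p\<close> of the rank-3 bundle. The last clause says that \<open>E\<close> is parallel:
  \<open>\<nabla>\<^sub>u S\<close>, given by \<open>(\<nabla>\<^sub>u S) Y = \<nabla>\<^sub>u (S Y) - S (\<nabla>\<^sub>u Y)\<close>, belongs to \<open>E\<close> for all local sections \<open>S\<close>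
  of \<open>E\<close>.\<close>

definition quaternionic_kaehler ::
  "('n::{t2_space,second_countable_topology}, 'q::euclidean_space) atlas \<Rightarrow>
   ('n \<Rightarrow> 'q \<Rightarrow> 'q \<Rightarrow> real) \<Rightarrow> ('n, 'q) connection \<Rightarrow> ('n \<Rightarrow> ('q \<Rightarrow>\<^sub>L 'q) set) \<Rightarrow> bool" where
  "quaternionic_kaehler N g D E \<longleftrightarrow>
     riemannian_manifold N g \<and> levi_civita N g D \<and>
     (\<forall>p. \<exists>W J. open W \<and> p \<in> W \<and>
        (\<forall>\<alpha>\<in>{1..3::nat}. smooth_endomorphism_field N W (J \<alpha>)) \<and>
        (\<forall>q\<in>W. quaternionic_triple g q (\<lambda>\<alpha>. J \<alpha> q) \<and> E q = span {J 1 q, J 2 q, J 3 q})) \<and>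
     (\<forall>W S p u. open W \<and> p \<in> W \<and> smooth_endomorphism_field N W S \<and> (\<forall>q\<in>W. S q \<in> E q) \<longrightarrow>
        (\<exists>K\<in>E p. \<forall>V Y. open V \<and> p \<in> V \<and> V \<subseteq> W \<and> smooth_vector_field N V Y \<longrightarrow>
           D p u (\<lambda>q. S q (Y q)) - S p (D p u Y) = K (Y p)))"

text \<open>The sectional curvature of the planes spanned by \<open>X\<close> and a vector \<open>Y\<close> of the quaternionic
  section \<open>Q(X) = span {X, J\<^sub>1 X, J\<^sub>2 X, J\<^sub>3 X}\<close> is \<open>c\<close>. (Any plane in a quaternionic section is of
  this form, as \<open>Q(X) = Q(Z)\<close> for nonzero \<open>X \<in> Q(Z)\<close>.)\<close>

definition constant_quaternionic_curvature ::
  "('n::topological_space, 'q::euclidean_space) atlas \<Rightarrow> ('n \<Rightarrow> 'q \<Rightarrow> 'q \<Rightarrow> real) \<Rightarrow>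
   ('n, 'q) connection \<Rightarrow> ('n \<Rightarrow> ('q \<Rightarrow>\<^sub>L 'q) set) \<Rightarrow> real \<Rightarrow> bool" where
  "constant_quaternionic_curvature N g D E c \<longleftrightarrow>
     (\<forall>W X Y p. open W \<and> p \<in> W \<and> smooth_vector_field N W X \<and> smooth_vector_field N W Y \<and>
        X p \<noteq> 0 \<and> Y p \<in> span (insert (X p) ((\<lambda>K. blinfun_apply K (X p)) ` E p)) \<and>
        Y p \<notin> span {X p} \<longrightarrow>
        g p (curvature N D X Y Y p) (X p)
          / (g p (X p) (X p) * g p (Y p) (Y p) - (g p (X p) (Y p))\<^sup>2) = c)"

definition quaternionic_space_form ::
  "('n::{t2_space,second_countable_topology}, 'q::euclidean_space) atlas \<Rightarrow>
   ('n \<Rightarrow> 'q \<Rightarrow> 'q \<Rightarrow> real) \<Rightarrow> ('n, 'q) connection \<Rightarrow> ('n \<Rightarrow> ('q \<Rightarrow>\<^sub>L 'q) set) \<Rightarrow> real \<Rightarrow> bool" where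
  "quaternionic_space_form N g D E c \<longleftrightarrow>
     quaternionic_kaehler N g D E \<and>
     constant_quaternionic_curvature N g D E c \<and>
     (\<forall>W X Y Z p J. open W \<and> p \<in> W \<and> smooth_vector_field N W X \<and> smooth_vector_field N W Y \<and>
        smooth_vector_field N W Z \<and> quaternionic_triple g p J \<and> (\<forall>\<alpha>\<in>{1..3}. J \<alpha> \<in> E p) \<longrightarrow>
        curvature N D X Y Z p =
          (c / 4) *\<^sub>R (g p (Y p) (Z p) *\<^sub>R X p - g p (X p) (Z p) *\<^sub>R Y p
             + (\<Sum>\<alpha>=1..3. g p (J \<alpha> (Y p)) (Z p) *\<^sub>R J \<alpha> (X p)
                        - g p (J \<alpha> (X p)) (Z p) *\<^sub>R J \<alpha> (Y p)
                        - (2 * g p (J \<alpha> (X p)) (Y p)) *\<^sub>R J \<alpha> (Z p))))"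

end

(*
For unit vectors X tangent to the base and Z tangent to the fibre, the Gauss equation and the
warped product structure give
  ((nabla_X X) f - X^2 f) / f = K(X, Z) + <h(X,X), h(Z,Z)> - |h(X,Z)|^2,
where K is the ambient sectional curvature. By the curvature formula and Bessel's inequality
for the orthonormal vectors J_1 X, J_2 X, J_3 X, it is c/4 (1 + 3t) with 0 <= t <= 1. Summing
over an orthonormal basis of the base expresses Laplacian(f) / f for each fixed Z.
Upper bound: sum also over Z in an orthonormal basis of the fibre; the terms <h(X,X), h(Z,Z)>
add up to <a, b> <= |a + b|^2 / 4, where a + b = m H.
Lower bound: Chen's inequality for each pair (X, Z) separately.
All identities are verified in the charts chosen at p and psi(p). The Gauss equation is obtained
there without the curvature tensor of the warped product, by differentiating the metric twice.
*)
theory Submission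
  imports Defs
begin

section \<open>Calculus on open subsets of Euclidean spaces\<close>

text \<open>Tangent vectors at q are components in the chart chosen at q, so a vector field has no
  fixed chart. In the charts centred at p and psi(p) components at the centre are the vectors
  themselves, and the immersion is a map between open Euclidean sets; this dictates the route. The
  metric of M is differentiated only after it is recognised as the pull-back of the ambient one. The
  two directions are special: a tangent to B, z tangent to F. In product coordinates they are
  orthogonal near p and |a|^2 is constant along z, so the Koszul formulas lose nearly all terms and
  only |z|^2 = f^2 g_F(z,z) is differentiated twice. Its second derivative contains (a f)^2, which
  the mixed Christoffel symbol cancels; what stays is the Hessian of f on B, whatever unit z was
  chosen. Hence one may average over the fibre for the upper bound (the source of 1/m_2) and pick a
  single Z for the lower one. The frame v of M is arbitrary, the argument needs one adapted to the
  product: H and |h|^2 are traces of bilinear forms at p, so they survive the change. The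
  denominator m - 1 comes from Cauchy-Schwarz for m - 1 vectors in Chen's inequality.\<close>

abbreviation fd :: "('a::euclidean_space \<Rightarrow> 'b::real_normed_vector) \<Rightarrow> 'a \<Rightarrow> 'a \<Rightarrow> 'b"
  where "fd F x \<equiv> frechet_derivative F (at x)"

lemma fd_eqI: "(F has_derivative F') (at x) \<Longrightarrow> fd F x = F'"
  by (rule frechet_derivative_at[symmetric])

lemma fd_has_derivative: "F differentiable (at x) \<Longrightarrow> (F has_derivative fd F x) (at x)"
  by (simp add: frechet_derivative_works)

lemma has_derivative_cong_open:
  assumes "open S" "x \<in> S" "\<And>y. y \<in> S \<Longrightarrow> F y = G y"
  shows "(F has_derivative F') (at x) \<longleftrightarrow> (G has_derivative F') (at x)"
  using has_derivative_transform_within_open[of F F' x UNIV S G]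
    has_derivative_transform_within_open[of G F' x UNIV S F] assms by fastforce

lemma fd_cong_open:
  assumes "open S" "x \<in> S" "\<And>y. y \<in> S \<Longrightarrow> F y = G y"
  shows "fd F x = fd G x"
  unfolding frechet_derivative_def using has_derivative_cong_open[OF assms] by simp

lemma differentiable_cong_open:
  assumes "open S" "x \<in> S" "\<And>y. y \<in> S \<Longrightarrow> F y = G y"
  shows "F differentiable (at x) \<longleftrightarrow> G differentiable (at x)"
  unfolding differentiable_def using has_derivative_cong_open[OF assms] by simp

lemma linear_euclidean_expand:
  fixes F :: "'a::euclidean_space \<Rightarrow> 'b::real_normed_vector"
  assumes "linear L"
  shows "L (u::'a) = (\<Sum>b\<in>Basis. (u \<bullet> b) *\<^sub>R (L b :: 'b))"
proof -
  have "L u = L (\<Sum>b\<in>Basis. (u \<bullet> b) *\<^sub>R b)" by (simp add: euclidean_representation)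
  also have "\<dots> = (\<Sum>b\<in>Basis. (u \<bullet> b) *\<^sub>R L b)"
    by (simp add: linear_sum[OF assms] linear_scale[OF assms])
  finally show ?thesis .
qed

text \<open>\<open>Ck_on\<close> uses derivatives in the whole space, and openness of
  \<open>S\<close> makes values on \<open>S\<close> determine them. This supports the pattern used
  below: find a C^k formula for the derivative on \<open>S\<close>, then transfer it to the
  derivative itself.\<close>

lemma Ck_on_cong:
  assumes "open S" "\<And>x. x \<in> S \<Longrightarrow> F x = G x"
  shows "Ck_on k S F \<longleftrightarrow> Ck_on k S G"
  using assms(2)
proof (induction k arbitrary: F G)
  case 0 then show ?case by (simp cong: continuous_on_cong)
next
  case (Suc k)
  have "Ck_on k S (\<lambda>x. fd F x u) \<longleftrightarrow> Ck_on k S (\<lambda>x. fd G x u)" for u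
    by (rule Suc.IH) (use fd_cong_open[OF assms(1) _ Suc.prems] in auto)
  then show ?case using differentiable_cong_open[OF assms(1) _ Suc.prems] by auto
qed

lemma Ck_on_congI:
  assumes "open S" "Ck_on k S F" "\<And>x. x \<in> S \<Longrightarrow> G x = F x"
  shows "Ck_on k S G"
  using assms Ck_on_cong[of S G F k] by simp

lemma Ck_on_SucD: "Ck_on (Suc k) S F \<Longrightarrow> Ck_on k S F"
proof (induction k arbitrary: F)
  case 0 then show ?case
    using continuous_at_imp_continuous_on differentiable_imp_continuous_within by fastforce
next
  case (Suc k) then show ?case by (metis Ck_on.simps(2))
qed

lemma Ck_on_subset: "Ck_on k S F \<Longrightarrow> T \<subseteq> S \<Longrightarrow> Ck_on k T F"
  by (induction k arbitrary: F) (auto intro: continuous_on_subset)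

lemma Ck_on_const: "Ck_on k S (\<lambda>x. c)"
  by (induction k arbitrary: c) auto

lemma Ck_on_add:
  assumes "open S" "Ck_on k S F" "Ck_on k S G"
  shows "Ck_on k S (\<lambda>x. F x + G x)"
  using assms(2,3)
proof (induction k arbitrary: F G)
  case 0 then show ?case by (simp add: continuous_on_add)
next
  case (Suc k)
  have "Ck_on k S (\<lambda>x. fd (\<lambda>x. F x + G x) x u)" for u
  proof -
    have "Ck_on k S (\<lambda>x. fd F x u + fd G x u)" using Suc by auto
    moreover have "fd (\<lambda>x. F x + G x) x u = fd F x u + fd G x u" if "x \<in> S" for x
      using Suc.prems that by (subst fd_eqI[OF has_derivative_add[OF fd_has_derivative fd_has_derivative]]) auto
    ultimately show ?thesis by (rule Ck_on_congI[OF assms(1)])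
  qed
  then show ?case using Suc.prems by auto
qed

lemma Ck_on_bounded_linear:
  assumes "open S" "bounded_linear L" "Ck_on k S F"
  shows "Ck_on k S (\<lambda>x. L (F x))"
  using assms(3)
proof (induction k arbitrary: F)
  case 0 then show ?case using assms(2) by (simp add: bounded_linear.continuous_on)
next
  case (Suc k)
  have d: "((\<lambda>x. L (F x)) has_derivative (\<lambda>u. L (fd F x u))) (at x)" if "x \<in> S" for x
    using bounded_linear.has_derivative[OF assms(2) fd_has_derivative] Suc.prems that by auto
  have "Ck_on k S (\<lambda>x. fd (\<lambda>x. L (F x)) x u)" for u
  proof -
    have "Ck_on k S (\<lambda>x. L (fd F x u))" using Suc by auto
    moreover have "fd (\<lambda>x. L (F x)) x u = L (fd F x u)" if "x \<in> S" for x
      using fd_eqI[OF d[OF that]] by simp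
    ultimately show ?thesis by (rule Ck_on_congI[OF assms(1)])
  qed
  then show ?case using d by (auto intro: Derivative.differentiableI)
qed

text \<open>By the Leibniz rule the derivative is a sum of two bilinear expressions; the factor left
  undifferentiated is brought down one order by \<open>Ck_on_SucD\<close>, so the induction
  hypothesis applies to both.\<close>

lemma Ck_on_bounded_bilinear:
  assumes "open S" "bounded_bilinear B" "Ck_on k S F" "Ck_on k S G"
  shows "Ck_on k S (\<lambda>x. B (F x) (G x))"
  using assms(3,4)
proof (induction k arbitrary: F G)
  case 0 then show ?case using assms(2) by (simp add: bounded_bilinear.continuous_on)
next
  case (Suc k)
  have d: "((\<lambda>x. B (F x) (G x)) has_derivative (\<lambda>u. B (F x) (fd G x u) + B (fd F x u) (G x))) (at x)"
    if "x \<in> S" for x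
    by (rule bounded_bilinear.FDERIV[OF assms(2) fd_has_derivative fd_has_derivative])
      (use Suc.prems that in auto)
  have "Ck_on k S (\<lambda>x. fd (\<lambda>x. B (F x) (G x)) x u)" for u
  proof -
    have "Ck_on k S (\<lambda>x. B (F x) (fd G x u) + B (fd F x u) (G x))"
      using Suc.prems Ck_on_SucD[OF Suc.prems(1)] Ck_on_SucD[OF Suc.prems(2)]
      by (intro Ck_on_add assms(1) Suc.IH) auto
    moreover have "fd (\<lambda>x. B (F x) (G x)) x u = B (F x) (fd G x u) + B (fd F x u) (G x)" if "x \<in> S" for x
      using fd_eqI[OF d[OF that]] by simp
    ultimately show ?thesis by (rule Ck_on_congI[OF assms(1)])
  qed
  then show ?case using d by (auto intro: Derivative.differentiableI)
qed

lemma Ck_on_sum: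
  assumes "open S" "\<And>i. i \<in> I \<Longrightarrow> Ck_on k S (F i)"
  shows "Ck_on k S (\<lambda>x. \<Sum>i\<in>I. F i x)"
  using assms(2)
  by (induction I rule: infinite_finite_induct) (auto simp: Ck_on_const intro!: Ck_on_add assms(1))

text \<open>The chain rule evaluates the derivative of \<open>G\<close> in the moving direction
  \<open>fd F x u\<close>, whereas the induction hypothesis covers fixed directions. Expanding the
  direction in \<open>Basis\<close> leaves sums of products with fixed directions.\<close>

lemma Ck_on_compose:
  assumes "open S" "open T" "\<And>x. x \<in> S \<Longrightarrow> F x \<in> T" "Ck_on k S F" "Ck_on k T G"
  shows "Ck_on k S (\<lambda>x. G (F x))"
  using assms(4,5)
proof (induction k arbitrary: G)
  case 0 then show ?case using assms(3) by (auto intro: continuous_on_compose2)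
next
  case (Suc k)
  have d: "((\<lambda>x. G (F x)) has_derivative (\<lambda>u. fd G (F x) (fd F x u))) (at x)" if "x \<in> S" for x
    using diff_chain_at[OF fd_has_derivative fd_has_derivative, of F x G] Suc.prems assms(3) that
    by (auto simp: o_def)
  have "Ck_on k S (\<lambda>x. fd (\<lambda>x. G (F x)) x u)" for u
  proof -
    have "Ck_on k S (\<lambda>x. \<Sum>b\<in>Basis. (fd F x u \<bullet> b) *\<^sub>R fd G (F x) b)"
      using Suc.prems Ck_on_SucD[OF Suc.prems(1)]
      by (intro Ck_on_sum assms(1) Ck_on_bounded_bilinear[OF assms(1) bounded_bilinear_scaleR] Suc.IH
           Ck_on_bounded_linear[OF assms(1) bounded_linear_inner_left]) auto
    moreover have "fd (\<lambda>x. G (F x)) x u = (\<Sum>b\<in>Basis. (fd F x u \<bullet> b) *\<^sub>R fd G (F x) b)" if "x \<in> S" for x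
      using fd_eqI[OF d[OF that]] Suc.prems(2) assms(3) that
        linear_euclidean_expand[of "fd G (F x)" "fd F x u"] linear_frechet_derivative by auto
    ultimately show ?thesis by (rule Ck_on_congI[OF assms(1)])
  qed
  then show ?case using d by (auto intro: Derivative.differentiableI)
qed

lemma smooth_on_cong:
  assumes "open S" "\<And>x. x \<in> S \<Longrightarrow> F x = G x"
  shows "smooth_on S F \<longleftrightarrow> smooth_on S G"
  using Ck_on_cong[OF assms] by (simp add: smooth_on_def)

lemma smooth_on_congI:
  assumes "open S" "smooth_on S F" "\<And>x. x \<in> S \<Longrightarrow> G x = F x"
  shows "smooth_on S G"
  using assms smooth_on_cong[of S G F] by simp

lemma smooth_on_subset: "smooth_on S F \<Longrightarrow> T \<subseteq> S \<Longrightarrow> smooth_on T F"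
  by (auto simp: smooth_on_def intro: Ck_on_subset)

lemma smooth_on_const: "smooth_on S (\<lambda>x. c)"
  by (simp add: smooth_on_def Ck_on_const)

lemma smooth_on_add: "open S \<Longrightarrow> smooth_on S F \<Longrightarrow> smooth_on S G \<Longrightarrow> smooth_on S (\<lambda>x. F x + G x)"
  by (simp add: smooth_on_def Ck_on_add)

lemma smooth_on_bounded_linear:
  "open S \<Longrightarrow> bounded_linear L \<Longrightarrow> smooth_on S F \<Longrightarrow> smooth_on S (\<lambda>x. L (F x))"
  by (simp add: smooth_on_def Ck_on_bounded_linear)

lemma smooth_on_scaleR:
  "open S \<Longrightarrow> smooth_on S F \<Longrightarrow> smooth_on S G \<Longrightarrow> smooth_on S (\<lambda>x. F x *\<^sub>R G x)"
  by (simp add: smooth_on_def Ck_on_bounded_bilinear[OF _ bounded_bilinear_scaleR])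

lemma smooth_on_sum:
  "open S \<Longrightarrow> (\<And>i. i \<in> I \<Longrightarrow> smooth_on S (F i)) \<Longrightarrow> smooth_on S (\<lambda>x. \<Sum>i\<in>I. F i x)"
  by (simp add: smooth_on_def Ck_on_sum)

lemma smooth_on_compose:
  assumes "open S" "open T" "\<And>x. x \<in> S \<Longrightarrow> F x \<in> T" "smooth_on S F" "smooth_on T G"
  shows "smooth_on S (\<lambda>x. G (F x))"
  using assms by (simp add: smooth_on_def Ck_on_compose)

lemma smooth_on_differentiable: "smooth_on S F \<Longrightarrow> x \<in> S \<Longrightarrow> F differentiable (at x)"
  unfolding smooth_on_def using Ck_on.simps(2) by blast

lemma smooth_on_has_derivative: "smooth_on S F \<Longrightarrow> x \<in> S \<Longrightarrow> (F has_derivative fd F x) (at x)"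
  by (simp add: smooth_on_differentiable fd_has_derivative)

lemma smooth_on_linear_fd: "smooth_on S F \<Longrightarrow> x \<in> S \<Longrightarrow> linear (fd F x)"
  by (simp add: smooth_on_differentiable linear_frechet_derivative)

lemma smooth_on_fd: "smooth_on S F \<Longrightarrow> smooth_on S (\<lambda>x. fd F x u)"
  unfolding smooth_on_def using Ck_on.simps(2) by blast

lemma smooth_on_continuous: "smooth_on S F \<Longrightarrow> continuous_on S F"
  unfolding smooth_on_def using Ck_on.simps(1) by blast

text \<open>Passes from constant arguments to variable ones. Smoothness of metrics, Christoffel
  symbols and Jacobians is always recorded for constant arguments, so this is how they are applied
  to vector fields.\<close>

lemma smooth_on_linear_apply:
  fixes L :: "'c::euclidean_space \<Rightarrow> 'a::euclidean_space \<Rightarrow> 'b::real_normed_vector"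
  assumes "open S" "\<And>x. x \<in> S \<Longrightarrow> linear (L x)" "\<And>u. smooth_on S (\<lambda>x. L x u)" "smooth_on S \<xi>"
  shows "smooth_on S (\<lambda>x. L x (\<xi> x))"
proof -
  have "smooth_on S (\<lambda>x. \<Sum>b\<in>Basis. (\<xi> x \<bullet> b) *\<^sub>R L x b)"
    using assms by (intro smooth_on_sum smooth_on_scaleR smooth_on_bounded_linear[OF _ bounded_linear_inner_left]) auto
  then show ?thesis by (rule smooth_on_congI[OF assms(1)]) (rule linear_euclidean_expand[OF assms(2)])
qed

section \<open>Symmetry of second derivatives\<close>

lemma fd_along_line:
  assumes "F differentiable (at (x + t *\<^sub>R u))"
  shows "((\<lambda>s. F (x + s *\<^sub>R u)) has_derivative (\<lambda>h. h *\<^sub>R fd F (x + t *\<^sub>R u) u)) (at t)"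
proof -
  have "((\<lambda>s. x + s *\<^sub>R u) has_derivative (\<lambda>h. h *\<^sub>R u)) (at t)"
    by (auto intro!: derivative_eq_intros)
  from diff_chain_at[OF this fd_has_derivative[OF assms]] show ?thesis
    by (simp add: o_def linear_scale[OF linear_frechet_derivative[OF assms]])
qed

text \<open>The second difference is a difference along \<open>u\<close> of differences along
  \<open>v\<close>: the mean value theorem in s produces \<open>fd F _ u\<close> at two points that
  differ by \<open>h *\<^sub>R v\<close>, and a second application in t finishes.\<close>

lemma second_difference_mvt:
  fixes F :: "'a::euclidean_space \<Rightarrow> real"
  assumes S: "\<And>s t. 0 \<le> s \<Longrightarrow> s \<le> h \<Longrightarrow> 0 \<le> t \<Longrightarrow> t \<le> h \<Longrightarrow> x + s *\<^sub>R u + t *\<^sub>R v \<in> S"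
    and sm: "smooth_on S F" and h: "h > 0"
  shows "\<exists>s t. 0 \<le> s \<and> s \<le> h \<and> 0 \<le> t \<and> t \<le> h \<and>
    F (x + h *\<^sub>R u + h *\<^sub>R v) - F (x + h *\<^sub>R u) - F (x + h *\<^sub>R v) + F x =
      h * h * fd (\<lambda>y. fd F y u) (x + s *\<^sub>R u + t *\<^sub>R v) v"
proof -
  define \<phi> where "\<phi> s = F ((x + h *\<^sub>R v) + s *\<^sub>R u) - F (x + s *\<^sub>R u)" for s
  have d: "(\<phi> has_real_derivative (fd F (x + h *\<^sub>R v + s *\<^sub>R u) u - fd F (x + s *\<^sub>R u) u)) (at s)"
    if "0 \<le> s" "s \<le> h" for s
  proof -
    have "F differentiable (at (x + h *\<^sub>R v + s *\<^sub>R u))" "F differentiable (at (x + s *\<^sub>R u))"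
      using S[of s h] S[of s 0] sm that h smooth_on_differentiable[OF sm] by (auto simp: add_ac)
    from has_derivative_diff[OF fd_along_line[OF this(1)] fd_along_line[OF this(2)]] show ?thesis
      unfolding \<phi>_def has_field_derivative_def
      by (rule has_derivative_eq_rhs) (auto simp: algebra_simps)
  qed
  obtain s where s: "0 < s" "s < h" "\<phi> h - \<phi> 0 = h * (fd F (x + h *\<^sub>R v + s *\<^sub>R u) u - fd F (x + s *\<^sub>R u) u)"
    using MVT2[OF h d] by auto
  define \<theta> where "\<theta> t = fd F ((x + s *\<^sub>R u) + t *\<^sub>R v) u" for t
  have d2: "(\<theta> has_real_derivative (fd (\<lambda>y. fd F y u) ((x + s *\<^sub>R u) + t *\<^sub>R v) v)) (at t)"
    if "0 \<le> t" "t \<le> h" for t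
  proof -
    have "(\<lambda>y. fd F y u) differentiable (at (x + s *\<^sub>R u + t *\<^sub>R v))"
      using S[of s t] s that smooth_on_differentiable[OF smooth_on_fd[OF sm]] by auto
    from fd_along_line[OF this] show ?thesis
      unfolding \<theta>_def has_field_derivative_def
      by (rule has_derivative_eq_rhs) (auto simp: algebra_simps)
  qed
  obtain t where t: "0 < t" "t < h" "\<theta> h - \<theta> 0 = h * fd (\<lambda>y. fd F y u) ((x + s *\<^sub>R u) + t *\<^sub>R v) v"
    using MVT2[OF h d2] by auto
  have "F (x + h *\<^sub>R u + h *\<^sub>R v) - F (x + h *\<^sub>R u) - F (x + h *\<^sub>R v) + F x = \<phi> h - \<phi> 0"
    by (simp add: \<phi>_def add_ac)
  also have "\<dots> = h * (\<theta> h - \<theta> 0)" by (simp add: s \<theta>_def add_ac)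
  finally show ?thesis using t s by (intro exI[of _ s] exI[of _ t]) auto
qed

text \<open>The second difference is symmetric in \<open>u\<close> and \<open>v\<close>, so by the
  mean value form both mixed derivatives attain a common value at points arbitrarily near
  \<open>x\<close>; continuity gives equality at \<open>x\<close>.\<close>

lemma fd_fd_commute_real:
  fixes F :: "'a::euclidean_space \<Rightarrow> real"
  assumes "open S" "smooth_on S F" "x \<in> S"
  shows "fd (\<lambda>y. fd F y u) x v = fd (\<lambda>y. fd F y v) x u"
proof (rule ccontr)
  define P where "P y = fd (\<lambda>y. fd F y u) y v" for y
  define Q where "Q y = fd (\<lambda>y. fd F y v) y u" for y
  assume "\<not> ?thesis"
  then have ne: "P x \<noteq> Q x" by (simp add: P_def Q_def)
  \<comment> \<open>With half the distance, a common value closer than \<open>e\<close> to both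
    \<open>P x\<close> and \<open>Q x\<close> contradicts the triangle inequality.\<close>
  define e where "e = dist (P x) (Q x) / 2"
  have e: "e > 0" using ne by (simp add: e_def)
  have "continuous_on S P" "continuous_on S Q"
    unfolding P_def Q_def using assms by (auto intro!: smooth_on_continuous smooth_on_fd)
  then have "isCont P x" "isCont Q x" using assms by (auto simp: continuous_on_eq_continuous_at)
  then have "(P \<longlongrightarrow> P x) (nhds x)" "(Q \<longlongrightarrow> Q x) (nhds x)"
    by (simp_all add: isCont_def tendsto_at_iff_tendsto_nhds)
  then have ev: "\<forall>\<^sub>F y in nhds x. dist (P y) (P x) < e \<and> dist (Q y) (Q x) < e \<and> y \<in> S"
    using e assms(1,3) by (intro eventually_conj) (auto simp: tendsto_iff eventually_nhds_in_open)
  then obtain r where r: "r > 0" "\<And>y. dist y x < r \<Longrightarrow> dist (P y) (P x) < e \<and> dist (Q y) (Q x) < e \<and> y \<in> S"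
    unfolding eventually_nhds_metric by auto
  \<comment> \<open>Small enough for the whole parallelogram of sides \<open>h *\<^sub>R u\<close>,
    \<open>h *\<^sub>R v\<close> to stay in the ball of radius \<open>r\<close>; the summand 1 keeps
    the denominator positive when both directions vanish.\<close>
  define h where "h = r / (2 * (norm u + norm v + 1))"
  have pos: "norm u + norm v + 1 > 0" by (smt (verit) norm_ge_zero)
  then have h: "h > 0" using r by (simp add: h_def)
  have near: "dist (x + s *\<^sub>R u + t *\<^sub>R v) x < r" if "0 \<le> s" "s \<le> h" "0 \<le> t" "t \<le> h" for s t
  proof -
    have "dist (x + s *\<^sub>R u + t *\<^sub>R v) x \<le> s * norm u + t * norm v"
      using that norm_triangle_ineq[of "s *\<^sub>R u" "t *\<^sub>R v"] by (simp add: dist_norm algebra_simps)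
    also have "\<dots> \<le> h * norm u + h * norm v"
      using that by (intro add_mono mult_right_mono) auto
    also have "\<dots> \<le> h * (norm u + norm v + 1)" using h by (simp add: algebra_simps)
    also have "\<dots> = r / 2" 
    proof -
      have "r / (2 * M) * M = r / 2" if "M > 0" for M :: real using that by simp
      from this[OF pos] show ?thesis unfolding h_def .
    qed
    also have "\<dots> < r" using r by simp
    finally show ?thesis .
  qed
  obtain s t where st: "0 \<le> s" "s \<le> h" "0 \<le> t" "t \<le> h" and
    eq1: "F (x + h *\<^sub>R u + h *\<^sub>R v) - F (x + h *\<^sub>R u) - F (x + h *\<^sub>R v) + F x = h * h * P (x + s *\<^sub>R u + t *\<^sub>R v)"
    unfolding P_def using second_difference_mvt[of h x u v S F] near r(2) assms(2) h by blast
  have near': "x + s *\<^sub>R v + t *\<^sub>R u \<in> S" if "0 \<le> s" "s \<le> h" "0 \<le> t" "t \<le> h" for s t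
    using near[of t s] r(2) that by (simp add: add_ac)
  obtain s' t' where st': "0 \<le> s'" "s' \<le> h" "0 \<le> t'" "t' \<le> h" and
    eq2: "F (x + h *\<^sub>R v + h *\<^sub>R u) - F (x + h *\<^sub>R v) - F (x + h *\<^sub>R u) + F x = h * h * Q (x + s' *\<^sub>R v + t' *\<^sub>R u)"
    unfolding Q_def using second_difference_mvt[of h x v u S F] near' assms(2) h by blast
  have "h * h * P (x + s *\<^sub>R u + t *\<^sub>R v) = h * h * Q (x + t' *\<^sub>R u + s' *\<^sub>R v)"
  proof -
    have "x + h *\<^sub>R v + h *\<^sub>R u = x + h *\<^sub>R u + h *\<^sub>R v"
      "x + s' *\<^sub>R v + t' *\<^sub>R u = x + t' *\<^sub>R u + s' *\<^sub>R v" by (simp_all add: add_ac)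
    from eq2[unfolded this] eq1 show ?thesis by linarith
  qed
  then have "P (x + s *\<^sub>R u + t *\<^sub>R v) = Q (x + t' *\<^sub>R u + s' *\<^sub>R v)" using h by simp
  moreover have "dist (P (x + s *\<^sub>R u + t *\<^sub>R v)) (P x) < e" "dist (Q (x + t' *\<^sub>R u + s' *\<^sub>R v)) (Q x) < e"
    using r(2) near st st' by blast+
  ultimately show False unfolding e_def by (metis dist_commute dist_triangle_half_r less_irrefl)
qed

lemma fd_bounded_linear:
  assumes "bounded_linear L" "F differentiable (at x)"
  shows "fd (\<lambda>x. L (F x)) x u = L (fd F x u)"
  by (simp add: fd_eqI[OF bounded_linear.has_derivative[OF assms(1) fd_has_derivative[OF assms(2)]]])

lemma fd_fd_commute:
  fixes F :: "'a::euclidean_space \<Rightarrow> 'b::euclidean_space"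
  assumes "open S" "smooth_on S F" "x \<in> S"
  shows "fd (\<lambda>y. fd F y u) x v = fd (\<lambda>y. fd F y v) x u"
proof (rule euclidean_eqI)
  fix b :: 'b assume "b \<in> Basis"
  have "fd (\<lambda>y. fd F y u) x v \<bullet> b = fd (\<lambda>y. fd (\<lambda>y. F y \<bullet> b) y u) x v" for u v
  proof -
    have "fd (\<lambda>y. fd F y u) x v \<bullet> b = fd (\<lambda>y. fd F y u \<bullet> b) x v"
      by (rule fd_bounded_linear[OF bounded_linear_inner_left smooth_on_differentiable[OF smooth_on_fd[OF assms(2)] assms(3)], symmetric])
    also have "\<dots> = fd (\<lambda>y. fd (\<lambda>y. F y \<bullet> b) y u) x v"
      by (subst fd_cong_open[OF assms(1,3)])
        (simp_all add: fd_bounded_linear[OF bounded_linear_inner_left smooth_on_differentiable[OF assms(2)]])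
    finally show ?thesis .
  qed
  then show "fd (\<lambda>y. fd F y u) x v \<bullet> b = fd (\<lambda>y. fd F y v) x u \<bullet> b"
    using fd_fd_commute_real[OF assms(1) smooth_on_bounded_linear[OF assms(1) bounded_linear_inner_left assms(2)] assms(3)]
    by simp
qed

section \<open>Connections along maps in coordinates\<close>

lemma bilinear_euclidean_expand:
  fixes B :: "'a::euclidean_space \<Rightarrow> 'b::euclidean_space \<Rightarrow> 'c::real_normed_vector"
  assumes "bilinear B"
  shows "B a b = (\<Sum>i\<in>Basis. \<Sum>j\<in>Basis. ((a \<bullet> i) * (b \<bullet> j)) *\<^sub>R B i j)"
proof -
  have "B a b = (\<Sum>i\<in>Basis. (a \<bullet> i) *\<^sub>R B i b)"
    using assms by (intro linear_euclidean_expand[of "\<lambda>a. B a b"]) (simp add: bilinear_def)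
  also have "\<dots> = (\<Sum>i\<in>Basis. (a \<bullet> i) *\<^sub>R (\<Sum>j\<in>Basis. (b \<bullet> j) *\<^sub>R B i j))"
    using assms by (intro sum.cong refl arg_cong2[where f=scaleR] linear_euclidean_expand[of "B _"])
      (simp add: bilinear_def)
  finally show ?thesis by (simp add: scaleR_sum_right)
qed

text \<open>Leibniz rule for a tensor along a map, with three sources of variation: the base point
  and both arguments. Expansion in \<open>Basis\<close> reduces it to scalar coefficients times
  \<open>T\<close> with constant arguments. It serves the metric and the Christoffel symbols
  alike.\<close>

lemma has_derivative_bilinear_pullback:
  fixes T :: "'y::euclidean_space \<Rightarrow> 'a::euclidean_space \<Rightarrow> 'b::euclidean_space \<Rightarrow> 'c::real_normed_vector"
    and \<Psi> :: "'x::euclidean_space \<Rightarrow> 'y"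
  assumes S: "open S" "\<And>y. y \<in> S \<Longrightarrow> bilinear (T y)" "\<And>a b. smooth_on S (\<lambda>y. T y a b)"
    and U: "open U" "x \<in> U" "\<And>x. x \<in> U \<Longrightarrow> \<Psi> x \<in> S"
    and d: "\<Psi> differentiable (at x)" "A differentiable (at x)" "C differentiable (at x)"
  shows "((\<lambda>x. T (\<Psi> x) (A x) (C x)) has_derivative
    (\<lambda>u. fd (\<lambda>y. T y (A x) (C x)) (\<Psi> x) (fd \<Psi> x u) + T (\<Psi> x) (fd A x u) (C x) + T (\<Psi> x) (A x) (fd C x u)))
    (at x)"
proof -
  note E = bilinear_euclidean_expand[OF S(2)[OF U(3)[OF U(2)]]]
  have dT: "((\<lambda>y. T y a b) has_derivative fd (\<lambda>y. T y a b) (\<Psi> x)) (at (\<Psi> x))" for a b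
    by (rule smooth_on_has_derivative[OF S(3) U(3)[OF U(2)]])
  have dTi: "((\<lambda>x. T (\<Psi> x) a b) has_derivative (\<lambda>u. fd (\<lambda>y. T y a b) (\<Psi> x) (fd \<Psi> x u))) (at x)" for a b
    using diff_chain_at[OF fd_has_derivative[OF d(1)] dT] by (simp add: o_def)
  have A: "(A has_derivative fd A x) (at x)" and C: "(C has_derivative fd C x) (at x)"
    using d by (simp_all add: fd_has_derivative)
  have Ts: "fd (\<lambda>y. T y a b) (\<Psi> x) v
      = (\<Sum>i\<in>Basis. \<Sum>j\<in>Basis. ((a \<bullet> i) * (b \<bullet> j)) *\<^sub>R fd (\<lambda>y. T y i j) (\<Psi> x) v)" for a b v
  proof -
    have "((\<lambda>y. \<Sum>i\<in>Basis. \<Sum>j\<in>Basis. ((a \<bullet> i) * (b \<bullet> j)) *\<^sub>R T y i j) has_derivative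
      (\<lambda>v. \<Sum>i\<in>Basis. \<Sum>j\<in>Basis. ((a \<bullet> i) * (b \<bullet> j)) *\<^sub>R fd (\<lambda>y. T y i j) (\<Psi> x) v)) (at (\<Psi> x))"
      by (intro has_derivative_sum has_derivative_scaleR_right dT)
    then have "fd (\<lambda>y. \<Sum>i\<in>Basis. \<Sum>j\<in>Basis. ((a \<bullet> i) * (b \<bullet> j)) *\<^sub>R T y i j) (\<Psi> x) =
      (\<lambda>v. \<Sum>i\<in>Basis. \<Sum>j\<in>Basis. ((a \<bullet> i) * (b \<bullet> j)) *\<^sub>R fd (\<lambda>y. T y i j) (\<Psi> x) v)"
      by (rule fd_eqI)
    moreover have "fd (\<lambda>y. T y a b) (\<Psi> x) = fd (\<lambda>y. \<Sum>i\<in>Basis. \<Sum>j\<in>Basis. ((a \<bullet> i) * (b \<bullet> j)) *\<^sub>R T y i j) (\<Psi> x)"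
      by (rule fd_cong_open[OF S(1) U(3)[OF U(2)]]) (rule bilinear_euclidean_expand[OF S(2)])
    ultimately show ?thesis by simp
  qed
  have dij: "((\<lambda>x. ((A x \<bullet> i) * (C x \<bullet> j)) *\<^sub>R T (\<Psi> x) i j) has_derivative
    (\<lambda>u. ((A x \<bullet> i) * (C x \<bullet> j)) *\<^sub>R fd (\<lambda>y. T y i j) (\<Psi> x) (fd \<Psi> x u)
      + ((fd A x u \<bullet> i) * (C x \<bullet> j)) *\<^sub>R T (\<Psi> x) i j + ((A x \<bullet> i) * (fd C x u \<bullet> j)) *\<^sub>R T (\<Psi> x) i j)) (at x)" for i j
    by (rule has_derivative_eq_rhs, rule has_derivative_scaleR, rule has_derivative_mult,
        rule has_derivative_inner_left[OF A], rule has_derivative_inner_left[OF C], rule dTi)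
      (auto simp: algebra_simps)
  have "((\<lambda>x. \<Sum>i\<in>Basis. \<Sum>j\<in>Basis. ((A x \<bullet> i) * (C x \<bullet> j)) *\<^sub>R T (\<Psi> x) i j) has_derivative
    (\<lambda>u. \<Sum>i\<in>Basis. \<Sum>j\<in>Basis. ((A x \<bullet> i) * (C x \<bullet> j)) *\<^sub>R fd (\<lambda>y. T y i j) (\<Psi> x) (fd \<Psi> x u)
      + ((fd A x u \<bullet> i) * (C x \<bullet> j)) *\<^sub>R T (\<Psi> x) i j + ((A x \<bullet> i) * (fd C x u \<bullet> j)) *\<^sub>R T (\<Psi> x) i j)) (at x)"
    by (intro has_derivative_sum dij)
  then have "((\<lambda>x. T (\<Psi> x) (A x) (C x)) has_derivative
    (\<lambda>u. \<Sum>i\<in>Basis. \<Sum>j\<in>Basis. ((A x \<bullet> i) * (C x \<bullet> j)) *\<^sub>R fd (\<lambda>y. T y i j) (\<Psi> x) (fd \<Psi> x u)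
      + ((fd A x u \<bullet> i) * (C x \<bullet> j)) *\<^sub>R T (\<Psi> x) i j + ((A x \<bullet> i) * (fd C x u \<bullet> j)) *\<^sub>R T (\<Psi> x) i j)) (at x)"
    by (rule has_derivative_transform_within_open[OF _ U(1,2)])
      (rule bilinear_euclidean_expand[OF S(2)[OF U(3)], symmetric])
  moreover have "(\<Sum>i\<in>Basis. \<Sum>j\<in>Basis. ((A x \<bullet> i) * (C x \<bullet> j)) *\<^sub>R fd (\<lambda>y. T y i j) (\<Psi> x) (fd \<Psi> x u)
      + ((fd A x u \<bullet> i) * (C x \<bullet> j)) *\<^sub>R T (\<Psi> x) i j + ((A x \<bullet> i) * (fd C x u \<bullet> j)) *\<^sub>R T (\<Psi> x) i j)
      = fd (\<lambda>y. T y (A x) (C x)) (\<Psi> x) (fd \<Psi> x u) + T (\<Psi> x) (fd A x u) (C x) + T (\<Psi> x) (A x) (fd C x u)" for u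
    unfolding Ts[of "A x" "C x"] E[of "fd A x u" "C x"] E[of "A x" "fd C x u"] by (simp only: sum.distrib)
  ultimately show ?thesis by (simp only:)
qed

lemma has_derivative_linear_apply:
  fixes L :: "'x::euclidean_space \<Rightarrow> 'a::euclidean_space \<Rightarrow> 'c::real_normed_vector"
  assumes "open S" "\<And>y. y \<in> S \<Longrightarrow> linear (L y)" "\<And>a. smooth_on S (\<lambda>y. L y a)" "x \<in> S"
    and d: "A differentiable (at x)"
  shows "((\<lambda>x. L x (A x)) has_derivative (\<lambda>u. fd (\<lambda>y. L y (A x)) x u + L x (fd A x u))) (at x)"
proof -
  \<comment> \<open>A scalar slot, later held at 1, turns the linear map into a bilinear one so that
    the previous rule applies.\<close>
  have bil: "bilinear (\<lambda>a t. (t::real) *\<^sub>R L y a)" if "y \<in> S" for y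
    using assms(2)[OF that] by (auto simp: bilinear_def linear_iff algebra_simps)
  have sm: "smooth_on S (\<lambda>y. t *\<^sub>R L y a)" for t a
    by (intro smooth_on_bounded_linear[OF assms(1) bounded_linear_scaleR_right] assms)
  have "((\<lambda>x. (1::real) *\<^sub>R L (x) (A x)) has_derivative
    (\<lambda>u. fd (\<lambda>y. 1 *\<^sub>R L y (A x)) x (fd (\<lambda>x. x) x u) + 1 *\<^sub>R L x (fd A x u) + fd (\<lambda>x. 1) x u *\<^sub>R L x (A x))) (at x)"
    by (rule has_derivative_bilinear_pullback[where T="\<lambda>y a t. (t::real) *\<^sub>R L y a" and \<Psi>="\<lambda>x. x" and C="\<lambda>x. 1",
          OF assms(1) bil sm assms(1,4)]) (use d in auto)
  then show ?thesis by simp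
qed

text \<open>\<open>cov_deriv \<Gamma> \<Psi> u A\<close> is \<open>\<nabla>\<^sub>u A\<close> for a vector field \<open>A\<close> along \<open>\<Psi>\<close> and the connection with
  Christoffel symbols \<open>\<Gamma>\<close>, so that \<open>hess u v\<close> below is \<open>\<nabla>\<^sub>u \<partial>\<^sub>v\<Psi>\<close>.\<close>

definition cov_deriv ::
  "('q \<Rightarrow> 'q \<Rightarrow> 'q \<Rightarrow> 'q::euclidean_space) \<Rightarrow> ('e::euclidean_space \<Rightarrow> 'q) \<Rightarrow> 'e \<Rightarrow> ('e \<Rightarrow> 'q) \<Rightarrow> 'e \<Rightarrow> 'q" where
  "cov_deriv \<Gamma> \<Psi> u A x = fd A x u + \<Gamma> (\<Psi> x) (fd \<Psi> x u) (A x)"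

text \<open>R(a,b)c for fields with constant components: their bracket is zero, so only derivatives
  and products of Christoffel symbols remain.\<close>

definition coord_curvature ::
  "('q \<Rightarrow> 'q \<Rightarrow> 'q \<Rightarrow> 'q::euclidean_space) \<Rightarrow> 'q \<Rightarrow> 'q \<Rightarrow> 'q \<Rightarrow> 'q \<Rightarrow> 'q" where
  "coord_curvature \<Gamma> y a b c =
     fd (\<lambda>y. \<Gamma> y b c) y a - fd (\<lambda>y. \<Gamma> y a c) y b + \<Gamma> y a (\<Gamma> y b c) - \<Gamma> y b (\<Gamma> y a c)"

text \<open>An immersion seen in charts: \<open>S\<close> is a chart image of the ambient manifold
  with metric matrix \<open>G\<close> and the Christoffel symbols of a torsion-free connection
  preserving \<open>G\<close>, and \<Psi> is the chart expression of the map. All curvature calculus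
  is done here, free of chart changes.\<close>

locale coord_map =
  fixes S :: "'q::euclidean_space set" and \<Gamma> :: "'q \<Rightarrow> 'q \<Rightarrow> 'q \<Rightarrow> 'q" and G :: "'q \<Rightarrow> 'q \<Rightarrow> 'q \<Rightarrow> real"
    and U :: "'e::euclidean_space set" and \<Psi> :: "'e \<Rightarrow> 'q"
  assumes open_S: "open S" and open_U: "open U"
    and \<Psi>_smooth: "smooth_on U \<Psi>" and \<Psi>_S: "\<And>x. x \<in> U \<Longrightarrow> \<Psi> x \<in> S"
    and \<Gamma>_bilinear: "\<And>y. y \<in> S \<Longrightarrow> bilinear (\<Gamma> y)"
    and \<Gamma>_sym: "\<And>y a b. y \<in> S \<Longrightarrow> \<Gamma> y a b = \<Gamma> y b a"
    and \<Gamma>_smooth: "\<And>a b. smooth_on S (\<lambda>y. \<Gamma> y a b)"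
    and G_bilinear: "\<And>y. y \<in> S \<Longrightarrow> bilinear (G y)"
    and G_sym: "\<And>y a b. y \<in> S \<Longrightarrow> G y a b = G y b a"
    and G_smooth: "\<And>a b. smooth_on S (\<lambda>y. G y a b)"
    and G_parallel: "\<And>y a b c. y \<in> S \<Longrightarrow> fd (\<lambda>y. G y b c) y a = G y (\<Gamma> y a b) c + G y b (\<Gamma> y a c)"
begin

abbreviation "cov \<equiv> cov_deriv \<Gamma> \<Psi>"

definition pull :: "'e \<Rightarrow> 'e \<Rightarrow> 'e \<Rightarrow> real" where
  "pull x u v = G (\<Psi> x) (fd \<Psi> x u) (fd \<Psi> x v)"

definition hess :: "'e \<Rightarrow> 'e \<Rightarrow> 'e \<Rightarrow> 'q" where
  "hess u v x = cov u (\<lambda>x. fd \<Psi> x v) x"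

lemma G_add: "y \<in> S \<Longrightarrow> G y (a + b) c = G y a c + G y b c" "y \<in> S \<Longrightarrow> G y c (a + b) = G y c a + G y c b"
  "y \<in> S \<Longrightarrow> G y (a - b) c = G y a c - G y b c" "y \<in> S \<Longrightarrow> G y c (a - b) = G y c a - G y c b"
  by (simp_all add: G_bilinear bilinear_ladd bilinear_radd bilinear_lsub bilinear_rsub)

lemma \<Gamma>_add: "y \<in> S \<Longrightarrow> \<Gamma> y (a + b) c = \<Gamma> y a c + \<Gamma> y b c" "y \<in> S \<Longrightarrow> \<Gamma> y c (a + b) = \<Gamma> y c a + \<Gamma> y c b"
  by (simp_all add: \<Gamma>_bilinear bilinear_ladd bilinear_radd)

lemma fd_\<Psi>_smooth: "smooth_on U (\<lambda>x. fd \<Psi> x u)"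
  using \<Psi>_smooth by (rule smooth_on_fd)

lemma has_derivative_G_pull:
  assumes "x \<in> U" "smooth_on U A" "smooth_on U C"
  shows "((\<lambda>x. G (\<Psi> x) (A x) (C x)) has_derivative
    (\<lambda>u. G (\<Psi> x) (cov u A x) (C x) + G (\<Psi> x) (A x) (cov u C x))) (at x)"
  by (rule has_derivative_eq_rhs[OF has_derivative_bilinear_pullback[OF open_S G_bilinear G_smooth open_U assms(1) \<Psi>_S
      smooth_on_differentiable[OF \<Psi>_smooth assms(1)] smooth_on_differentiable[OF assms(2,1)]
      smooth_on_differentiable[OF assms(3,1)]]])
    (auto simp: fun_eq_iff G_parallel[OF \<Psi>_S[OF assms(1)]] G_add[OF \<Psi>_S[OF assms(1)]] cov_deriv_def)

lemma fd_G_pull: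
  assumes "x \<in> U" "smooth_on U A" "smooth_on U C"
  shows "fd (\<lambda>x. G (\<Psi> x) (A x) (C x)) x u = G (\<Psi> x) (cov u A x) (C x) + G (\<Psi> x) (A x) (cov u C x)"
  using fd_eqI[OF has_derivative_G_pull[OF assms]] by simp

lemma fd_pull:
  assumes "x \<in> U"
  shows "fd (\<lambda>x. pull x v w) x u = G (\<Psi> x) (hess u v x) (fd \<Psi> x w) + G (\<Psi> x) (hess u w x) (fd \<Psi> x v)"
  unfolding pull_def hess_def fd_G_pull[OF assms fd_\<Psi>_smooth fd_\<Psi>_smooth]
  using G_sym[OF \<Psi>_S[OF assms], of "fd \<Psi> x v" "cov u (\<lambda>x. fd \<Psi> x w) x"] by simp

lemma \<Gamma>_pull_smooth:
  assumes "smooth_on U A" "smooth_on U C"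
  shows "smooth_on U (\<lambda>x. \<Gamma> (\<Psi> x) (A x) (C x))"
proof -
  have 1: "smooth_on U (\<lambda>x. \<Gamma> (\<Psi> x) a (C x))" for a
    by (rule smooth_on_linear_apply[OF open_U])
      (use \<Gamma>_bilinear \<Psi>_S assms smooth_on_compose[OF open_U open_S _ \<Psi>_smooth \<Gamma>_smooth]
        in \<open>auto simp: bilinear_def\<close>)
  show ?thesis
    by (rule smooth_on_linear_apply[OF open_U, where L="\<lambda>x a. \<Gamma> (\<Psi> x) a (C x)"])
      (use \<Gamma>_bilinear \<Psi>_S assms 1 in \<open>auto simp: bilinear_def\<close>)
qed

lemma cov_smooth:
  assumes "smooth_on U A"
  shows "smooth_on U (\<lambda>x. cov u A x)"
  unfolding cov_deriv_def
  by (intro smooth_on_add open_U smooth_on_fd \<Gamma>_pull_smooth fd_\<Psi>_smooth assms)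

lemma hess_smooth: "smooth_on U (hess u v)"
  unfolding hess_def by (intro cov_smooth fd_\<Psi>_smooth)

text \<open>Second partial derivatives commute and the connection has no torsion.\<close>

lemma hess_sym: "x \<in> U \<Longrightarrow> hess u v x = hess v u x"
  unfolding hess_def cov_deriv_def
  using fd_fd_commute[OF open_U \<Psi>_smooth, of x v u] \<Gamma>_sym[OF \<Psi>_S, of x "fd \<Psi> x u" "fd \<Psi> x v"]
  by simp

text \<open>Curvature is the failure of covariant derivatives along \<Psi> to commute: second
  derivatives of \<open>A\<close> and of \<Psi> cancel by symmetry, as do the terms with one
  derivative of \<open>A\<close>; derivatives and products of \<Gamma> are left.\<close>

lemma cov_commutator:
  assumes x: "x \<in> U" and A: "smooth_on U A"
  shows "cov u (cov v A) x - cov v (cov u A) x = coord_curvature \<Gamma> (\<Psi> x) (fd \<Psi> x u) (fd \<Psi> x v) (A x)"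
proof -
  have "fd (cov v A) x u = fd (\<lambda>x. fd A x v) x u + (fd (\<lambda>y. \<Gamma> y (fd \<Psi> x v) (A x)) (\<Psi> x) (fd \<Psi> x u)
      + \<Gamma> (\<Psi> x) (fd (\<lambda>x. fd \<Psi> x v) x u) (A x) + \<Gamma> (\<Psi> x) (fd \<Psi> x v) (fd A x u))" for u v
  proof -
    have "((\<lambda>x. fd A x v + \<Gamma> (\<Psi> x) (fd \<Psi> x v) (A x)) has_derivative
      (\<lambda>u. fd (\<lambda>x. fd A x v) x u + (fd (\<lambda>y. \<Gamma> y (fd \<Psi> x v) (A x)) (\<Psi> x) (fd \<Psi> x u)
      + \<Gamma> (\<Psi> x) (fd (\<lambda>x. fd \<Psi> x v) x u) (A x) + \<Gamma> (\<Psi> x) (fd \<Psi> x v) (fd A x u)))) (at x)"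
      by (intro has_derivative_add smooth_on_has_derivative[OF smooth_on_fd[OF A] x]
        has_derivative_bilinear_pullback[OF open_S \<Gamma>_bilinear \<Gamma>_smooth open_U x \<Psi>_S]
        smooth_on_differentiable[OF _ x] \<Psi>_smooth fd_\<Psi>_smooth A)
    moreover have "cov v A = (\<lambda>x. fd A x v + \<Gamma> (\<Psi> x) (fd \<Psi> x v) (A x))" by (simp add: cov_deriv_def fun_eq_iff)
    ultimately show ?thesis by (simp add: fd_eqI)
  qed
  note d = this
  show ?thesis
    unfolding cov_deriv_def[of _ _ _ "cov_deriv _ _ _ _"] d coord_curvature_def
    unfolding cov_deriv_def \<Gamma>_add[OF \<Psi>_S[OF x]]
      fd_fd_commute[OF open_U A x, of u v] fd_fd_commute[OF open_U \<Psi>_smooth x, of u v]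
    by (simp add: algebra_simps)
qed

text \<open>The tangential part of the second derivative depends on the induced metric alone. The
  Levi-Civita connection of the domain obeys the same formula, and comparing the two will show that
  the second fundamental form is normal.\<close>

lemma koszul:
  assumes "x \<in> U"
  shows "2 * G (\<Psi> x) (hess u v x) (fd \<Psi> x w) =
    fd (\<lambda>x. pull x v w) x u + fd (\<lambda>x. pull x u w) x v - fd (\<lambda>x. pull x u v) x w"
  by (simp add: fd_pull[OF assms] hess_sym[OF assms, of v u] hess_sym[OF assms, of w u] hess_sym[OF assms, of w v])

text \<open>Take the difference of the \<open>a\<close>-derivative of \<open>\<langle>\<nabla>\<^sub>z \<partial>\<^sub>z\<Psi>, \<partial>\<^sub>a\<Psi>\<rangle> = - \<partial>\<^sub>a (pull z z) / 2\<close> and the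
  \<open>z\<close>-derivative of \<open>\<langle>\<nabla>\<^sub>a \<partial>\<^sub>z\<Psi>, \<partial>\<^sub>a\<Psi>\<rangle> = 0\<close>; the curvature of the domain never enters.\<close>

lemma curvature_orthogonal_directions:
  assumes x: "x \<in> U" and orth: "\<And>x. x \<in> U \<Longrightarrow> pull x a z = 0"
    and inv: "\<And>x. x \<in> U \<Longrightarrow> fd (\<lambda>x. pull x a a) x z = 0"
  shows "G (\<Psi> x) (coord_curvature \<Gamma> (\<Psi> x) (fd \<Psi> x a) (fd \<Psi> x z) (fd \<Psi> x z)) (fd \<Psi> x a) =
    - (fd (\<lambda>x. fd (\<lambda>x. pull x z z) x a) x a) / 2
    - G (\<Psi> x) (hess z z x) (hess a a x) + G (\<Psi> x) (hess a z x) (hess a z x)"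
proof -
  have c0: "fd (\<lambda>x. pull x a z) x u = 0" "fd (\<lambda>x. pull x z a) x u = 0" if "x \<in> U" for x u
  proof -
    have "pull x z a = 0" if "x \<in> U" for x
      using orth[OF that] G_sym[OF \<Psi>_S[OF that]] by (metis pull_def)
    then have "fd (\<lambda>x. pull x a z) x = fd (\<lambda>x. 0) x" "fd (\<lambda>x. pull x z a) x = fd (\<lambda>x. 0) x"
      using fd_cong_open[OF open_U that, of "\<lambda>x. pull x a z" "\<lambda>x. 0"] orth
        fd_cong_open[OF open_U that, of "\<lambda>x. pull x z a" "\<lambda>x. 0"] by blast+
    then show "fd (\<lambda>x. pull x a z) x u = 0" "fd (\<lambda>x. pull x z a) x u = 0" by simp_all
  qed
  have zz: "G (\<Psi> x) (hess z z x) (fd \<Psi> x a) = - (fd (\<lambda>x. pull x z z) x a) / 2" if "x \<in> U" for x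
    using koszul[OF that, of z z a] c0[OF that] by simp
  have az: "G (\<Psi> x) (hess a z x) (fd \<Psi> x a) = 0" if "x \<in> U" for x
    using koszul[OF that, of a z a] c0[OF that] inv[OF that] by simp
  have sm: "smooth_on U (\<lambda>x. fd (\<lambda>x. pull x z z) x a)"
  proof -
    have "smooth_on U (\<lambda>x. pull x z z)"
      unfolding pull_def
    proof (rule smooth_on_linear_apply[OF open_U, where L="\<lambda>x v. G (\<Psi> x) v (fd \<Psi> x z)"])
      show "smooth_on U (\<lambda>x. G (\<Psi> x) u (fd \<Psi> x z))" for u
        by (rule smooth_on_linear_apply[OF open_U])
          (use G_bilinear \<Psi>_S fd_\<Psi>_smooth smooth_on_compose[OF open_U open_S _ \<Psi>_smooth G_smooth] in \<open>auto simp: bilinear_def\<close>)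
    qed (use G_bilinear \<Psi>_S fd_\<Psi>_smooth in \<open>auto simp: bilinear_def\<close>)
    then show ?thesis by (rule smooth_on_fd)
  qed
  have "fd (\<lambda>x. G (\<Psi> x) (hess z z x) (fd \<Psi> x a)) x a = fd (\<lambda>x. - (fd (\<lambda>x. pull x z z) x a) / 2) x a"
    using fd_cong_open[OF open_U x zz] by simp
  also have "\<dots> = - (fd (\<lambda>x. fd (\<lambda>x. pull x z z) x a) x a) / 2"
    using fd_bounded_linear[of "\<lambda>t. - t / 2", OF _ smooth_on_differentiable[OF sm x]]
    by (simp add: bounded_linear_minus bounded_linear_divide)
  finally have 1: "G (\<Psi> x) (cov a (hess z z) x) (fd \<Psi> x a) + G (\<Psi> x) (hess z z x) (hess a a x)
      = - (fd (\<lambda>x. fd (\<lambda>x. pull x z z) x a) x a) / 2"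
    using fd_G_pull[OF x hess_smooth fd_\<Psi>_smooth] by (simp add: hess_def)
  have "fd (\<lambda>x. G (\<Psi> x) (hess a z x) (fd \<Psi> x a)) x z = 0"
    using fd_cong_open[OF open_U x az] by simp
  then have 2: "G (\<Psi> x) (cov z (hess a z) x) (fd \<Psi> x a) + G (\<Psi> x) (hess a z x) (hess a z x) = 0"
    using fd_G_pull[OF x hess_smooth fd_\<Psi>_smooth] hess_sym[OF x, of z a] by (simp add: hess_def)
  \<comment> \<open>Both are covariant derivatives of the one field \<open>fd \<Psi> _ z\<close>, so
    differentiating crosswise and subtracting yields a commutator.\<close>
  have "hess z z = cov z (\<lambda>x. fd \<Psi> x z)" "hess a z = cov a (\<lambda>x. fd \<Psi> x z)" 
    by (simp_all add: hess_def fun_eq_iff)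
  then have "cov a (hess z z) x - cov z (hess a z) x =
    coord_curvature \<Gamma> (\<Psi> x) (fd \<Psi> x a) (fd \<Psi> x z) (fd \<Psi> x z)"
    using cov_commutator[OF x fd_\<Psi>_smooth] by simp
  then have "G (\<Psi> x) (coord_curvature \<Gamma> (\<Psi> x) (fd \<Psi> x a) (fd \<Psi> x z) (fd \<Psi> x z)) (fd \<Psi> x a)
    = G (\<Psi> x) (cov a (hess z z) x) (fd \<Psi> x a) - G (\<Psi> x) (cov z (hess a z) x) (fd \<Psi> x a)"
    by (simp only: G_add(3)[OF \<Psi>_S[OF x], symmetric])
  moreover have "C = P - Q \<Longrightarrow> P + R = - t / 2 \<Longrightarrow> Q + s = 0 \<Longrightarrow> C = - t / 2 - R + s" for C P Q R s t :: real
    by simp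
  ultimately show ?thesis using 1 2 by blast
qed

end

section \<open>Coordinates on a manifold\<close>

lemma linear_euclideanI:
  assumes "\<And>v :: 'a::euclidean_space. F v = (\<Sum>b\<in>Basis. (v \<bullet> b) *\<^sub>R F' b)"
  shows "linear F"
  by (intro linearI) (simp_all add: assms inner_add_left scaleR_add_left sum.distrib scaleR_sum_right)

text \<open>The Jacobian at \<open>q\<close> of the change from the chart at \<open>a\<close> to the
  chart at \<open>b\<close>. Both \<open>components\<close> and \<open>coord_field\<close> are
  instances, so one cocycle identity governs them.\<close>

definition trans_deriv :: "('p, 'e::euclidean_space) atlas \<Rightarrow> 'p \<Rightarrow> 'p \<Rightarrow> 'p \<Rightarrow> 'e \<Rightarrow> 'e" where
  "trans_deriv A a b q = fd (chart A b \<circ> chart_inv A a) (chart A a q)"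

lemma components_trans: "components A a q u = trans_deriv A q a q u"
  by (simp add: components_def trans_deriv_def)

lemma coord_field_trans: "coord_field A a w q = trans_deriv A a q q w"
  by (simp add: coord_field_def trans_deriv_def)

text \<open>The symbols are kept as one vector-valued map of two constant vectors, read off in the
  chart at \<open>a\<close>, instead of an indexed family.\<close>

definition christoffel :: "('p, 'e::euclidean_space) atlas \<Rightarrow> ('p, 'e) connection \<Rightarrow> 'p \<Rightarrow> 'e \<Rightarrow> 'e \<Rightarrow> 'e \<Rightarrow> 'e" where
  "christoffel A D a x u v = local_rep A a (\<lambda>q. D q (coord_field A a u q) (coord_field A a v)) x"

definition metric_rep ::
  "('p, 'e::euclidean_space) atlas \<Rightarrow> ('p \<Rightarrow> 'e \<Rightarrow> 'e \<Rightarrow> real) \<Rightarrow> 'p \<Rightarrow> 'e \<Rightarrow> 'e \<Rightarrow> 'e \<Rightarrow> real" where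
  "metric_rep A g a x u v =
     g (chart_inv A a x) (coord_field A a u (chart_inv A a x)) (coord_field A a v (chart_inv A a x))"

locale manifold_atlas =
  fixes A :: "('p::{t2_space,second_countable_topology}, 'e::euclidean_space) atlas"
  assumes smooth_manifold: "smooth_manifold A"
begin

abbreviation "cdom \<equiv> chart_dom A"
abbreviation "cimg a \<equiv> chart A a ` chart_dom A a"

lemma open_dom: "open (cdom a)" and centre_dom: "a \<in> cdom a" and open_img: "open (cimg a)"
  and chart_homeo: "homeomorphism (cdom a) (cimg a) (chart A a) (chart_inv A a)"
  and transition_smooth: "smooth_on (chart A a ` (cdom a \<inter> cdom b)) (chart A b \<circ> chart_inv A a)"
  using smooth_manifold by (simp_all add: smooth_manifold_def)

lemma chart_inv_chart [simp]: "q \<in> cdom a \<Longrightarrow> chart_inv A a (chart A a q) = q"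
  using chart_homeo by (rule homeomorphism_apply1)

lemma chart_chart_inv [simp]: "x \<in> cimg a \<Longrightarrow> chart A a (chart_inv A a x) = x"
  using chart_homeo by (rule homeomorphism_apply2)

lemma chart_inv_dom: "x \<in> cimg a \<Longrightarrow> chart_inv A a x \<in> cdom a"
  by auto

lemma open_chart_image: "open W \<Longrightarrow> open (chart A a ` (W \<inter> cdom a))"
proof -
  assume W: "open W"
  have "openin (top_of_set (cdom a)) (W \<inter> cdom a)" using W by (simp add: openin_open Int_commute) blast
  from homeomorphism_imp_open_map[OF chart_homeo this]
  show ?thesis using open_img by (rule openin_open_trans)
qed

lemma open_chart_image': "open W \<Longrightarrow> open (chart A a ` (cdom a \<inter> W))"
  using open_chart_image by (simp add: Int_commute)

lemma transition_has_derivative: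
  assumes "q \<in> cdom a" "q \<in> cdom b"
  shows "((chart A b \<circ> chart_inv A a) has_derivative trans_deriv A a b q) (at (chart A a q))"
  unfolding trans_deriv_def by (rule smooth_on_has_derivative[OF transition_smooth]) (use assms in auto)

lemma linear_trans: "q \<in> cdom a \<Longrightarrow> q \<in> cdom b \<Longrightarrow> linear (trans_deriv A a b q)"
  using transition_has_derivative has_derivative_linear by blast

text \<open>The chain rule. The two transition maps compose to the third on the triple overlap,
  whose chart image is an open neighbourhood of the point.\<close>

lemma trans_cocycle:
  assumes "q \<in> cdom a" "q \<in> cdom b" "q \<in> cdom c"
  shows "trans_deriv A b c q (trans_deriv A a b q u) = trans_deriv A a c q u"
proof -
  let ?S = "chart A a ` (cdom a \<inter> (cdom b \<inter> cdom c))"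
  have "((chart A c \<circ> chart_inv A b) \<circ> (chart A b \<circ> chart_inv A a) has_derivative
      trans_deriv A b c q \<circ> trans_deriv A a b q) (at (chart A a q))"
    using assms transition_has_derivative[of q b c]
    by (intro diff_chain_at transition_has_derivative) simp_all
  then have "((chart A c \<circ> chart_inv A a) has_derivative trans_deriv A b c q \<circ> trans_deriv A a b q) (at (chart A a q))"
  proof (rule has_derivative_transform_within_open)
    show "open ?S" by (intro open_chart_image' open_Int open_dom)
  qed (use assms in auto)
  from fd_eqI[OF this] show ?thesis by (simp add: trans_deriv_def[of A a c])
qed

lemma trans_refl: "q \<in> cdom a \<Longrightarrow> trans_deriv A a a q u = u"
proof -
  assume q: "q \<in> cdom a"
  have "((\<lambda>x. x) has_derivative (\<lambda>u. u)) (at (chart A a q))" by simp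
  then have "(chart A a \<circ> chart_inv A a has_derivative (\<lambda>u. u)) (at (chart A a q))"
    by (rule has_derivative_transform_within_open[OF _ open_img]) (use q in auto)
  from fd_eqI[OF this] show ?thesis by (simp add: trans_deriv_def)
qed

lemma coord_components: "q \<in> cdom a \<Longrightarrow> coord_field A a (components A a q u) q = u"
  by (simp add: coord_field_trans components_trans trans_cocycle centre_dom trans_refl)

lemma components_coord: "q \<in> cdom a \<Longrightarrow> components A a q (coord_field A a u q) = u"
  by (simp add: coord_field_trans components_trans trans_cocycle centre_dom trans_refl)

text \<open>The reason for working at chart centres: there a formula in components is already a
  statement about tangent vectors.\<close>

lemma components_centre: "components A a a u = u"
  by (simp add: components_trans trans_refl centre_dom)

lemma coord_field_centre: "coord_field A a u a = u"
  by (simp add: coord_field_trans trans_refl centre_dom)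

lemma linear_components: "q \<in> cdom a \<Longrightarrow> linear (components A a q)"
  using linear_trans[of q q a] centre_dom by (simp add: components_trans[abs_def])

lemma linear_coord_field: "q \<in> cdom a \<Longrightarrow> linear (\<lambda>u. coord_field A a u q)"
  using linear_trans[of q a q] centre_dom by (simp add: coord_field_trans[abs_def])

text \<open>\<open>dir_deriv\<close> at \<open>q\<close> uses the chart chosen at \<open>q\<close>;
  to differentiate it once more in \<open>q\<close>, one fixed chart is needed. The chain rule
  through the transition map provides it.\<close>

lemma dir_deriv_chart:
  assumes q: "q \<in> cdom a" and F: "(F \<circ> chart_inv A a) differentiable at (chart A a q)"
  shows "dir_deriv A F q v = fd (F \<circ> chart_inv A a) (chart A a q) (components A a q v)"
proof -
  let ?S = "chart A q ` (cdom q \<inter> cdom a)"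
  have "((F \<circ> chart_inv A a) \<circ> (chart A a \<circ> chart_inv A q) has_derivative
      fd (F \<circ> chart_inv A a) (chart A a q) \<circ> trans_deriv A q a q) (at (chart A q q))"
    using q fd_has_derivative[OF F] centre_dom
    by (intro diff_chain_at transition_has_derivative) simp_all
  then have "((F \<circ> chart_inv A q) has_derivative
      fd (F \<circ> chart_inv A a) (chart A a q) \<circ> trans_deriv A q a q) (at (chart A q q))"
  proof (rule has_derivative_transform_within_open)
    show "open ?S" by (intro open_chart_image' open_dom)
  qed (use q centre_dom in auto)
  from fd_eqI[OF this] show ?thesis by (simp add: dir_deriv_def components_trans)
qed

lemma local_rep_coord_field: "x \<in> cimg a \<Longrightarrow> local_rep A a (coord_field A a w) x = w"
  by (simp add: local_rep_def components_coord chart_inv_dom)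

lemma coord_field_local_rep: "q \<in> cdom a \<Longrightarrow> coord_field A a (local_rep A a X (chart A a q)) q = X q"
  by (simp add: local_rep_def coord_components)

lemma local_rep_centre: "local_rep A a X (chart A a a) = X a"
  by (simp add: local_rep_def components_centre centre_dom)

lemma transition_compose_smooth:
  assumes W: "open W" "W \<subseteq> cdom a" and F: "smooth_on (chart A a ` W) F"
  shows "smooth_on (chart A b ` (W \<inter> cdom b)) (\<lambda>x. F (chart A a (chart_inv A b x)))"
proof (rule smooth_on_compose[OF open_chart_image[OF W(1)] _ _ _ F])
  show "open (chart A a ` W)" using open_chart_image[OF W(1), of a] W(2) by (simp add: Int_absorb2)
  show "smooth_on (chart A b ` (W \<inter> cdom b)) (\<lambda>x. chart A a (chart_inv A b x))"
  proof -
    have "chart A b ` (W \<inter> cdom b) \<subseteq> chart A b ` (cdom b \<inter> cdom a)" using W(2) by blast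
    from smooth_on_subset[OF transition_smooth this] show ?thesis by (simp add: o_def)
  qed
qed auto

text \<open>One chart containing \<open>W\<close> suffices: in any other chart the representative is
  multiplied by the Jacobian of the transition, which is itself smooth.\<close>

lemma smooth_vector_fieldI:
  assumes W: "open W" "W \<subseteq> cdom a" and X: "smooth_on (chart A a ` W) (local_rep A a X)"
  shows "smooth_vector_field A W X"
  unfolding smooth_vector_field_def
proof
  fix b
  let ?S = "chart A b ` (W \<inter> cdom b)"
  have oS: "open ?S" by (rule open_chart_image[OF W(1)])
  have "smooth_on ?S (\<lambda>x. trans_deriv A a b (chart_inv A b x) (local_rep A a X (chart A a (chart_inv A b x))))"
  proof (rule smooth_on_linear_apply[OF oS, where L="\<lambda>x. trans_deriv A a b (chart_inv A b x)"])
    show "linear (trans_deriv A a b (chart_inv A b x))" if "x \<in> ?S" for x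
      using that W by (intro linear_trans) auto
    show "smooth_on ?S (\<lambda>x. local_rep A a X (chart A a (chart_inv A b x)))"
      by (rule transition_compose_smooth[OF W X])
    show "smooth_on ?S (\<lambda>x. trans_deriv A a b (chart_inv A b x) u)" for u
    proof -
      have "smooth_on (chart A b ` ((W \<inter> cdom b) \<inter> cdom b))
          (\<lambda>x. fd (chart A b \<circ> chart_inv A a) (chart A a (chart_inv A b x)) u)"
        using W open_dom by (intro transition_compose_smooth[where a=a] smooth_on_fd smooth_on_subset[OF transition_smooth[of a b]])
          auto
      then show ?thesis by (simp add: trans_deriv_def Int_assoc)
    qed
  qed
  then show "smooth_on ?S (local_rep A b X)"
    by (rule smooth_on_congI[OF oS])
      (use W in \<open>auto simp: local_rep_def components_trans trans_cocycle centre_dom subset_iff\<close>)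
qed

lemma smooth_vector_fieldD:
  "smooth_vector_field A W X \<Longrightarrow> W \<subseteq> cdom a \<Longrightarrow> smooth_on (chart A a ` W) (local_rep A a X)"
  unfolding smooth_vector_field_def by (metis Int_absorb2)

lemma smooth_vector_field_subset:
  "smooth_vector_field A W X \<Longrightarrow> V \<subseteq> W \<Longrightarrow> smooth_vector_field A V X"
  unfolding smooth_vector_field_def by (meson Int_mono image_mono order_refl smooth_on_subset)

lemma smooth_funI:
  assumes W: "open W" "W \<subseteq> cdom a" and F: "smooth_on (chart A a ` W) (F \<circ> chart_inv A a)"
  shows "smooth_fun A W F"
  unfolding smooth_fun_def
proof
  fix b
  show "smooth_on (chart A b ` (W \<inter> cdom b)) (F \<circ> chart_inv A b)"
    by (rule smooth_on_congI[OF open_chart_image[OF W(1)] transition_compose_smooth[OF W F]])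
      (use W in auto)
qed

lemma smooth_coord_field: "smooth_vector_field A (cdom a) (coord_field A a w)"
  by (rule smooth_vector_fieldI[OF open_dom order_refl])
    (rule smooth_on_congI[OF open_img smooth_on_const local_rep_coord_field])

text \<open>The bracket at \<open>q\<close> is computed in the chart at \<open>q\<close>, where a
  coordinate field of the chart at \<open>a\<close> appears as a first derivative of the transition
  map. The bracket is thus an antisymmetrised second derivative.\<close>

lemma lie_bracket_coord_fields:
  assumes q: "q \<in> cdom a"
  shows "lie_bracket A (coord_field A a u) (coord_field A a v) q = 0"
proof -
  let ?S = "chart A q ` (cdom q \<inter> cdom a)"
  let ?\<tau> = "chart A q \<circ> chart_inv A a"
  have *: "fd (local_rep A q (coord_field A a v)) (chart A q q) (coord_field A a u q)
      = fd (\<lambda>y. fd ?\<tau> y v) (chart A a q) u" for u v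
  proof -
    have "((\<lambda>y. fd ?\<tau> y v) has_derivative fd (\<lambda>y. fd ?\<tau> y v) (chart A a q)) (at (chart A a q))"
      by (rule smooth_on_has_derivative[OF smooth_on_fd[OF transition_smooth]]) (use q centre_dom in auto)
    then have "((\<lambda>y. fd ?\<tau> y v) \<circ> (chart A a \<circ> chart_inv A q) has_derivative
      fd (\<lambda>y. fd ?\<tau> y v) (chart A a q) \<circ> trans_deriv A q a q) (at (chart A q q))"
      using q centre_dom by (intro diff_chain_at transition_has_derivative) simp_all
    then have "(local_rep A q (coord_field A a v) has_derivative
      fd (\<lambda>y. fd ?\<tau> y v) (chart A a q) \<circ> trans_deriv A q a q) (at (chart A q q))"
    proof (rule has_derivative_transform_within_open)
      show "open ?S" by (intro open_chart_image' open_dom)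
      show "((\<lambda>y. fd ?\<tau> y v) \<circ> (chart A a \<circ> chart_inv A q)) x = local_rep A q (coord_field A a v) x"
        if x: "x \<in> ?S" for x
      proof -
        define r where "r = chart_inv A q x"
        have r: "r \<in> cdom q" "r \<in> cdom a" using x by (auto simp: r_def)
        have "local_rep A q (coord_field A a v) x = trans_deriv A a q r v"
          by (simp add: local_rep_def coord_field_trans components_trans r_def[symmetric] trans_cocycle r centre_dom)
        then show ?thesis by (simp add: trans_deriv_def r_def)
      qed
    qed (use q centre_dom in auto)
    from fd_eqI[OF this] show ?thesis
      using components_coord[OF q] by (simp add: components_trans)
  qed
  have "fd (\<lambda>y. fd ?\<tau> y v) (chart A a q) u = fd (\<lambda>y. fd ?\<tau> y u) (chart A a q) v"
    by (rule fd_fd_commute[OF _ transition_smooth[of a q]])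
      (use q centre_dom in \<open>auto intro!: open_chart_image' open_dom\<close>)
  then show ?thesis by (simp add: lie_bracket_def *)
qed

end

section \<open>Affine connections in charts: Christoffel symbols, the coordinate formula,
  curvature\<close>

locale manifold_connection = manifold_atlas A
  for A :: "('p::{t2_space,second_countable_topology}, 'e::euclidean_space) atlas" +
  fixes D :: "('p, 'e) connection"
  assumes affine: "affine_connection A D"
begin

abbreviation "\<Gamma> \<equiv> christoffel A D"

lemma conn_linear: "open W \<Longrightarrow> smooth_vector_field A W Y \<Longrightarrow> p \<in> W \<Longrightarrow> linear (\<lambda>u. D p u Y)"
  and conn_add: "open W \<Longrightarrow> smooth_vector_field A W X \<Longrightarrow> smooth_vector_field A W Y \<Longrightarrow> p \<in> W \<Longrightarrow>
    D p u (\<lambda>q. X q + Y q) = D p u X + D p u Y"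
  and conn_scale: "open W \<Longrightarrow> smooth_vector_field A W Y \<Longrightarrow> p \<in> W \<Longrightarrow> smooth_fun A W F \<Longrightarrow>
    D p u (\<lambda>q. F q *\<^sub>R Y q) = dir_deriv A F p u *\<^sub>R Y p + F p *\<^sub>R D p u Y"
  and conn_local: "open W \<Longrightarrow> smooth_vector_field A W X \<Longrightarrow> smooth_vector_field A W Y \<Longrightarrow> p \<in> W \<Longrightarrow>
    (\<And>q. q \<in> W \<Longrightarrow> X q = Y q) \<Longrightarrow> D p u X = D p u Y"
  and conn_smooth: "open W \<Longrightarrow> smooth_vector_field A W X \<Longrightarrow> smooth_vector_field A W Y \<Longrightarrow>
    smooth_vector_field A W (\<lambda>p. D p (X p) Y)"
  using affine unfolding affine_connection_def by blast+

lemma local_rep_lincomb: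
  assumes "x \<in> cimg a"
  shows "local_rep A a (\<lambda>q. \<Sum>i\<in>I. F i q *\<^sub>R coord_field A a (w i) q) x = (\<Sum>i\<in>I. F i (chart_inv A a x) *\<^sub>R w i)"
  using linear_components[OF chart_inv_dom[OF assms]]
  by (simp add: local_rep_def linear_sum linear_scale components_coord chart_inv_dom[OF assms])

lemma smooth_lincomb:
  assumes W: "open W" "W \<subseteq> cdom a" and F: "\<And>i. i \<in> I \<Longrightarrow> smooth_fun A W (F i)"
  shows "smooth_vector_field A W (\<lambda>q. \<Sum>i\<in>I. F i q *\<^sub>R coord_field A a (w i) q)"
proof (rule smooth_vector_fieldI[OF W])
  have o: "open (chart A a ` W)" using open_chart_image[OF W(1), of a] W(2) by (simp add: Int_absorb2)
  have "smooth_on (chart A a ` W) (F i \<circ> chart_inv A a)" if "i \<in> I" for i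
    using F[OF that] W(2) unfolding smooth_fun_def by (metis Int_absorb2)
  then have "smooth_on (chart A a ` W) (\<lambda>x. \<Sum>i\<in>I. (F i \<circ> chart_inv A a) x *\<^sub>R w i)"
    by (intro smooth_on_sum smooth_on_scaleR o smooth_on_const)
  then show "smooth_on (chart A a ` W) (local_rep A a (\<lambda>q. \<Sum>i\<in>I. F i q *\<^sub>R coord_field A a (w i) q))"
    by (rule smooth_on_congI[OF o]) (use W in \<open>auto simp: local_rep_lincomb\<close>)
qed

lemma conn_lincomb:
  assumes W: "open W" "W \<subseteq> cdom a" "p \<in> W" and I: "finite I" and F: "\<And>i. i \<in> I \<Longrightarrow> smooth_fun A W (F i)"
  shows "D p u (\<lambda>q. \<Sum>i\<in>I. F i q *\<^sub>R coord_field A a (w i) q) =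
    (\<Sum>i\<in>I. dir_deriv A (F i) p u *\<^sub>R coord_field A a (w i) p + F i p *\<^sub>R D p u (coord_field A a (w i)))"
  using I F
proof (induction I rule: finite_induct)
  case empty
  have "smooth_vector_field A W (\<lambda>q. 0)"
    using smooth_lincomb[OF W(1,2), of "{}"] by simp
  \<comment> \<open>Additivity applied to 0 + 0 makes the derivative of the zero field
    vanish.\<close>
  from conn_add[OF W(1) this this W(3)] show ?case by simp
next
  case (insert i I)
  have c: "smooth_vector_field A W (coord_field A a v)" for v
    using smooth_coord_field W(2) by (rule smooth_vector_field_subset)
  have s: "smooth_vector_field A W (\<lambda>q. F i q *\<^sub>R coord_field A a (w i) q)"
    using smooth_lincomb[OF W(1,2), of "{i}" F w] insert by simp
  have s': "smooth_vector_field A W (\<lambda>q. \<Sum>i\<in>I. F i q *\<^sub>R coord_field A a (w i) q)"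
    using insert by (intro smooth_lincomb[OF W(1,2)]) auto
  have "D p u (\<lambda>q. F i q *\<^sub>R coord_field A a (w i) q) =
      dir_deriv A (F i) p u *\<^sub>R coord_field A a (w i) p + F i p *\<^sub>R D p u (coord_field A a (w i))"
    using insert by (intro conn_scale[OF W(1) c W(3)]) auto
  then show ?case
    using insert conn_add[OF W(1) s s' W(3)] by simp
qed

lemma coord_field_lincomb: "q \<in> cdom a \<Longrightarrow> coord_field A a v q = (\<Sum>b\<in>Basis. (v \<bullet> b) *\<^sub>R coord_field A a b q)"
  by (rule linear_euclidean_expand[OF linear_coord_field])

text \<open>Linearity of the connection over constants: constant coefficients are smooth functions
  with zero directional derivative. This yields linearity of the Christoffel symbols in their last
  argument.\<close>

lemma conn_coord_expand:
  assumes "q \<in> cdom a"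
  shows "D q u (coord_field A a v) = (\<Sum>b\<in>Basis. (v \<bullet> b) *\<^sub>R D q u (coord_field A a b))"
proof -
  have s: "smooth_fun A (cdom a) (\<lambda>q. c)" for c
    by (rule smooth_funI[OF open_dom order_refl]) (simp add: o_def smooth_on_const)
  have "D q u (coord_field A a v) = D q u (\<lambda>q. \<Sum>b\<in>Basis. (v \<bullet> b) *\<^sub>R coord_field A a b q)"
    by (rule conn_local[OF open_dom smooth_coord_field smooth_lincomb[OF open_dom order_refl s] assms])
      (rule coord_field_lincomb)
  also have "\<dots> = (\<Sum>b\<in>Basis. dir_deriv A (\<lambda>q. v \<bullet> b) q u *\<^sub>R coord_field A a b q + (v \<bullet> b) *\<^sub>R D q u (coord_field A a b))"
    by (rule conn_lincomb[OF open_dom order_refl assms finite_Basis]) (rule s)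
  also have "\<dots> = (\<Sum>b\<in>Basis. (v \<bullet> b) *\<^sub>R D q u (coord_field A a b))"
    by (simp add: dir_deriv_def o_def)
  finally show ?thesis .
qed

lemma christoffel_coord:
  assumes "q \<in> cdom a"
  shows "D q (coord_field A a u q) (coord_field A a v) = coord_field A a (\<Gamma> a (chart A a q) u v) q"
  unfolding christoffel_def by (rule coord_field_local_rep[OF assms, symmetric])

lemma christoffel_components:
  assumes "x \<in> cimg a"
  shows "\<Gamma> a x u v = components A a (chart_inv A a x) (D (chart_inv A a x) (coord_field A a u (chart_inv A a x)) (coord_field A a v))"
  by (simp add: christoffel_def local_rep_def)

lemma christoffel_centre: "\<Gamma> a (chart A a a) u v = D a u (coord_field A a v)"
  by (simp add: christoffel_def local_rep_centre coord_field_centre)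

lemma christoffel_bilinear:
  assumes x: "x \<in> cimg a"
  shows "bilinear (\<Gamma> a x)"
proof -
  let ?q = "chart_inv A a x"
  have q: "?q \<in> cdom a" using x by (rule chart_inv_dom)
  have lc: "linear (components A a ?q)" by (rule linear_components[OF q])
  have "linear (\<lambda>u. \<Gamma> a x u v)" for v
  proof -
    have "linear (components A a ?q \<circ> ((\<lambda>u. D ?q u (coord_field A a v)) \<circ> (\<lambda>u. coord_field A a u ?q)))"
      by (intro linear_compose linear_coord_field[OF q] conn_linear[OF open_dom smooth_coord_field q] lc)
    then show ?thesis by (simp add: christoffel_components[OF x] o_def)
  qed
  moreover have "linear (\<lambda>v. \<Gamma> a x u v)" for u
  proof -
    have "\<Gamma> a x u v = (\<Sum>b\<in>Basis. (v \<bullet> b) *\<^sub>R \<Gamma> a x u b)" for v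
      unfolding christoffel_components[OF x]
      by (subst conn_coord_expand[OF q]) (simp add: linear_sum[OF lc] linear_scale[OF lc])
    then show ?thesis by (rule linear_euclideanI)
  qed
  ultimately show ?thesis by (simp add: bilinear_def)
qed

lemma christoffel_smooth: "smooth_on (cimg a) (\<lambda>x. \<Gamma> a x u v)"
  unfolding christoffel_def
  by (rule smooth_vector_fieldD[OF conn_smooth[OF open_dom smooth_coord_field smooth_coord_field] order_refl])

text \<open>The coordinate formula for a covariant derivative, from the axioms: near p the field is
  a combination of coordinate fields with smooth coefficients, and the locality axiom admits an
  expansion that holds only on \<open>V\<close>.\<close>

lemma conn_centre:
  assumes W: "open W" "p \<in> W" and X: "smooth_vector_field A W X"
  shows "D p u X = fd (local_rep A p X) (chart A p p) u + \<Gamma> p (chart A p p) u (X p)"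
proof -
  define V where "V = W \<inter> cdom p"
  have V: "open V" "V \<subseteq> cdom p" "p \<in> V" using W open_dom centre_dom by (auto simp: V_def)
  have XV: "smooth_vector_field A V X" using X by (rule smooth_vector_field_subset) (simp add: V_def)
  define F where "F b q = local_rep A p X (chart A p q) \<bullet> b" for b q
  have oV: "open (chart A p ` V)" using open_chart_image[OF W(1)] by (simp add: V_def)
  have rep: "smooth_on (chart A p ` V) (local_rep A p X)" by (rule smooth_vector_fieldD[OF XV V(2)])
  have F': "smooth_on (chart A p ` V) (\<lambda>x. local_rep A p X x \<bullet> b)" for b
    by (rule smooth_on_bounded_linear[OF oV bounded_linear_inner_left rep])
  have eq: "(F b \<circ> chart_inv A p) x = local_rep A p X x \<bullet> b" if "x \<in> chart A p ` V" for b x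
    using that V(2) by (auto simp: F_def)
  have F: "smooth_fun A V (F b)" for b
    by (rule smooth_funI[OF V(1,2) smooth_on_congI[OF oV F' eq]])
  have pV: "chart A p p \<in> chart A p ` V" using V by auto
  have dF: "dir_deriv A (F b) p u = fd (local_rep A p X) (chart A p p) u \<bullet> b" for b
  proof -
    have "fd (F b \<circ> chart_inv A p) (chart A p p) = fd (\<lambda>x. local_rep A p X x \<bullet> b) (chart A p p)"
      by (rule fd_cong_open[OF oV pV eq])
    then show ?thesis
      by (simp add: dir_deriv_def fd_bounded_linear[OF bounded_linear_inner_left smooth_on_differentiable[OF rep pV]])
  qed
  have "X q = (\<Sum>b\<in>Basis. F b q *\<^sub>R coord_field A p b q)" if "q \<in> V" for q
    using that V(2) coord_field_lincomb[of q p] coord_field_local_rep[of q p X] unfolding F_def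
    by (metis subsetD)
  then have "D p u X = D p u (\<lambda>q. \<Sum>b\<in>Basis. F b q *\<^sub>R coord_field A p b q)"
    by (rule conn_local[OF V(1) XV smooth_lincomb[OF V(1,2) F] V(3)])
  also have "\<dots> = (\<Sum>b\<in>Basis. dir_deriv A (F b) p u *\<^sub>R coord_field A p b p + F b p *\<^sub>R D p u (coord_field A p b))"
    by (rule conn_lincomb[OF V finite_Basis F])
  also have "\<dots> = (\<Sum>b\<in>Basis. (fd (local_rep A p X) (chart A p p) u \<bullet> b) *\<^sub>R b)
      + (\<Sum>b\<in>Basis. (X p \<bullet> b) *\<^sub>R D p u (coord_field A p b))"
    by (simp add: dF F_def local_rep_centre coord_field_centre sum.distrib)
  also have "\<dots> = fd (local_rep A p X) (chart A p p) u + \<Gamma> p (chart A p p) u (X p)"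
    by (simp add: euclidean_representation christoffel_centre conn_coord_expand[OF centre_dom, where u=u and v="X p"])
  finally show ?thesis .
qed

text \<open>The inner covariant derivative has the Christoffel symbols as its representative, so
  \<open>conn_centre\<close> differentiates it; the bracket term vanishes.\<close>

lemma curvature_coord_fields:
  "curvature A D (coord_field A p a) (coord_field A p b) (coord_field A p c) p =
    coord_curvature (\<Gamma> p) (chart A p p) a b c"
proof -
  have 1: "D p a (\<lambda>q. D q (coord_field A p b q) (coord_field A p c)) =
      fd (\<lambda>x. \<Gamma> p x b c) (chart A p p) a + \<Gamma> p (chart A p p) a (\<Gamma> p (chart A p p) b c)" for a b
    using conn_centre[OF open_dom centre_dom conn_smooth[OF open_dom smooth_coord_field smooth_coord_field], of p a b c]
    by (simp add: christoffel_def[abs_def] local_rep_centre)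
  have 2: "D p 0 (coord_field A p c) = 0"
    using linear_0[OF conn_linear[OF open_dom smooth_coord_field centre_dom]] .
  show ?thesis
    by (simp add: curvature_def coord_field_centre 1 2 lie_bracket_coord_fields[OF centre_dom] coord_curvature_def)
qed

end

section \<open>Levi-Civita connections in charts: symmetric Christoffel symbols and metric
  compatibility\<close>

locale manifold_levi_civita = manifold_atlas A
  for A :: "('p::{t2_space,second_countable_topology}, 'e::euclidean_space) atlas" +
  fixes g :: "'p \<Rightarrow> 'e \<Rightarrow> 'e \<Rightarrow> real" and D :: "('p, 'e) connection"
  assumes levi_civita: "levi_civita A g D"
begin

sublocale manifold_connection
  using levi_civita by unfold_locales (simp add: levi_civita_def)

lemma christoffel_sym:
  assumes "x \<in> cimg a"
  shows "\<Gamma> a x u v = \<Gamma> a x v u"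
proof -
  let ?q = "chart_inv A a x"
  have q: "?q \<in> cdom a" using assms by (rule chart_inv_dom)
  have "D ?q (coord_field A a u ?q) (coord_field A a v) - D ?q (coord_field A a v ?q) (coord_field A a u)
      = lie_bracket A (coord_field A a u) (coord_field A a v) ?q"
    using levi_civita open_dom smooth_coord_field q unfolding levi_civita_def by blast
  then show ?thesis by (simp add: lie_bracket_coord_fields[OF q] christoffel_components[OF assms])
qed

text \<open>Metric compatibility read in a fixed chart. Differentiability is a hypothesis because it
  has two sources: smoothness of the metric for the ambient space and the base, the pull-back along
  the immersion for the warped product.\<close>

lemma metric_rep_deriv:
  assumes x: "x \<in> cimg a" and d: "(\<lambda>y. metric_rep A g a y v w) differentiable (at x)"
  shows "fd (\<lambda>y. metric_rep A g a y v w) x u = metric_rep A g a x (\<Gamma> a x u v) w + metric_rep A g a x v (\<Gamma> a x u w)"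
proof -
  let ?q = "chart_inv A a x"
  have q: "?q \<in> cdom a" using assms by (simp add: chart_inv_dom)
  let ?F = "\<lambda>q. g q (coord_field A a v q) (coord_field A a w q)"
  have eq: "?F \<circ> chart_inv A a = (\<lambda>y. metric_rep A g a y v w)" by (simp add: fun_eq_iff metric_rep_def)
  have "dir_deriv A ?F ?q (coord_field A a u ?q) =
      g ?q (D ?q (coord_field A a u ?q) (coord_field A a v)) (coord_field A a w ?q)
    + g ?q (coord_field A a v ?q) (D ?q (coord_field A a u ?q) (coord_field A a w))"
    using levi_civita open_dom smooth_coord_field q unfolding levi_civita_def by blast
  moreover have "dir_deriv A ?F ?q (coord_field A a u ?q) = fd (\<lambda>y. metric_rep A g a y v w) x u"
    using dir_deriv_chart[OF q, of ?F] d x by (simp add: eq components_coord[OF q])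
  ultimately show ?thesis using x by (simp add: christoffel_coord[OF q] metric_rep_def)
qed

end

lemma (in manifold_atlas) metric_rep_smooth:
  assumes "riemannian_manifold A g"
  shows "smooth_on (cimg a) (\<lambda>x. metric_rep A g a x u v)"
proof -
  have "smooth_fun A (cdom a) (\<lambda>q. g q (coord_field A a u q) (coord_field A a v q))"
    using assms open_dom smooth_coord_field unfolding riemannian_manifold_def by blast
  then have "smooth_on (chart A a ` (cdom a \<inter> cdom a)) ((\<lambda>q. g q (coord_field A a u q) (coord_field A a v q)) \<circ> chart_inv A a)"
    unfolding smooth_fun_def by blast
  then show ?thesis by (simp add: metric_rep_def o_def)
qed

lemma (in manifold_atlas) metric_rep_bilinear:
  assumes "bilinear (g (chart_inv A a x))" "x \<in> cimg a"
  shows "bilinear (metric_rep A g a x)"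
proof -
  have l: "linear (\<lambda>u. coord_field A a u (chart_inv A a x))"
    using assms by (intro linear_coord_field chart_inv_dom)
  have "linear (\<lambda>u. g (chart_inv A a x) u w)" "linear (g (chart_inv A a x) w)" for w
    using assms(1) by (simp_all add: bilinear_def)
  from linear_compose[OF l this(1)] linear_compose[OF l this(2)] show ?thesis
    by (simp add: bilinear_def metric_rep_def[abs_def] o_def)
qed

lemma (in manifold_atlas) metric_rep_centre: "metric_rep A g a (chart A a a) u v = g a u v"
  by (simp add: metric_rep_def coord_field_centre centre_dom)

text \<open>The derivative of the frame field occurs in both terms of the Laplacian and cancels, so
  only the values of the frame at p remain. Each summand is minus a diagonal entry of the
  Hessian.\<close>

lemma (in manifold_connection) laplacian_coord:
  assumes V: "open V" "p \<in> V" and w: "\<And>i. i \<in> {1..DIM('e)} \<Longrightarrow> smooth_vector_field A V (w i)"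
    and F: "smooth_fun A UNIV F"
  defines "\<phi> \<equiv> F \<circ> chart_inv A p" and "x \<equiv> chart A p p"
  shows "laplacian A D w F p =
    (\<Sum>i=1..DIM('e). fd \<phi> x (\<Gamma> p x (w i p) (w i p)) - fd (\<lambda>y. fd \<phi> y (w i p)) x (w i p))"
  unfolding laplacian_def
proof (rule sum.cong[OF refl])
  fix i assume i: "i \<in> {1..DIM('e)}"
  let ?U = "chart A p ` (V \<inter> cdom p)"
  have oU: "open ?U" by (rule open_chart_image[OF V(1)])
  have xU: "x \<in> ?U" using V(2) centre_dom by (auto simp: x_def)
  have \<phi>: "smooth_on ?U \<phi>"
    using F unfolding smooth_fun_def \<phi>_def by (rule allE[where x=p]) (rule smooth_on_subset, auto)
  have w': "smooth_on ?U (local_rep A p (w i))" using w[OF i] by (simp add: smooth_vector_field_def)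
  have "((\<lambda>y. fd \<phi> y (local_rep A p (w i) y)) has_derivative
    (\<lambda>u. fd (\<lambda>y. fd \<phi> y (local_rep A p (w i) x)) x u + fd \<phi> x (fd (local_rep A p (w i)) x u))) (at x)"
    by (rule has_derivative_linear_apply[OF oU smooth_on_linear_fd[OF \<phi>] smooth_on_fd[OF \<phi>] xU smooth_on_differentiable[OF w' xU]])
  then have "(((\<lambda>q. dir_deriv A F q (w i q)) \<circ> chart_inv A p) has_derivative
    (\<lambda>u. fd (\<lambda>y. fd \<phi> y (local_rep A p (w i) x)) x u + fd \<phi> x (fd (local_rep A p (w i)) x u))) (at x)"
  proof (rule has_derivative_transform_within_open[OF _ oU xU])
    fix y assume y: "y \<in> ?U"
    then have q: "chart_inv A p y \<in> cdom p" "chart A p (chart_inv A p y) = y" by auto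
    then show "fd \<phi> y (local_rep A p (w i) y) = ((\<lambda>q. dir_deriv A F q (w i q)) \<circ> chart_inv A p) y"
      using dir_deriv_chart[OF q(1), of F] smooth_on_differentiable[OF \<phi> y] by (simp add: \<phi>_def local_rep_def)
  qed
  then have "dir_deriv A (\<lambda>q. dir_deriv A F q (w i q)) p (w i p) =
    fd (\<lambda>y. fd \<phi> y (w i p)) x (w i p) + fd \<phi> x (fd (local_rep A p (w i)) x (w i p))"
    using fd_eqI by (fastforce simp: dir_deriv_def x_def local_rep_centre)
  moreover have "dir_deriv A F p (D p (w i p) (w i)) =
    fd \<phi> x (fd (local_rep A p (w i)) x (w i p)) + fd \<phi> x (\<Gamma> p x (w i p) (w i p))"
    using linear_add[OF smooth_on_linear_fd[OF \<phi> xU]]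
    by (simp add: dir_deriv_def conn_centre[OF V w[OF i]] \<phi>_def x_def)
  ultimately show "dir_deriv A F p (D p (w i p) (w i)) - dir_deriv A (\<lambda>q. dir_deriv A F q (w i q)) p (w i p) =
    fd \<phi> x (\<Gamma> p x (w i p) (w i p)) - fd (\<lambda>y. fd \<phi> y (w i p)) x (w i p)" by simp
qed

section \<open>Products of manifolds\<close>

lemma smooth_on_Pair:
  assumes "open S" "smooth_on S F" "smooth_on S G"
  shows "smooth_on S (\<lambda>x. (F x, G x))"
proof -
  have "bounded_linear (\<lambda>a. (a, 0))" "bounded_linear (\<lambda>b. (0, b))"
    by (intro bounded_linear_Pair bounded_linear_ident bounded_linear_zero)+
  then have "smooth_on S (\<lambda>x. (F x, 0) + (0, G x))"
    using assms by (intro smooth_on_add) (auto intro: smooth_on_bounded_linear[where L="\<lambda>a. (a, 0)"]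
      smooth_on_bounded_linear[where L="\<lambda>b. (0, b)"])
  then show ?thesis by simp
qed

lemma Ck_on_ident: "Ck_on k S (\<lambda>x. x)"
  by (cases k) (auto simp: Ck_on_const)

lemma smooth_on_ident: "smooth_on S (\<lambda>x. x)"
  by (simp add: smooth_on_def Ck_on_ident)

lemma smooth_on_map_prod:
  assumes "open S" "open T" "smooth_on S F" "smooth_on T G"
  shows "smooth_on (S \<times> T) (map_prod F G)"
proof -
  have o: "open (S \<times> T)" using assms by (simp add: open_Times)
  have "smooth_on (S \<times> T) (\<lambda>z. (F (fst z), G (snd z)))"
    by (intro smooth_on_Pair o smooth_on_compose[OF o assms(1) _ _ assms(3)] smooth_on_compose[OF o assms(2) _ _ assms(4)]
        smooth_on_bounded_linear[OF o bounded_linear_fst smooth_on_ident] smooth_on_bounded_linear[OF o bounded_linear_snd smooth_on_ident])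
      auto
  then show ?thesis by (simp add: map_prod_def case_prod_beta')
qed

lemma has_derivative_map_prod:
  assumes "(F has_derivative F') (at (fst z))" "(G has_derivative G') (at (snd z))"
  shows "(map_prod F G has_derivative map_prod F' G') (at z)"
proof -
  have "((\<lambda>z. (F (fst z), G (snd z))) has_derivative (\<lambda>u. (F' (fst u), G' (snd u)))) (at z)"
    using diff_chain_at[OF has_derivative_fst[OF has_derivative_ident] assms(1)]
      diff_chain_at[OF has_derivative_snd[OF has_derivative_ident] assms(2)]
    by (intro has_derivative_Pair) (simp_all add: o_def)
  then show ?thesis by (simp add: map_prod_def case_prod_beta')
qed

lemma has_derivative_fst_compose:
  assumes "(F has_derivative F') (at (fst x))"
  shows "((\<lambda>x. F (fst x)) has_derivative (\<lambda>w. F' (fst w))) (at x)"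
  using diff_chain_at[OF has_derivative_fst[OF has_derivative_ident] assms] by (simp add: o_def)

lemma has_derivative_snd_compose:
  assumes "(F has_derivative F') (at (snd x))"
  shows "((\<lambda>x. F (snd x)) has_derivative (\<lambda>w. F' (snd w))) (at x)"
  using diff_chain_at[OF has_derivative_snd[OF has_derivative_ident] assms] by (simp add: o_def)

lemma chart_dom_product: "chart_dom (product_atlas A B) p = chart_dom A (fst p) \<times> chart_dom B (snd p)"
  by (simp add: chart_dom_def product_atlas_def case_prod_beta)

lemma chart_product: "chart (product_atlas A B) p = map_prod (chart A (fst p)) (chart B (snd p))"
  by (simp add: chart_def product_atlas_def case_prod_beta)

locale product_manifold = A: manifold_atlas A + B: manifold_atlas B
  for A :: "('b::{t2_space,second_countable_topology}, 'e::euclidean_space) atlas"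
  and B :: "('f::{t2_space,second_countable_topology}, 'k::euclidean_space) atlas"
begin

abbreviation "M \<equiv> product_atlas A B"

lemma chart_image_product:
  "chart M p ` (X \<times> Y) = (chart A (fst p) ` X) \<times> (chart B (snd p) ` Y)"
  by (auto simp: chart_product image_iff)

lemma chart_inv_product:
  assumes "x \<in> A.cimg (fst p)" "y \<in> B.cimg (snd p)"
  shows "chart_inv M p (x, y) = (chart_inv A (fst p) x, chart_inv B (snd p) y)"
proof -
  have "inj_on (chart A a) (A.cdom a)" for a by (rule inj_on_inverseI) (rule A.chart_inv_chart)
  moreover have "inj_on (chart B a) (B.cdom a)" for a by (rule inj_on_inverseI) (rule B.chart_inv_chart)
  ultimately have "inj_on (chart M p) (chart_dom M p)"
    by (auto simp: chart_product chart_dom_product intro: map_prod_inj_on)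
  then show ?thesis
    unfolding chart_inv_def[of M] 
    by (rule inv_into_f_eq) (use assms in \<open>auto simp: chart_product chart_dom_product\<close>)
qed

lemma smooth_manifold_product: "smooth_manifold M"
  unfolding smooth_manifold_def
proof (intro conjI allI)
  fix p q :: "'b \<times> 'f"
  show o: "open (chart_dom M p)" by (simp add: chart_dom_product open_Times A.open_dom B.open_dom)
  show "p \<in> chart_dom M p" by (simp add: chart_dom_product mem_Times_iff A.centre_dom B.centre_dom)
  show "open (chart M p ` chart_dom M p)"
    by (simp add: chart_dom_product chart_image_product open_Times A.open_img B.open_img)
  have inv: "chart_inv M p z = map_prod (chart_inv A (fst p)) (chart_inv B (snd p)) z"
    if "z \<in> A.cimg (fst p) \<times> B.cimg (snd p)" for z
    using that by (cases z) (auto simp: chart_inv_product)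
  show "homeomorphism (chart_dom M p) (chart M p ` chart_dom M p) (chart M p) (chart_inv M p)"
  proof -
    have cA: "continuous_on (A.cdom a) (chart A a)" "continuous_on (A.cimg a) (chart_inv A a)" for a
      using A.chart_homeo[of a] by (auto simp: homeomorphism_def)
    have cB: "continuous_on (B.cdom a) (chart B a)" "continuous_on (B.cimg a) (chart_inv B a)" for a
      using B.chart_homeo[of a] by (auto simp: homeomorphism_def)
    have "continuous_on (chart_dom M p) (chart M p)"
      unfolding chart_dom_product chart_product map_prod_def case_prod_beta'
      by (intro continuous_on_Pair continuous_on_compose2[OF cA(1)] continuous_on_compose2[OF cB(1)] continuous_on_fst continuous_on_snd continuous_on_id) auto
    moreover have "continuous_on (chart M p ` chart_dom M p) (map_prod (chart_inv A (fst p)) (chart_inv B (snd p)))"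
      unfolding chart_dom_product chart_image_product map_prod_def case_prod_beta'
      by (intro continuous_on_Pair continuous_on_compose2[OF cA(2)] continuous_on_compose2[OF cB(2)] continuous_on_fst continuous_on_snd continuous_on_id) auto
    then have "continuous_on (chart M p ` chart_dom M p) (chart_inv M p)"
      by (rule continuous_on_eq) (simp add: inv chart_dom_product chart_image_product)
    moreover have "chart_inv M p (chart M p z) = z" if "z \<in> chart_dom M p" for z
      using that by (cases z) (auto simp: chart_product chart_dom_product chart_inv_product)
    ultimately show ?thesis by (intro homeomorphismI) auto
  qed
  let ?S = "chart A (fst p) ` (A.cdom (fst p) \<inter> A.cdom (fst q))"
  let ?T = "chart B (snd p) ` (B.cdom (snd p) \<inter> B.cdom (snd q))"
  have S: "open ?S" "open ?T" by (intro A.open_chart_image' A.open_dom B.open_chart_image' B.open_dom)+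
  have *: "chart M p ` (chart_dom M p \<inter> chart_dom M q) = ?S \<times> ?T"
    by (simp add: chart_dom_product Times_Int_Times chart_image_product)
  show "smooth_on (chart M p ` (chart_dom M p \<inter> chart_dom M q)) (chart M q \<circ> chart_inv M p)"
    unfolding *
    by (rule smooth_on_congI[OF open_Times[OF S] smooth_on_map_prod[OF S A.transition_smooth B.transition_smooth]])
      (auto simp: chart_product inv)
qed

text \<open>The Jacobian of a change of product charts is block diagonal.\<close>

lemma coord_field_product:
  assumes "q \<in> chart_dom M p"
  shows "coord_field M p u q = (coord_field A (fst p) (fst u) (fst q), coord_field B (snd p) (snd u) (snd q))"
proof -
  have q: "fst q \<in> A.cdom (fst p)" "snd q \<in> B.cdom (snd p)" using assms by (auto simp: chart_dom_product)
  have "(map_prod (chart A (fst q) \<circ> chart_inv A (fst p)) (chart B (snd q) \<circ> chart_inv B (snd p)) has_derivative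
    map_prod (trans_deriv A (fst p) (fst q) (fst q)) (trans_deriv B (snd p) (snd q) (snd q))) (at (chart M p q))"
    by (intro has_derivative_map_prod)
      (auto simp: chart_product q A.centre_dom B.centre_dom A.transition_has_derivative B.transition_has_derivative)
  then have "((chart M q \<circ> chart_inv M p) has_derivative
    map_prod (trans_deriv A (fst p) (fst q) (fst q)) (trans_deriv B (snd p) (snd q) (snd q))) (at (chart M p q))"
  proof (rule has_derivative_transform_within_open)
    show "open (A.cimg (fst p) \<times> B.cimg (snd p))" by (intro open_Times A.open_img B.open_img)
    show "chart M p q \<in> A.cimg (fst p) \<times> B.cimg (snd p)" using q by (auto simp: chart_product mem_Times_iff)
  qed (auto simp: chart_inv_product chart_product)
  from fd_eqI[OF this] show ?thesis
    by (simp add: coord_field_def[of M] coord_field_trans[of A] coord_field_trans[of B] map_prod_def case_prod_beta)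
qed

end

section \<open>Inner products\<close>

locale inner_form =
  fixes \<beta> :: "'a::euclidean_space \<Rightarrow> 'a \<Rightarrow> real"
  assumes bil: "bilinear \<beta>" and sym: "\<beta> u w = \<beta> w u" and pos: "u \<noteq> 0 \<Longrightarrow> \<beta> u u > 0"
begin

lemma add: "\<beta> (u + v) w = \<beta> u w + \<beta> v w" "\<beta> w (u + v) = \<beta> w u + \<beta> w v"
  and diff: "\<beta> (u - v) w = \<beta> u w - \<beta> v w" "\<beta> w (u - v) = \<beta> w u - \<beta> w v"
  and scale: "\<beta> (r *\<^sub>R u) w = r * \<beta> u w" "\<beta> w (r *\<^sub>R u) = r * \<beta> w u"
  and neg: "\<beta> (- u) w = - \<beta> u w" "\<beta> w (- u) = - \<beta> w u"
  and zero: "\<beta> 0 w = 0" "\<beta> w 0 = 0"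
  using bil by (simp_all add: bilinear_ladd bilinear_radd bilinear_lsub bilinear_rsub bilinear_lmul
      bilinear_rmul bilinear_lneg bilinear_rneg bilinear_lzero bilinear_rzero)

lemma sum: "\<beta> (\<Sum>i\<in>I. x i) w = (\<Sum>i\<in>I. \<beta> (x i) w)" "\<beta> w (\<Sum>i\<in>I. x i) = (\<Sum>i\<in>I. \<beta> w (x i))"
  using bil by (simp_all add: bilinear_def linear_sum[of "\<lambda>u. \<beta> u w"] linear_sum[of "\<beta> w"])

lemma nonneg: "\<beta> u u \<ge> 0"
  by (cases "u = 0") (auto simp: zero less_imp_le[OF pos])

lemma nondegenerate: "(\<And>w. \<beta> u w = \<beta> v w) \<Longrightarrow> u = v"
proof (rule ccontr)
  assume "\<And>w. \<beta> u w = \<beta> v w" "u \<noteq> v"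
  then show False using pos[of "u - v"] by (simp add: diff)
qed

definition orthonormal :: "'i set \<Rightarrow> ('i \<Rightarrow> 'a) \<Rightarrow> bool" where
  "orthonormal I e \<longleftrightarrow> finite I \<and> (\<forall>i\<in>I. \<forall>j\<in>I. \<beta> (e i) (e j) = (if i = j then 1 else 0))"

lemma orthonormal_coeff:
  assumes "orthonormal I e" "j \<in> I"
  shows "\<beta> (\<Sum>i\<in>I. r i *\<^sub>R e i) (e j) = r j"
proof -
  have "\<beta> (\<Sum>i\<in>I. r i *\<^sub>R e i) (e j) = (\<Sum>i\<in>I. if i = j then r i else 0)"
    unfolding sum scale using assms by (intro sum.cong) (auto simp: orthonormal_def)
  then show ?thesis using assms by (simp add: orthonormal_def)
qed

lemma orthonormal_inj_independent:
  assumes "orthonormal I e"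
  shows "inj_on e I" "independent (e ` I)"
proof -
  show inj: "inj_on e I"
    using assms unfolding orthonormal_def inj_on_def by (metis zero_neq_one)
  have fin: "finite I" using assms by (simp add: orthonormal_def)
  show "independent (e ` I)"
  proof
    assume "dependent (e ` I)"
    then obtain r where r: "\<exists>v\<in>e ` I. r v \<noteq> 0" "(\<Sum>v\<in>e ` I. r v *\<^sub>R v) = 0"
      using fin by (auto simp: dependent_finite)
    from r(2) have "(\<Sum>i\<in>I. r (e i) *\<^sub>R e i) = 0" by (simp add: sum.reindex[OF inj])
    then have "r (e j) = 0" if "j \<in> I" for j
      using orthonormal_coeff[OF assms that, of "\<lambda>i. r (e i)"] by (simp add: zero)
    then show False using r(1) by auto
  qed
qed

text \<open>A full orthonormal system is independent and hence spans; the remainder is orthogonal to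
  the span, therefore to itself.\<close>

lemma orthonormal_expand:
  assumes e: "orthonormal I e" "card I = DIM('a)"
  shows "x = (\<Sum>i\<in>I. \<beta> x (e i) *\<^sub>R e i)"
proof -
  have "UNIV \<subseteq> span (e ` I)"
    using orthonormal_inj_independent[OF e(1)] e(2)
    by (intro card_ge_dim_independent) (auto simp: card_image)
  moreover define y where "y = x - (\<Sum>i\<in>I. \<beta> x (e i) *\<^sub>R e i)"
  ultimately have y: "y \<in> span (e ` I)" by auto
  have "\<beta> y z = 0" if "z \<in> e ` I" for z
    using that orthonormal_coeff[OF e(1)] by (auto simp: y_def diff)
  moreover have "linear (\<beta> y)" using bil by (simp add: bilinear_def)
  ultimately have "\<beta> y y = 0" using linear_eq_0_on_span[of "\<beta> y" "e ` I" y] y by blast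
  then have "y = 0" using pos[of y] by fastforce
  then show ?thesis by (simp add: y_def)
qed

text \<open>Expand \<open>v\<close> in \<open>e\<close>; by Parseval the coefficient of
  \<open>T (e i) (e k)\<close> is \<open>\<beta> (e i) (e k)\<close>. The values of \<open>T\<close>
  are vectors and the index types may differ, so that it covers both H and the norm of h, and
  passage from a numbered frame to one split into base and fibre.\<close>

lemma orthonormal_trace:
  fixes T :: "'a \<Rightarrow> 'a \<Rightarrow> 'c::real_vector"
  assumes e: "orthonormal I e" "card I = DIM('a)" and v: "orthonormal J v" "card J = DIM('a)"
    and T: "bilinear T"
  shows "(\<Sum>j\<in>J. T (v j) (v j)) = (\<Sum>i\<in>I. T (e i) (e i))"
proof -
  have T1: "linear (\<lambda>x. T x y)" and T2: "linear (T y)" for y using T by (simp_all add: bilinear_def)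
  have fin: "finite I" "finite J" using e v by (simp_all add: orthonormal_def)
  have "T (v j) (v j) = (\<Sum>i\<in>I. \<Sum>k\<in>I. (\<beta> (v j) (e i) * \<beta> (v j) (e k)) *\<^sub>R T (e i) (e k))" for j
  proof -
    have "T (v j) (v j) = T (\<Sum>i\<in>I. \<beta> (v j) (e i) *\<^sub>R e i) (\<Sum>k\<in>I. \<beta> (v j) (e k) *\<^sub>R e k)"
      using orthonormal_expand[OF e, of "v j"] by simp
    then show ?thesis
      by (subst sum.swap)
        (simp add: linear_sum[OF T1] linear_sum[OF T2] linear_scale[OF T1] linear_scale[OF T2] scaleR_sum_right mult.commute)
  qed
  then have "(\<Sum>j\<in>J. T (v j) (v j)) = (\<Sum>j\<in>J. \<Sum>i\<in>I. \<Sum>k\<in>I. (\<beta> (v j) (e i) * \<beta> (v j) (e k)) *\<^sub>R T (e i) (e k))"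
    by simp
  also have "\<dots> = (\<Sum>i\<in>I. \<Sum>j\<in>J. \<Sum>k\<in>I. (\<beta> (v j) (e i) * \<beta> (v j) (e k)) *\<^sub>R T (e i) (e k))"
    by (rule sum.swap)
  also have "\<dots> = (\<Sum>i\<in>I. \<Sum>k\<in>I. \<Sum>j\<in>J. (\<beta> (v j) (e i) * \<beta> (v j) (e k)) *\<^sub>R T (e i) (e k))"
    by (intro sum.cong refl sum.swap)
  also have "\<dots> = (\<Sum>i\<in>I. \<Sum>k\<in>I. \<beta> (e i) (e k) *\<^sub>R T (e i) (e k))"
  proof (intro sum.cong refl)
    fix i k
    have "\<beta> (e i) (e k) = \<beta> (\<Sum>j\<in>J. \<beta> (e i) (v j) *\<^sub>R v j) (e k)"
      using orthonormal_expand[OF v, of "e i"] by simp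
    also have "\<dots> = (\<Sum>j\<in>J. \<beta> (v j) (e i) * \<beta> (v j) (e k))"
      unfolding sum scale by (simp add: sym[of "e i"])
    finally show "(\<Sum>j\<in>J. (\<beta> (v j) (e i) * \<beta> (v j) (e k)) *\<^sub>R T (e i) (e k)) = \<beta> (e i) (e k) *\<^sub>R T (e i) (e k)"
      by (simp add: scaleR_sum_left)
  qed
  also have "\<dots> = (\<Sum>i\<in>I. \<Sum>k\<in>I. if k = i then T (e i) (e k) else 0)"
    using e(1) by (intro sum.cong refl) (auto simp: orthonormal_def)
  also have "\<dots> = (\<Sum>i\<in>I. T (e i) (e i))" using fin by simp
  finally show ?thesis .
qed

text \<open>Gram-Schmidt: fewer vectors than the dimension leave some \<open>x\<close> outside their
  span, and the normalised remainder of \<open>x\<close> is the next vector.\<close>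

lemma orthonormal_exists:
  obtains e where "orthonormal {1..DIM('a)} e"
proof -
  have "n \<le> DIM('a) \<Longrightarrow> \<exists>e. orthonormal {1..n} e" for n
  proof (induction n)
    case 0 then show ?case by (simp add: orthonormal_def)
  next
    case (Suc n)
    then obtain e where e: "orthonormal {1..n} e" by auto
    have "dim (span (e ` {1..n})) \<le> n"
      using dim_le_card'[of "e ` {1..n}"] card_image_le[of "{1..n}" e] by simp
    then have "span (e ` {1..n}) \<noteq> UNIV" using Suc.prems dim_UNIV[where 'a='a] by (metis not_less_eq_eq)
    then obtain x where x: "x \<notin> span (e ` {1..n})" by auto
    define y where "y = x - (\<Sum>i\<in>{1..n}. \<beta> x (e i) *\<^sub>R e i)"
    have "(\<Sum>i\<in>{1..n}. \<beta> x (e i) *\<^sub>R e i) \<in> span (e ` {1..n})"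
      by (intro span_sum span_scale span_base) auto
    then have "y \<noteq> 0" using x by (auto simp: y_def)
    then have yy: "\<beta> y y > 0" by (rule pos)
    have ye: "\<beta> y (e j) = 0" "\<beta> (e j) y = 0" if "j \<in> {1..n}" for j
      using orthonormal_coeff[OF e that] sym[of y "e j"] by (auto simp: y_def diff)
    let ?e = "e(Suc n := (1 / sqrt (\<beta> y y)) *\<^sub>R y)"
    have "orthonormal {1..Suc n} ?e"
      unfolding orthonormal_def
    proof (intro conjI ballI)
      fix i j assume "i \<in> {1..Suc n}" "j \<in> {1..Suc n}"
      then consider "i \<in> {1..n}" "j \<in> {1..n}" | "i \<in> {1..n}" "j = Suc n" | "i = Suc n" "j \<in> {1..n}" | "i = Suc n" "j = Suc n"
        by fastforce
      then show "\<beta> (?e i) (?e j) = (if i = j then 1 else 0)"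
      proof cases
        case 1 then show ?thesis using e by (auto simp: orthonormal_def)
      next
        case 4 then show ?thesis using yy by (simp add: scale)
      qed (auto simp: scale ye)
    qed simp
    then show ?case by blast
  qed
  then show ?thesis using that by blast
qed

text \<open>The square of \<open>a - c\<close> is nonnegative. This is the source of the 4 in the
  upper bound.\<close>

lemma product_le: "\<beta> a c \<le> \<beta> (a + c) (a + c) / 4"
  using nonneg[of "a - c"] by (simp add: add diff sym[of c a])

text \<open>Cauchy-Schwarz against the all-ones vector, obtained by bounding each product
  \<open>\<beta> (y k) (y l)\<close> by the mean of the two squares.\<close>

lemma sum_square_le:
  assumes "finite K"
  shows "\<beta> (\<Sum>k\<in>K. y k) (\<Sum>k\<in>K. y k) \<le> real (card K) * (\<Sum>k\<in>K. \<beta> (y k) (y k))"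
proof -
  have "\<beta> (y k) (y l) \<le> (\<beta> (y k) (y k) + \<beta> (y l) (y l)) / 2" for k l
    using nonneg[of "y k - y l"] by (simp add: diff sym[of "y l" "y k"])
  then have "(\<Sum>k\<in>K. \<Sum>l\<in>K. \<beta> (y k) (y l)) \<le> (\<Sum>k\<in>K. \<Sum>l\<in>K. (\<beta> (y k) (y k) + \<beta> (y l) (y l)) / 2)"
    by (intro sum_mono)
  also have "\<dots> = real (card K) * (\<Sum>k\<in>K. \<beta> (y k) (y k))"
    by (simp add: sum_divide_distrib[symmetric] sum.distrib sum_distrib_left sum_distrib_right mult_ac)
  finally show ?thesis unfolding sum(1) by (simp only: sum(2))
qed

text \<open>Chen's inequality: merging the entries \<open>i\<close> and \<open>s\<close> writes the trace as a sum of \<open>card K - 1\<close> vectors.\<close>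

lemma chen_inequality:
  assumes K: "finite K" "i \<in> K" "s \<in> K" "i \<noteq> s" and hs: "h i s = h s i"
  shows "\<beta> (\<Sum>k\<in>K. h k k) (\<Sum>k\<in>K. h k k) / (2 * (real (card K) - 1))
      - (\<Sum>k\<in>K. \<Sum>l\<in>K. \<beta> (h k l) (h k l)) / 2 \<le> \<beta> (h i i) (h s s) - \<beta> (h i s) (h i s)"
proof -
  define L where "L = K - {i, s}"
  define y where "y k = (if k = i then h i i + h s s else h k k)" for k
  have L: "finite L" "i \<notin> L" "s \<notin> L" "K = insert i (insert s L)" using K by (auto simp: L_def)
  have cK: "card K = card L + 2" using L K(4) by simp
  have trace: "(\<Sum>k\<in>K. h k k) = (\<Sum>k\<in>insert i L. y k)"
  proof -
    have "(\<Sum>k\<in>L. y k) = (\<Sum>k\<in>L. h k k)" using L by (intro sum.cong) (auto simp: y_def)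
    then show ?thesis using L K(4) by (simp add: y_def add_ac)
  qed
  have yy: "(\<Sum>k\<in>insert i L. \<beta> (y k) (y k)) = \<beta> (h i i + h s s) (h i i + h s s) + (\<Sum>k\<in>L. \<beta> (h k k) (h k k))"
  proof -
    have "(\<Sum>k\<in>L. \<beta> (y k) (y k)) = (\<Sum>k\<in>L. \<beta> (h k k) (h k k))" using L by (intro sum.cong) (auto simp: y_def)
    then show ?thesis using L by (simp add: y_def)
  qed
  \<comment> \<open>After merging, the index set \<open>insert i L\<close> has
    \<open>card K - 1\<close> elements; this gives the denominator 2(m - 1).\<close>
  have "\<beta> (\<Sum>k\<in>K. h k k) (\<Sum>k\<in>K. h k k) \<le> (real (card K) - 1) * (\<Sum>k\<in>insert i L. \<beta> (y k) (y k))"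
    using sum_square_le[of "insert i L" y] L(1,2) cK unfolding trace by simp
  then have 1: "\<beta> (\<Sum>k\<in>K. h k k) (\<Sum>k\<in>K. h k k) / (2 * (real (card K) - 1))
    \<le> (\<beta> (h i i + h s s) (h i i + h s s) + (\<Sum>k\<in>L. \<beta> (h k k) (h k k))) / 2"
    using cK by (simp add: yy field_simps)
  \<comment> \<open>Of the double sum only the diagonal and the two positions (i,s), (s,i) are kept;
    the others are nonnegative. Those two positions, halved, supply exactly the term
    \<open>\<beta> (h i s) (h i s)\<close>.\<close>
  have "(\<Sum>(k,l)\<in>(\<lambda>k. (k,k)) ` K \<union> {(i,s), (s,i)}. \<beta> (h k l) (h k l)) \<le> (\<Sum>(k,l)\<in>K \<times> K. \<beta> (h k l) (h k l))"
    using K nonneg by (intro sum_mono2) auto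
  moreover have "(\<Sum>(k,l)\<in>(\<lambda>k. (k,k)) ` K \<union> {(i,s), (s,i)}. \<beta> (h k l) (h k l)) =
     (\<Sum>(k,l)\<in>(\<lambda>k. (k,k)) ` K. \<beta> (h k l) (h k l)) + (\<Sum>(k,l)\<in>{(i,s), (s,i)}. \<beta> (h k l) (h k l))"
    using K by (intro sum.union_disjoint) auto
  moreover have "(\<Sum>(k,l)\<in>(\<lambda>k. (k,k)) ` K. \<beta> (h k l) (h k l)) = (\<Sum>k\<in>K. \<beta> (h k k) (h k k))"
    by (subst sum.reindex) (auto simp: inj_on_def)
  ultimately have "(\<Sum>k\<in>K. \<beta> (h k k) (h k k)) + 2 * \<beta> (h i s) (h i s) \<le> (\<Sum>k\<in>K. \<Sum>l\<in>K. \<beta> (h k l) (h k l))"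
    using K(4) hs by (simp add: sum.cartesian_product)
  moreover have "(\<Sum>k\<in>K. \<beta> (h k k) (h k k)) = \<beta> (h i i) (h i i) + \<beta> (h s s) (h s s) + (\<Sum>k\<in>L. \<beta> (h k k) (h k k))"
    using L K(4) by simp
  moreover have "\<beta> (h i i + h s s) (h i i + h s s) = \<beta> (h i i) (h i i) + 2 * \<beta> (h i i) (h s s) + \<beta> (h s s) (h s s)"
    by (simp add: add sym[of "h s s" "h i i"])
  ultimately show ?thesis using 1 by argo
qed

end

lemma riemannian_manifoldD:
  assumes "riemannian_manifold A g"
  shows "smooth_manifold A" "inner_form (g p)"
  using assms by (auto simp: riemannian_manifold_def inner_form_def)

text \<open>The algebraic core at one point, with \<kappa> the ambient sectional curvatures and
  \<open>L\<close> standing for Laplacian(f) / f. What drives both bounds is that \<open>L\<close>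
  is the same number for every fibre index s.\<close>

lemma (in inner_form) warped_sectional_sum_bounds:
  fixes h :: "'i + 'j \<Rightarrow> 'i + 'j \<Rightarrow> 'a"
  assumes fin: "finite I" "finite S" "S \<noteq> {}"
    and hs: "\<And>k l. h k l = h l k"
    and \<kappa>: "\<And>i s. i \<in> I \<Longrightarrow> s \<in> S \<Longrightarrow> lo \<le> \<kappa> i s \<and> \<kappa> i s \<le> hi"
    and L: "\<And>s. s \<in> S \<Longrightarrow> L = (\<Sum>i\<in>I. \<kappa> i s + \<beta> (h (Inl i) (Inl i)) (h (Inr s) (Inr s))
                                     - \<beta> (h (Inl i) (Inr s)) (h (Inl i) (Inr s)))"
  defines "K \<equiv> I <+> S"
  defines "tr \<equiv> \<Sum>k\<in>K. h k k" and "n \<equiv> \<Sum>k\<in>K. \<Sum>l\<in>K. \<beta> (h k l) (h k l)"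
  shows "L \<le> \<beta> tr tr / (4 * real (card S)) + real (card I) * hi"
    and "real (card I) / (2 * (real (card K) - 1)) * \<beta> tr tr - real (card I) / 2 * n + real (card I) * lo \<le> L"
proof -
  let ?a = "\<Sum>i\<in>I. h (Inl i) (Inl i)"
  let ?b = "\<Sum>s\<in>S. h (Inr s) (Inr s)"
  have finK: "finite K" using fin by (simp add: K_def)
  have tr: "tr = ?a + ?b" unfolding tr_def K_def using fin by (simp add: sum.Plus)
  have cS: "real (card S) > 0" using fin by (simp add: card_gt_0_iff)
  \<comment> \<open>The subtracted square of the mixed entry of h is dropped here.\<close>
  have up: "L \<le> real (card I) * hi + \<beta> ?a (h (Inr s) (Inr s))" if s: "s \<in> S" for s
  proof -
    have "L \<le> (\<Sum>i\<in>I. hi + \<beta> (h (Inl i) (Inl i)) (h (Inr s) (Inr s)))"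
      unfolding L[OF s] using \<kappa> s nonneg by (intro sum_mono) (smt (verit))
    then show ?thesis by (simp add: sum.distrib sum)
  qed
  \<comment> \<open>Summation over s turns the products into one product of the base and fibre parts
    of the trace, at the price of the factor \<open>card S\<close>.\<close>
  have "real (card S) * L = (\<Sum>s\<in>S. L)" by simp
  also have "\<dots> \<le> (\<Sum>s\<in>S. real (card I) * hi + \<beta> ?a (h (Inr s) (Inr s)))"
    by (intro sum_mono up)
  also have "\<dots> = real (card S) * (real (card I) * hi) + \<beta> ?a ?b"
    unfolding sum(2) by (simp add: sum.distrib)
  also have "\<dots> \<le> real (card S) * (real (card I) * hi) + \<beta> tr tr / 4"
    unfolding tr using product_le[of ?a ?b] by simp
  finally show "L \<le> \<beta> tr tr / (4 * real (card S)) + real (card I) * hi"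
    using cS by (simp add: field_simps)
  \<comment> \<open>For the lower bound a single s is enough, so Chen's inequality is used once for
    each base index; hence the factor \<open>card I\<close>.\<close>
  obtain s where s: "s \<in> S" using fin by auto
  have "(\<Sum>i\<in>I. lo + (\<beta> tr tr / (2 * (real (card K) - 1)) - n / 2)) \<le> L"
    unfolding L[OF s]
  proof (rule sum_mono)
    fix i assume i: "i \<in> I"
    have "\<beta> tr tr / (2 * (real (card K) - 1)) - n / 2
      \<le> \<beta> (h (Inl i) (Inl i)) (h (Inr s) (Inr s)) - \<beta> (h (Inl i) (Inr s)) (h (Inl i) (Inr s))"
      unfolding tr_def n_def using i s by (intro chen_inequality finK hs) (auto simp: K_def)
    then show "lo + (\<beta> tr tr / (2 * (real (card K) - 1)) - n / 2)
      \<le> \<kappa> i s + \<beta> (h (Inl i) (Inl i)) (h (Inr s) (Inr s)) - \<beta> (h (Inl i) (Inr s)) (h (Inl i) (Inr s))"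
      using \<kappa>[OF i s] by linarith
  qed
  then show "real (card I) / (2 * (real (card K) - 1)) * \<beta> tr tr - real (card I) / 2 * n + real (card I) * lo \<le> L"
    by (simp add: algebra_simps)
qed

section \<open>The Gauss equation\<close>

text \<open>The metric of the domain enters through its Levi-Civita connection, positivity at p and
  the isometry condition; its differentiability in the chart at p is drawn from \<open>gN\<close> by
  the pull-back.\<close>

locale immersed_manifold =
  A: manifold_levi_civita A g D + N: manifold_levi_civita N gN DN
  for A :: "('p::{t2_space,second_countable_topology}, 'e::euclidean_space) atlas"
    and g :: "'p \<Rightarrow> 'e \<Rightarrow> 'e \<Rightarrow> real" and D :: "('p, 'e) connection"
    and N :: "('n::{t2_space,second_countable_topology}, 'q::euclidean_space) atlas"
    and gN :: "'n \<Rightarrow> 'q \<Rightarrow> 'q \<Rightarrow> real" and DN :: "('n, 'q) connection" +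
  fixes \<psi> :: "'p \<Rightarrow> 'n" and p :: 'p
  assumes riemN: "riemannian_manifold N gN" and innerA: "inner_form (g p)"
    and immersion: "isometric_immersion A g N gN \<psi>"
begin

definition \<Psi> :: "'e \<Rightarrow> 'q" where "\<Psi> = chart N (\<psi> p) \<circ> \<psi> \<circ> chart_inv A p"

definition U :: "'e set" where "U = chart A p ` (A.cdom p \<inter> \<psi> -` N.cdom (\<psi> p))"

abbreviation "x0 \<equiv> chart A p p"

sublocale tangent: inner_form "g p" by (rule innerA)

sublocale ambient: inner_form "gN (\<psi> p)" by (rule riemannian_manifoldD[OF riemN])

lemma open_preimage: "open (\<psi> -` N.cdom b)"
  using immersion N.open_dom continuous_open_vimage
  by (auto simp: isometric_immersion_def smooth_map_def continuous_on_eq_continuous_at intro: continuous_open_vimage)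

lemma smooth_local:
  "smooth_on (chart A a ` (A.cdom a \<inter> \<psi> -` N.cdom b)) (chart N b \<circ> \<psi> \<circ> chart_inv A a)"
  using immersion by (simp add: isometric_immersion_def smooth_map_def)

text \<open>\<open>differential\<close> at \<open>q\<close> refers to the charts chosen at
  \<open>q\<close> and \<open>\<psi> q\<close>, which move with \<open>q\<close>; the chain rule
  rewrites it in two fixed charts so that it can be differentiated.\<close>

lemma differential_chart:
  assumes q: "q \<in> A.cdom a" "\<psi> q \<in> N.cdom b"
  shows "fd (chart N b \<circ> \<psi> \<circ> chart_inv A a) (chart A a q) (components A a q v)
    = components N b (\<psi> q) (differential A N \<psi> q v)"
proof -
  let ?T = "\<psi> -` N.cdom (\<psi> q) \<inter> \<psi> -` N.cdom b \<inter> A.cdom q"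
  let ?F = "chart N (\<psi> q) \<circ> \<psi> \<circ> chart_inv A q"
  have "(?F has_derivative fd ?F (chart A q q)) (at (chart A q q))"
    by (rule smooth_on_has_derivative[OF smooth_local]) (auto simp: A.centre_dom N.centre_dom)
  then have "((chart N b \<circ> chart_inv N (\<psi> q)) \<circ> (?F \<circ> (chart A q \<circ> chart_inv A a)) has_derivative
    trans_deriv N (\<psi> q) b (\<psi> q) \<circ> (fd ?F (chart A q q) \<circ> trans_deriv A a q q)) (at (chart A a q))"
    using q A.centre_dom N.centre_dom N.transition_has_derivative[of "\<psi> q" "\<psi> q" b]
    by (intro diff_chain_at A.transition_has_derivative) simp_all
  then have "((chart N b \<circ> \<psi> \<circ> chart_inv A a) has_derivative
    trans_deriv N (\<psi> q) b (\<psi> q) \<circ> (fd ?F (chart A q q) \<circ> trans_deriv A a q q)) (at (chart A a q))"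
  proof (rule has_derivative_transform_within_open)
    show "open (chart A a ` (?T \<inter> A.cdom a))"
      by (intro A.open_chart_image open_Int open_preimage A.open_dom)
  qed (use q A.centre_dom N.centre_dom in auto)
  from fd_eqI[OF this] show ?thesis
    using q by (simp add: components_trans differential_def A.trans_cocycle A.trans_refl A.centre_dom)
qed

lemma x0_U: "x0 \<in> U"
  by (auto simp: U_def A.centre_dom N.centre_dom)

lemma \<Psi>_x0: "\<Psi> x0 = chart N (\<psi> p) (\<psi> p)"
  by (simp add: \<Psi>_def A.centre_dom)

lemma U_D:
  assumes "x \<in> U"
  shows "x \<in> A.cimg p" "chart_inv A p x \<in> A.cdom p" "\<psi> (chart_inv A p x) \<in> N.cdom (\<psi> p)"
    "chart A p (chart_inv A p x) = x"
  using assms by (auto simp: U_def)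

lemma fd_\<Psi>: "x \<in> U \<Longrightarrow> fd \<Psi> x (components A p (chart_inv A p x) v) =
    components N (\<psi> p) (\<psi> (chart_inv A p x)) (differential A N \<psi> (chart_inv A p x) v)"
  using differential_chart[of "chart_inv A p x" p "\<psi> p" v] U_D by (simp add: \<Psi>_def)

lemma differential_centre: "differential A N \<psi> p v = fd \<Psi> x0 v"
  by (simp add: differential_def \<Psi>_def)

lemma open_U: "open U"
  unfolding U_def by (rule A.open_chart_image'[OF open_preimage])

sublocale coord_map "N.cimg (\<psi> p)" "christoffel N DN (\<psi> p)" "metric_rep N gN (\<psi> p)" U \<Psi>
proof
  fix y a b c assume y: "y \<in> N.cimg (\<psi> p)"
  interpret G: inner_form "gN (chart_inv N (\<psi> p) y)" by (rule riemannian_manifoldD[OF riemN])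
  show "bilinear (christoffel N DN (\<psi> p) y)" by (rule N.christoffel_bilinear[OF y])
  show "christoffel N DN (\<psi> p) y a b = christoffel N DN (\<psi> p) y b a" by (rule N.christoffel_sym[OF y])
  show "bilinear (metric_rep N gN (\<psi> p) y)" by (rule N.metric_rep_bilinear) (rule G.bil, rule y)
  show "metric_rep N gN (\<psi> p) y a b = metric_rep N gN (\<psi> p) y b a"
    unfolding metric_rep_def by (rule G.sym)
  show "fd (\<lambda>y. metric_rep N gN (\<psi> p) y b c) y a = metric_rep N gN (\<psi> p) y (christoffel N DN (\<psi> p) y a b) c
      + metric_rep N gN (\<psi> p) y b (christoffel N DN (\<psi> p) y a c)"
    by (rule N.metric_rep_deriv[OF y smooth_on_differentiable[OF N.metric_rep_smooth[OF riemN] y]])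
next
  show "smooth_on U \<Psi>" unfolding U_def \<Psi>_def by (rule smooth_local)
  show "\<Psi> x \<in> N.cimg (\<psi> p)" if "x \<in> U" for x using U_D[OF that] by (simp add: \<Psi>_def)
qed (rule N.open_img open_U N.christoffel_smooth N.metric_rep_smooth[OF riemN])+

text \<open>The isometry condition, carried over to the fixed charts at p and
  \<open>\<psi> p\<close> on all of \<open>U\<close>; it is needed near p because the metric is
  differentiated twice.\<close>

lemma pull_metric_rep:
  assumes x: "x \<in> U"
  shows "pull x u v = metric_rep A g p x u v"
proof -
  let ?q = "chart_inv A p x"
  have *: "fd \<Psi> x u = components N (\<psi> p) (\<psi> ?q) (differential A N \<psi> ?q (coord_field A p u ?q))" for u
    using fd_\<Psi>[OF x, of "coord_field A p u ?q"] by (simp add: A.components_coord U_D[OF x])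
  have c: "coord_field N (\<psi> p) (fd \<Psi> x u) (\<psi> ?q) = differential A N \<psi> ?q (coord_field A p u ?q)" for u
    unfolding * by (rule N.coord_components[OF U_D(3)[OF x]])
  have "chart_inv N (\<psi> p) (\<Psi> x) = \<psi> ?q" using U_D[OF x] by (simp add: \<Psi>_def)
  then show ?thesis
    using immersion by (simp add: pull_def metric_rep_def c isometric_immersion_def)
qed

lemma metric_rep_differentiable: "(\<lambda>y. metric_rep A g p y v w) differentiable (at x0)"
proof -
  have "(\<lambda>x. pull x v w) differentiable (at x0)"
    unfolding pull_def using has_derivative_G_pull[OF x0_U fd_\<Psi>_smooth fd_\<Psi>_smooth]
    by (rule Derivative.differentiableI)
  moreover have "(\<lambda>x. pull x v w) differentiable (at x0) \<longleftrightarrow> (\<lambda>y. metric_rep A g p y v w) differentiable (at x0)"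
    by (rule differentiable_cong_open[OF open_U x0_U]) (rule pull_metric_rep)
  ultimately show ?thesis by simp
qed

lemma fd_pull_metric_rep: "x \<in> U \<Longrightarrow> fd (\<lambda>x. pull x v w) x = fd (\<lambda>x. metric_rep A g p x v w) x"
  by (rule fd_cong_open[OF open_U]) (assumption, rule pull_metric_rep)

definition \<Gamma>0 :: "'e \<Rightarrow> 'e \<Rightarrow> 'e" where "\<Gamma>0 = christoffel A D p x0"

text \<open>The second fundamental form at p as a bilinear form on tangent vectors: the ambient
  second derivative of \<Psi> minus the image of the intrinsic one.\<close>

definition sff :: "'e \<Rightarrow> 'e \<Rightarrow> 'q" where "sff u v = hess u v x0 - fd \<Psi> x0 (\<Gamma>0 u v)"

lemma x0_img: "x0 \<in> A.cimg p" using A.centre_dom by auto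

lemma \<Gamma>0_sym: "\<Gamma>0 u v = \<Gamma>0 v u"
  unfolding \<Gamma>0_def by (rule A.christoffel_sym[OF x0_img])

lemma linear_fd_\<Psi>: "linear (fd \<Psi> x0)"
  by (rule smooth_on_linear_fd[OF \<Psi>_smooth x0_U])

lemma sff_sym: "sff u v = sff v u"
  unfolding sff_def using \<Gamma>0_sym[of u v] hess_sym[OF x0_U, of u v] by simp

lemma sff_bilinear: "bilinear sff"
proof -
  have "linear (\<lambda>u. sff u v)" for v
  proof -
    have "linear (\<lambda>u. fd (\<lambda>x. fd \<Psi> x v) x0 u)"
      by (rule smooth_on_linear_fd[OF fd_\<Psi>_smooth x0_U])
    moreover have "linear (\<lambda>u. christoffel N DN (\<psi> p) (\<Psi> x0) (fd \<Psi> x0 u) (fd \<Psi> x0 v))"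
      using linear_compose[OF linear_fd_\<Psi>, of "\<lambda>a. christoffel N DN (\<psi> p) (\<Psi> x0) a (fd \<Psi> x0 v)"]
        \<Gamma>_bilinear[OF \<Psi>_S[OF x0_U]] by (simp add: bilinear_def o_def)
    moreover have "linear (\<lambda>u. fd \<Psi> x0 (\<Gamma>0 u v))"
      using linear_compose[OF _ linear_fd_\<Psi>, of "\<lambda>u. \<Gamma>0 u v"] A.christoffel_bilinear[OF x0_img]
      by (simp add: bilinear_def o_def \<Gamma>0_def)
    ultimately show ?thesis
      unfolding sff_def hess_def cov_deriv_def by (intro linear_compose_sub linear_compose_add)
  qed
  moreover from this have "linear (\<lambda>v. sff u v)" for u by (subst sff_sym)
  ultimately show ?thesis by (simp add: bilinear_def)
qed

text \<open>Tensoriality: the derivative of the components of \<open>Y\<close> appears in the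
  ambient and in the intrinsic covariant derivative, and the two cancel.\<close>

lemma second_fundamental_form_sff:
  assumes W: "open W" "p \<in> W" and Y: "smooth_vector_field A W Y"
  shows "second_fundamental_form A D N DN \<psi> X Y p = sff (X p) (Y p)"
proof -
  let ?V = "U \<inter> chart A p ` (W \<inter> A.cdom p)"
  have oV: "open ?V" by (intro open_Int open_U A.open_chart_image W)
  have xV: "x0 \<in> ?V" using x0_U W A.centre_dom by auto
  have \<Psi>V: "smooth_on ?V \<Psi>" using \<Psi>_smooth by (rule smooth_on_subset) auto
  have Y': "smooth_on ?V (local_rep A p Y)"
    using Y unfolding smooth_vector_field_def by (rule allE[where x=p]) (rule smooth_on_subset, auto)
  have "((\<lambda>x. fd \<Psi> x (local_rep A p Y x)) has_derivative
    (\<lambda>u. fd (\<lambda>x. fd \<Psi> x (local_rep A p Y x0)) x0 u + fd \<Psi> x0 (fd (local_rep A p Y) x0 u))) (at x0)"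
    by (rule has_derivative_linear_apply[OF oV smooth_on_linear_fd[OF \<Psi>V] smooth_on_fd[OF \<Psi>V] xV smooth_on_differentiable[OF Y' xV]])
  then have "((\<lambda>x. components N (\<psi> p) (\<psi> (chart_inv A p x)) (differential A N \<psi> (chart_inv A p x) (Y (chart_inv A p x)))) has_derivative
    (\<lambda>u. fd (\<lambda>x. fd \<Psi> x (local_rep A p Y x0)) x0 u + fd \<Psi> x0 (fd (local_rep A p Y) x0 u))) (at x0)"
    by (rule has_derivative_transform_within_open[OF _ oV xV]) (simp add: local_rep_def fd_\<Psi>)
  then have "fd (\<lambda>x. components N (\<psi> p) (\<psi> (chart_inv A p x)) (differential A N \<psi> (chart_inv A p x) (Y (chart_inv A p x)))) x0
    = (\<lambda>u. fd (\<lambda>x. fd \<Psi> x (local_rep A p Y x0)) x0 u + fd \<Psi> x0 (fd (local_rep A p Y) x0 u))"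
    by (rule fd_eqI)
  then show ?thesis
    by (simp add: second_fundamental_form_def covariant_deriv_along_def A.local_rep_centre
      A.conn_centre[OF W Y] sff_def hess_def cov_deriv_def \<Gamma>0_def differential_centre
      linear_add[OF linear_fd_\<Psi>] N.christoffel_centre[symmetric] \<Psi>_x0)
qed

lemma pull_x0: "pull x0 u v = g p u v"
  by (simp add: pull_metric_rep[OF x0_U] A.metric_rep_centre)

lemma G_x0: "metric_rep N gN (\<psi> p) (\<Psi> x0) a b = gN (\<psi> p) a b"
  by (simp add: \<Psi>_x0 N.metric_rep_centre)

lemma metric_\<Psi>: "gN (\<psi> p) (fd \<Psi> x0 u) (fd \<Psi> x0 v) = g p u v"
  using pull_x0[of u v] by (simp add: pull_def G_x0)

lemma koszul_tangent:
  "2 * g p (\<Gamma>0 u v) w = fd (\<lambda>x. pull x v w) x0 u + fd (\<lambda>x. pull x u w) x0 v - fd (\<lambda>x. pull x u v) x0 w"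
proof -
  have "fd (\<lambda>x. pull x v w) x0 u = g p (\<Gamma>0 u v) w + g p (\<Gamma>0 u w) v" for u v w
    using fd_pull_metric_rep[OF x0_U, of v w]
      A.metric_rep_deriv[OF x0_img metric_rep_differentiable, of v w u] tangent.sym[of v "\<Gamma>0 u w"]
    by (simp add: A.metric_rep_centre \<Gamma>0_def)
  then show ?thesis using \<Gamma>0_sym[of v u] \<Gamma>0_sym[of w u] \<Gamma>0_sym[of w v] by simp
qed

text \<open>The ambient and the intrinsic Koszul formula have the same right-hand side, since
  \<open>pull\<close> is at once the induced metric and the metric of the domain.\<close>

lemma sff_normal: "gN (\<psi> p) (sff u v) (fd \<Psi> x0 w) = 0"
  using koszul[OF x0_U, of u v w] koszul_tangent[of u v w]
  by (simp add: sff_def ambient.diff metric_\<Psi> G_x0)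

lemma hess_product:
  "gN (\<psi> p) (hess u v x0) (hess u' v' x0) = gN (\<psi> p) (sff u v) (sff u' v') + g p (\<Gamma>0 u v) (\<Gamma>0 u' v')"
proof -
  have "hess u v x0 = sff u v + fd \<Psi> x0 (\<Gamma>0 u v)" for u v by (simp add: sff_def)
  then show ?thesis
    by (simp add: ambient.add sff_normal metric_\<Psi> ambient.sym[of "fd \<Psi> x0 _" "sff _ _"])
qed

text \<open>Each product of second derivatives splits into its normal part (\<open>sff\<close>) and
  its tangential part (\<open>\<Gamma>0\<close>). The terms without \<open>sff\<close> add up to the
  curvature of the domain in these coordinates, written through its metric.\<close>

lemma gauss_equation_orthogonal:
  assumes "\<And>x. x \<in> U \<Longrightarrow> pull x a z = 0" "\<And>x. x \<in> U \<Longrightarrow> fd (\<lambda>x. pull x a a) x z = 0"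
  shows "gN (\<psi> p) (curvature N DN (coord_field N (\<psi> p) (fd \<Psi> x0 a)) (coord_field N (\<psi> p) (fd \<Psi> x0 z))
      (coord_field N (\<psi> p) (fd \<Psi> x0 z)) (\<psi> p)) (fd \<Psi> x0 a) =
    - (fd (\<lambda>x. fd (\<lambda>x. pull x z z) x a) x0 a) / 2
    - gN (\<psi> p) (sff z z) (sff a a) - g p (\<Gamma>0 z z) (\<Gamma>0 a a)
    + gN (\<psi> p) (sff a z) (sff a z) + g p (\<Gamma>0 a z) (\<Gamma>0 a z)"
  using curvature_orthogonal_directions[OF x0_U assms]
  by (simp add: N.curvature_coord_fields G_x0 hess_product flip: \<Psi>_x0)

end

section \<open>Warped products\<close>

lemma inner_form_warped:
  assumes "inner_form (gB (fst p))" "inner_form (gF (snd p))" "f (fst p) > 0"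
  shows "inner_form (warped_metric gB f gF p)"
proof -
  interpret B: inner_form "gB (fst p)" by fact
  interpret F: inner_form "gF (snd p)" by fact
  show ?thesis
  proof
    show "bilinear (warped_metric gB f gF p)"
      unfolding bilinear_def warped_metric_def
      by (intro conjI allI linearI) (simp_all add: B.add B.scale F.add F.scale algebra_simps)
    show "warped_metric gB f gF p u w = warped_metric gB f gF p w u" for u w
      unfolding warped_metric_def using B.sym[of "fst u"] F.sym[of "snd u"] by simp
    show "0 < warped_metric gB f gF p u u" if "u \<noteq> 0" for u
    proof (cases "fst u = 0")
      case True
      then have "snd u \<noteq> 0" using that by (simp add: prod_eq_iff)
      then show ?thesis using F.pos assms(3) True by (simp add: warped_metric_def B.zero)
    next
      case False
      then show ?thesis using B.pos F.nonneg by (simp add: warped_metric_def add_pos_nonneg)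
    qed
  qed
qed

locale warped_immersion =
  P: product_manifold AB AF +
  LB: manifold_levi_civita AB gB DB +
  immersed_manifold "product_atlas AB AF" "warped_metric gB f gF" D N gN DN \<psi> p
  for AB :: "('b::{t2_space,second_countable_topology}, 'e::euclidean_space) atlas"
    and gB :: "'b \<Rightarrow> 'e \<Rightarrow> 'e \<Rightarrow> real" and DB :: "('b, 'e) connection"
    and AF :: "('f::{t2_space,second_countable_topology}, 'k::euclidean_space) atlas"
    and gF :: "'f \<Rightarrow> 'k \<Rightarrow> 'k \<Rightarrow> real" and f :: "'b \<Rightarrow> real"
    and D :: "('b \<times> 'f, 'e \<times> 'k) connection"
    and N :: "('n::{t2_space,second_countable_topology}, 'q::euclidean_space) atlas"
    and gN :: "'n \<Rightarrow> 'q \<Rightarrow> 'q \<Rightarrow> real" and DN :: "('n, 'q) connection"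
    and \<psi> :: "'b \<times> 'f \<Rightarrow> 'n" and p :: "'b \<times> 'f" +
  assumes riemB: "riemannian_manifold AB gB" and riemF: "riemannian_manifold AF gF"
    and smooth_f: "smooth_fun AB UNIV f" and f_pos: "\<And>b. f b > 0"
begin

definition \<phi> :: "'e \<Rightarrow> real" where "\<phi> = f \<circ> chart_inv AB (fst p)"

abbreviation "GB \<equiv> metric_rep AB gB (fst p)"
abbreviation "GF \<equiv> metric_rep AF gF (snd p)"
abbreviation "SB \<equiv> chart AB (fst p) ` chart_dom AB (fst p)"
abbreviation "SF \<equiv> chart AF (snd p) ` chart_dom AF (snd p)"
abbreviation "xb \<equiv> chart AB (fst p) (fst p)"
abbreviation "\<Gamma>B \<equiv> christoffel AB DB (fst p) xb"

sublocale base: inner_form "gB (fst p)" by (rule riemannian_manifoldD[OF riemB])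

sublocale fibre: inner_form "gF (snd p)" by (rule riemannian_manifoldD[OF riemF])

section \<open>The warped metric in product charts and its first and second derivatives\<close>

lemma x0_product: "fst x0 = xb" "snd x0 = chart AF (snd p) (snd p)"
  by (simp_all add: chart_product)

lemma U_product: "x \<in> U \<Longrightarrow> fst x \<in> SB" "x \<in> U \<Longrightarrow> snd x \<in> SF"
  using U_D(1)[of x] by (auto simp: chart_dom_product P.chart_image_product)

lemma xb_SB: "xb \<in> SB"
  using P.A.centre_dom by blast

lemma \<phi>_xb: "\<phi> xb = f (fst p)"
  by (simp add: \<phi>_def P.A.centre_dom)

lemma \<phi>_smooth: "smooth_on SB \<phi>"
  using smooth_f unfolding smooth_fun_def \<phi>_def by (metis Int_UNIV_left)

lemma GB_smooth: "smooth_on SB (\<lambda>y. GB y u v)"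
  by (rule P.A.metric_rep_smooth[OF riemB])

lemma GF_smooth: "smooth_on SF (\<lambda>y. GF y u v)"
  by (rule P.B.metric_rep_smooth[OF riemF])

lemma GB_zero: "y \<in> SB \<Longrightarrow> GB y 0 v = 0" "y \<in> SB \<Longrightarrow> GB y v 0 = 0"
proof -
  assume y: "y \<in> SB"
  interpret G: inner_form "gB (chart_inv AB (fst p) y)" by (rule riemannian_manifoldD[OF riemB])
  have "bilinear (GB y)" by (rule P.A.metric_rep_bilinear) (rule G.bil, rule y)
  then show "GB y 0 v = 0" "GB y v 0 = 0" by (simp_all add: bilinear_lzero bilinear_rzero)
qed

lemma GF_zero: "y \<in> SF \<Longrightarrow> GF y 0 v = 0" "y \<in> SF \<Longrightarrow> GF y v 0 = 0"
proof -
  assume y: "y \<in> SF"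
  interpret G: inner_form "gF (chart_inv AF (snd p) y)" by (rule riemannian_manifoldD[OF riemF])
  have "bilinear (GF y)" by (rule P.B.metric_rep_bilinear) (rule G.bil, rule y)
  then show "GF y 0 v = 0" "GF y v 0 = 0" by (simp_all add: bilinear_lzero bilinear_rzero)
qed

lemma pull_warped:
  assumes x: "x \<in> U"
  shows "pull x u v = GB (fst x) (fst u) (fst v) + (\<phi> (fst x))\<^sup>2 * GF (snd x) (snd u) (snd v)"
proof -
  have ci: "chart_inv (product_atlas AB AF) p x = (chart_inv AB (fst p) (fst x), chart_inv AF (snd p) (snd x))"
    using P.chart_inv_product[OF U_product[OF x]] by simp
  show ?thesis
    using P.coord_field_product[OF U_D(2)[OF x]]
    by (simp add: pull_metric_rep[OF x] metric_rep_def warped_metric_def ci \<phi>_def)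
qed

lemma fd_pull_warped:
  assumes x: "x \<in> U"
  shows "fd (\<lambda>x. pull x u v) x w = fd (\<lambda>y. GB y (fst u) (fst v)) (fst x) (fst w)
    + 2 * \<phi> (fst x) * fd \<phi> (fst x) (fst w) * GF (snd x) (snd u) (snd v)
    + (\<phi> (fst x))\<^sup>2 * fd (\<lambda>y. GF y (snd u) (snd v)) (snd x) (snd w)"
proof -
  note dB = has_derivative_fst_compose[OF smooth_on_has_derivative[OF GB_smooth U_product(1)[OF x]], of "fst u" "fst v"]
  note d\<phi> = has_derivative_fst_compose[OF smooth_on_has_derivative[OF \<phi>_smooth U_product(1)[OF x]]]
  note dF = has_derivative_snd_compose[OF smooth_on_has_derivative[OF GF_smooth U_product(2)[OF x]], of "snd u" "snd v"]
  have "((\<lambda>x. GB (fst x) (fst u) (fst v) + (\<phi> (fst x) * \<phi> (fst x)) * GF (snd x) (snd u) (snd v)) has_derivative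
    (\<lambda>w. fd (\<lambda>y. GB y (fst u) (fst v)) (fst x) (fst w)
      + ((\<phi> (fst x) * \<phi> (fst x)) * fd (\<lambda>y. GF y (snd u) (snd v)) (snd x) (snd w)
      + (\<phi> (fst x) * fd \<phi> (fst x) (fst w) + fd \<phi> (fst x) (fst w) * \<phi> (fst x)) * GF (snd x) (snd u) (snd v)))) (at x)"
    by (intro has_derivative_add has_derivative_mult dB d\<phi> dF)
  then have "((\<lambda>x. pull x u v) has_derivative
    (\<lambda>w. fd (\<lambda>y. GB y (fst u) (fst v)) (fst x) (fst w)
      + ((\<phi> (fst x) * \<phi> (fst x)) * fd (\<lambda>y. GF y (snd u) (snd v)) (snd x) (snd w)
      + (\<phi> (fst x) * fd \<phi> (fst x) (fst w) + fd \<phi> (fst x) (fst w) * \<phi> (fst x)) * GF (snd x) (snd u) (snd v)))) (at x)"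
    by (rule has_derivative_transform_within_open[OF _ open_U x]) (simp add: pull_warped power2_eq_square)
  from fd_eqI[OF this] show ?thesis by (simp add: power2_eq_square algebra_simps)
qed

lemma fd_zero [simp]:
  "y \<in> SB \<Longrightarrow> fd (\<lambda>y. GB y u v) y 0 = 0" "y \<in> SB \<Longrightarrow> fd \<phi> y 0 = 0" "y' \<in> SF \<Longrightarrow> fd (\<lambda>y. GF y u' v') y' 0 = 0"
  using smooth_on_linear_fd[OF GB_smooth] smooth_on_linear_fd[OF \<phi>_smooth] smooth_on_linear_fd[OF GF_smooth]
  by (auto simp: linear_0)

lemma fd_GB_zero [simp]:
  assumes "y \<in> SB"
  shows "fd (\<lambda>y. GB y 0 v) y = (\<lambda>w. 0)" "fd (\<lambda>y. GB y v 0) y = (\<lambda>w. 0)"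
proof -
  have "fd (\<lambda>y. GB y 0 v) y = fd (\<lambda>y. 0) y" "fd (\<lambda>y. GB y v 0) y = fd (\<lambda>y. 0) y"
    by (rule fd_cong_open[OF P.A.open_img assms]; simp add: GB_zero)+
  then show "fd (\<lambda>y. GB y 0 v) y = (\<lambda>w. 0)" "fd (\<lambda>y. GB y v 0) y = (\<lambda>w. 0)" by simp_all
qed

lemma fd_GF_zero [simp]:
  assumes "y \<in> SF"
  shows "fd (\<lambda>y. GF y 0 v) y = (\<lambda>w. 0)" "fd (\<lambda>y. GF y v 0) y = (\<lambda>w. 0)"
proof -
  have "fd (\<lambda>y. GF y 0 v) y = fd (\<lambda>y. 0) y" "fd (\<lambda>y. GF y v 0) y = fd (\<lambda>y. 0) y"
    by (rule fd_cong_open[OF P.B.open_img assms]; simp add: GF_zero)+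
  then show "fd (\<lambda>y. GF y 0 v) y = (\<lambda>w. 0)" "fd (\<lambda>y. GF y v 0) y = (\<lambda>w. 0)" by simp_all
qed

lemma xf_SF: "chart AF (snd p) (snd p) \<in> SF"
  using P.B.centre_dom by blast

lemma GF_xf: "GF (chart AF (snd p) (snd p)) u v = gF (snd p) u v"
  by (rule P.B.metric_rep_centre)

lemma fd_pull_warped_x0:
  "fd (\<lambda>x. pull x u v) x0 w = fd (\<lambda>y. GB y (fst u) (fst v)) xb (fst w)
    + 2 * f (fst p) * fd \<phi> xb (fst w) * gF (snd p) (snd u) (snd v)
    + (f (fst p))\<^sup>2 * fd (\<lambda>y. GF y (snd u) (snd v)) (chart AF (snd p) (snd p)) (snd w)"
  using fd_pull_warped[OF x0_U, of u v w] by (simp add: x0_product \<phi>_xb GF_xf)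

text \<open>Along base directions the fibre metric is constant, so this is the second derivative of
  the square of \<phi>.\<close>

lemma fd_fd_pull_fibre:
  "fd (\<lambda>x. fd (\<lambda>x. pull x (0, z) (0, z)) x (a, 0)) x0 (a, 0) =
    2 * ((fd \<phi> xb a)\<^sup>2 + f (fst p) * fd (\<lambda>y. fd \<phi> y a) xb a) * gF (snd p) z z"
proof -
  note d\<phi> = has_derivative_fst_compose[OF smooth_on_has_derivative[OF \<phi>_smooth U_product(1)[OF x0_U]]]
  note dd\<phi> = has_derivative_fst_compose[OF smooth_on_has_derivative[OF smooth_on_fd[OF \<phi>_smooth] U_product(1)[OF x0_U]]]
  note dF = has_derivative_snd_compose[OF smooth_on_has_derivative[OF GF_smooth U_product(2)[OF x0_U]]]
  have "((\<lambda>x. 2 * (\<phi> (fst x) * fd \<phi> (fst x) a) * GF (snd x) z z) has_derivative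
    (\<lambda>w. 2 * (\<phi> (fst x0) * fd \<phi> (fst x0) a) * fd (\<lambda>y. GF y z z) (snd x0) (snd w)
      + 2 * (\<phi> (fst x0) * fd (\<lambda>y. fd \<phi> y a) (fst x0) (fst w) + fd \<phi> (fst x0) (fst w) * fd \<phi> (fst x0) a) * GF (snd x0) z z)) (at x0)"
    by (intro has_derivative_mult has_derivative_mult_right d\<phi> dd\<phi> dF)
  then have "((\<lambda>x. fd (\<lambda>x. pull x (0, z) (0, z)) x (a, 0)) has_derivative
    (\<lambda>w. 2 * (\<phi> (fst x0) * fd \<phi> (fst x0) a) * fd (\<lambda>y. GF y z z) (snd x0) (snd w)
      + 2 * (\<phi> (fst x0) * fd (\<lambda>y. fd \<phi> y a) (fst x0) (fst w) + fd \<phi> (fst x0) (fst w) * fd \<phi> (fst x0) a) * GF (snd x0) z z)) (at x0)"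
    by (rule has_derivative_transform_within_open[OF _ open_U x0_U]) (simp add: fd_pull_warped U_product)
  from fd_eqI[OF this] show ?thesis
    by (simp add: x0_product \<phi>_xb GF_xf xf_SF power2_eq_square algebra_simps)
qed

section \<open>Christoffel symbols of the warped product and the resulting Gauss equation\<close>

lemma metric_warped: "warped_metric gB f gF p u v = gB (fst p) (fst u) (fst v) + (f (fst p))\<^sup>2 * gF (snd p) (snd u) (snd v)"
  by (simp add: warped_metric_def)

text \<open>The slices B x {point} are totally geodesic: for base vectors all fibre contributions to
  the Koszul formula vanish and that of the base remains. Nondegeneracy turns equal inner products
  into equal vectors.\<close>

lemma \<Gamma>0_base: "\<Gamma>0 (a, 0) (a, 0) = (\<Gamma>B a a, 0)"
proof (rule tangent.nondegenerate)
  fix w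
  have d: "fd (\<lambda>y. GB y v w) xb u = gB (fst p) (\<Gamma>B u v) w + gB (fst p) (\<Gamma>B u w) v" for u v w
    using LB.metric_rep_deriv[OF xb_SB smooth_on_differentiable[OF GB_smooth xb_SB], of v w u]
      base.sym[of v "\<Gamma>B u w"] by (simp add: P.A.metric_rep_centre)
  have "2 * warped_metric gB f gF p (\<Gamma>0 (a, 0) (a, 0)) w = 2 * warped_metric gB f gF p (\<Gamma>B a a, 0) w"
    unfolding koszul_tangent fd_pull_warped_x0
    using LB.christoffel_sym[OF xb_SB, of "fst w" a]
    by (simp add: d metric_warped fibre.zero xb_SB xf_SF)
  then show "warped_metric gB f gF p (\<Gamma>0 (a, 0) (a, 0)) w = warped_metric gB f gF p (\<Gamma>B a a, 0) w" by simp
qed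

text \<open>Only the base component is computed: in the Gauss equation this symbol is paired with
  \<open>\<Gamma>0 (a, 0) (a, 0)\<close>, which is tangent to the base.\<close>

lemma \<Gamma>0_fibre: "warped_metric gB f gF p (\<Gamma>0 (0, z) (0, z)) (w, 0) = - f (fst p) * fd \<phi> xb w * gF (snd p) z z"
  using koszul_tangent[of "(0, z)" "(0, z)" "(w, 0)"] unfolding fd_pull_warped_x0
  by (simp add: fibre.zero xb_SB xf_SF)

text \<open>The rule for the covariant derivative of a fibre field along the base, (a f / f) z: the
  factor f^2 is the only part of the metric on fibre vectors that varies along
  \<open>a\<close>.\<close>

lemma \<Gamma>0_mixed: "\<Gamma>0 (a, 0) (0, z) = (0, (fd \<phi> xb a / f (fst p)) *\<^sub>R z)"
proof (rule tangent.nondegenerate)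
  fix w
  have "2 * warped_metric gB f gF p (\<Gamma>0 (a, 0) (0, z)) w =
      2 * warped_metric gB f gF p (0, (fd \<phi> xb a / f (fst p)) *\<^sub>R z) w"
    unfolding koszul_tangent fd_pull_warped_x0 using f_pos[of "fst p"]
    by (simp add: metric_warped fibre.zero fibre.scale base.zero xb_SB xf_SF power2_eq_square)
  then show "warped_metric gB f gF p (\<Gamma>0 (a, 0) (0, z)) w =
      warped_metric gB f gF p (0, (fd \<phi> xb a / f (fst p)) *\<^sub>R z) w" by simp
qed

text \<open>The square of \<open>fd \<phi> xb a\<close> in the second derivative of the metric
  cancels against the length of the mixed symbol. What is left in the bracket is minus the Hessian
  of f on the base, a summand of its Laplacian.\<close>

lemma gauss_warped:
  "gN (\<psi> p) (curvature N DN (coord_field N (\<psi> p) (fd \<Psi> x0 (a, 0))) (coord_field N (\<psi> p) (fd \<Psi> x0 (0, z)))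
      (coord_field N (\<psi> p) (fd \<Psi> x0 (0, z))) (\<psi> p)) (fd \<Psi> x0 (a, 0)) =
    f (fst p) * gF (snd p) z z * (fd \<phi> xb (\<Gamma>B a a) - fd (\<lambda>y. fd \<phi> y a) xb a)
    - gN (\<psi> p) (sff (0, z) (0, z)) (sff (a, 0) (a, 0)) + gN (\<psi> p) (sff (a, 0) (0, z)) (sff (a, 0) (0, z))"
proof -
  have orth: "pull x (a, 0) (0, z) = 0" if "x \<in> U" for x
    using that by (simp add: pull_warped GB_zero GF_zero U_product)
  have inv: "fd (\<lambda>x. pull x (a, 0) (a, 0)) x (0, z) = 0" if "x \<in> U" for x
    using that by (simp add: fd_pull_warped GF_zero U_product)
  have mixed: "warped_metric gB f gF p (\<Gamma>0 (a, 0) (0, z)) (\<Gamma>0 (a, 0) (0, z)) = (fd \<phi> xb a)\<^sup>2 * gF (snd p) z z"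
    using f_pos[of "fst p"]
    by (simp add: \<Gamma>0_mixed metric_warped base.zero fibre.scale power2_eq_square)
  have fibre: "warped_metric gB f gF p (\<Gamma>0 (0, z) (0, z)) (\<Gamma>0 (a, 0) (a, 0))
      = - f (fst p) * fd \<phi> xb (\<Gamma>B a a) * gF (snd p) z z"
    unfolding \<Gamma>0_base by (rule \<Gamma>0_fibre)
  note gauss = gauss_equation_orthogonal[of "(a, 0)" "(0, z)", unfolded fd_fd_pull_fibre mixed fibre]
  show ?thesis
    by (subst gauss) (erule orth, erule inv, simp add: field_simps)
qed

end

section \<open>Sectional curvature of a quaternionic space form\<close>

text \<open>Here t is the squared length of the projection of \<open>Z\<close> to the span of the
  \<open>J \<alpha> X\<close>: 1 if the plane lies in a quaternionic section, 0 if \<open>Z\<close>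
  is orthogonal to that span.\<close>

lemma quaternionic_sectional_curvature:
  fixes J :: "nat \<Rightarrow> 'q::euclidean_space \<Rightarrow>\<^sub>L 'q" and g :: "'n \<Rightarrow> 'q \<Rightarrow> 'q \<Rightarrow> real" and c :: real
  assumes \<beta>: "inner_form (g p)" and J: "quaternionic_triple g p J"
    and X: "g p X X = 1" and Z: "g p Z Z = 1" and XZ: "g p X Z = 0"
  defines "R \<equiv> (c / 4) *\<^sub>R (g p Z Z *\<^sub>R X - g p X Z *\<^sub>R Z
             + (\<Sum>\<alpha>=1..3. g p (J \<alpha> Z) Z *\<^sub>R J \<alpha> X - g p (J \<alpha> X) Z *\<^sub>R J \<alpha> Z
                        - (2 * g p (J \<alpha> X) Z) *\<^sub>R J \<alpha> Z))"
  shows "\<exists>t. 0 \<le> t \<and> t \<le> 1 \<and> g p R X = c / 4 * (1 + 3 * t)"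
proof -
  interpret inner_form "g p" by (rule \<beta>)
  have JJ: "J \<alpha> (J \<alpha> u) = - u" and Jg: "g p (J \<alpha> u) (J \<alpha> w) = g p u w" if "\<alpha> \<in> {1..3}" for \<alpha> u w
  proof -
    have "J \<alpha> o\<^sub>L J \<alpha> = - id_blinfun" "g p (J \<alpha> u) (J \<alpha> w) = g p u w"
      using J that by (auto simp: quaternionic_triple_def)
    from arg_cong[OF this(1), of "\<lambda>L. blinfun_apply L u"] this(2)
    show "J \<alpha> (J \<alpha> u) = - u" "g p (J \<alpha> u) (J \<alpha> w) = g p u w" by (simp_all add: uminus_blinfun.rep_eq)
  qed
  have J12: "J 1 (J 2 u) = J 3 u" and J21: "J 2 (J 1 u) = - J 3 u" for u
  proof -
    have "J 1 o\<^sub>L J 2 = J 3" "J 2 o\<^sub>L J 1 = - J 3" using J by (simp_all add: quaternionic_triple_def)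
    from this[THEN arg_cong, of "\<lambda>L. blinfun_apply L u"]
    show "J 1 (J 2 u) = J 3 u" "J 2 (J 1 u) = - J 3 u" by (simp_all add: uminus_blinfun.rep_eq)
  qed
  have skew: "g p (J \<alpha> u) w = - g p u (J \<alpha> w)" if "\<alpha> \<in> {1..3}" for \<alpha> u w
    using Jg[OF that, of u "J \<alpha> w"] by (simp add: JJ[OF that] neg)
  have self: "g p (J \<alpha> u) u = 0" if "\<alpha> \<in> {1..3}" for \<alpha> u
    using skew[OF that, of u u] sym[of u "J \<alpha> u"] by simp
  \<comment> \<open>The quaternion relations turn each product into a multiple of some
    \<open>g p X (J \<alpha> X)\<close>, which is zero by skewness.\<close>
  have orth: "g p (J 1 X) (J 2 X) = 0" "g p (J 1 X) (J 3 X) = 0" "g p (J 2 X) (J 3 X) = 0"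
  proof -
    show "g p (J 1 X) (J 2 X) = 0"
      using skew[of 1 X "J 2 X"] self[of 3 X] sym[of X "J 3 X"] by (simp add: J12 del: One_nat_def)
    show "g p (J 1 X) (J 3 X) = 0"
      using Jg[of 1 X "J 2 X"] self[of 2 X] sym[of X "J 2 X"] by (simp add: J12 del: One_nat_def)
    show "g p (J 2 X) (J 3 X) = 0"
      using Jg[of 2 X "J 1 X"] self[of 1 X] sym[of X "J 1 X"] by (simp add: J21 neg del: One_nat_def)
  qed
  define t where "t = (\<Sum>\<alpha>=1..3. (g p (J \<alpha> X) Z)\<^sup>2)"
  have set3: "{1..3::nat} = {1, 2, 3}" by auto
  have "0 \<le> t" by (simp add: t_def sum_nonneg)
  moreover have "t \<le> 1"
  proof -
    define a where "a \<alpha> = g p (J \<alpha> X) Z" for \<alpha>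
    have JX: "g p (J \<alpha> X) (J \<alpha> X) = 1" if "\<alpha> \<in> {1..3}" for \<alpha> by (simp add: Jg[OF that] X)
    have 1: "g p (J 1 X) (J 1 X) = 1" "g p (J 2 X) (J 2 X) = 1" "g p (J 3 X) (J 3 X) = 1"
      by (simp_all add: JX del: One_nat_def)
    have 2: "g p (J 2 X) (J 1 X) = 0" "g p (J 3 X) (J 1 X) = 0" "g p (J 3 X) (J 2 X) = 0"
      using orth by (simp_all add: sym[of "J 2 X" "J 1 X"] sym[of "J 3 X" "J 1 X"] sym[of "J 3 X" "J 2 X"] del: One_nat_def)
    have 3: "g p Z (J \<alpha> X) = a \<alpha>" "g p (J \<alpha> X) Z = a \<alpha>" for \<alpha> by (simp_all add: a_def sym[of Z])
    \<comment> \<open>\<open>S\<close> is the orthogonal projection of \<open>Z\<close>, so Bessel's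
      inequality is nonnegativity of the square of \<open>Z - S\<close>, which equals 1 - t.\<close>
    define S where "S = a 1 *\<^sub>R J 1 X + (a 2 *\<^sub>R J 2 X + a 3 *\<^sub>R J 3 X)"
    have "g p S S = a 1 * a 1 + a 2 * a 2 + a 3 * a 3"
      unfolding S_def by (simp only: add scale orth 1 2) simp
    moreover have "g p Z S = a 1 * a 1 + a 2 * a 2 + a 3 * a 3" "g p S Z = a 1 * a 1 + a 2 * a 2 + a 3 * a 3"
      unfolding S_def by (simp_all only: add scale 3)
    moreover have "0 \<le> g p (Z - S) (Z - S)" by (rule nonneg)
    ultimately have "a 1 * a 1 + a 2 * a 2 + a 3 * a 3 \<le> 1" by (simp add: diff Z del: One_nat_def)
    then show ?thesis unfolding t_def set3 by (simp add: a_def power2_eq_square del: One_nat_def)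
  qed
  moreover have "g p R X = c / 4 * (1 + 3 * t)"
  proof -
    \<comment> \<open>The factor 3 is 1 + 2: by skewness the last two terms give one and two copies
      of the square, and the first vanishes.\<close>
    have "g p (g p (J \<alpha> Z) Z *\<^sub>R J \<alpha> X - g p (J \<alpha> X) Z *\<^sub>R J \<alpha> Z - (2 * g p (J \<alpha> X) Z) *\<^sub>R J \<alpha> Z) X
        = 3 * (g p (J \<alpha> X) Z)\<^sup>2" if "\<alpha> \<in> {1..3}" for \<alpha>
      using skew[OF that, of Z X] sym[of Z "J \<alpha> X"]
      by (simp add: diff scale neg self[OF that] power2_eq_square algebra_simps)
    then have "g p (\<Sum>\<alpha>=1..3. g p (J \<alpha> Z) Z *\<^sub>R J \<alpha> X - g p (J \<alpha> X) Z *\<^sub>R J \<alpha> Z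
        - (2 * g p (J \<alpha> X) Z) *\<^sub>R J \<alpha> Z) X = 3 * t"
      unfolding sum t_def by (simp add: sum_distrib_left)
    then show ?thesis unfolding R_def by (simp only: scale add diff X Z XZ) simp
  qed
  ultimately show ?thesis by blast
qed

text \<open>The curvature formula is stated for vector fields; coordinate fields of the chart at
  \<open>n\<close> extend the given tangent vectors and take their values at
  \<open>n\<close>.\<close>

lemma quaternionic_space_form_curvature:
  assumes Q: "quaternionic_space_form N gN DN E c"
    and ortho: "gN n X X = 1" "gN n Z Z = 1" "gN n X Z = 0"
  shows "\<exists>t. 0 \<le> t \<and> t \<le> 1 \<and>
    gN n (curvature N DN (coord_field N n X) (coord_field N n Z) (coord_field N n Z) n) X = c / 4 * (1 + 3 * t)"
proof -
  have K: "quaternionic_kaehler N gN DN E" and riem: "riemannian_manifold N gN"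
    using Q by (simp_all add: quaternionic_space_form_def quaternionic_kaehler_def)
  interpret N: manifold_atlas N using riemannian_manifoldD(1)[OF riem] by unfold_locales
  obtain J where J: "quaternionic_triple gN n (\<lambda>\<alpha>. J \<alpha> n)" "E n = span {J 1 n, J 2 n, J 3 n}"
    using K[unfolded quaternionic_kaehler_def, THEN conjunct2, THEN conjunct2, THEN conjunct1, THEN spec[of _ n]]
    by blast
  have JE: "\<forall>\<alpha>\<in>{1..3}. J \<alpha> n \<in> E n"
  proof
    fix \<alpha> :: nat assume "\<alpha> \<in> {1..3}"
    then have "\<alpha> = 1 \<or> \<alpha> = 2 \<or> \<alpha> = 3" by auto
    then show "J \<alpha> n \<in> E n" unfolding J(2) by (auto intro: span_base)
  qed
  have R: "curvature N DN (coord_field N n X) (coord_field N n Z) (coord_field N n Z) n =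
          (c / 4) *\<^sub>R (gN n Z Z *\<^sub>R X - gN n X Z *\<^sub>R Z
             + (\<Sum>\<alpha>=1..3. gN n (J \<alpha> n Z) Z *\<^sub>R J \<alpha> n X
                        - gN n (J \<alpha> n X) Z *\<^sub>R J \<alpha> n Z
                        - (2 * gN n (J \<alpha> n X) Z) *\<^sub>R J \<alpha> n Z))"
    using Q[unfolded quaternionic_space_form_def, THEN conjunct2, THEN conjunct2, THEN spec[of _ "chart_dom N n"],
        THEN spec[of _ "coord_field N n X"], THEN spec[of _ "coord_field N n Z"], THEN spec[of _ "coord_field N n Z"],
        THEN spec[of _ n], THEN spec[of _ "\<lambda>\<alpha>. J \<alpha> n"]] J(1) JE
    by (simp add: N.smooth_coord_field N.coord_field_centre N.open_dom N.centre_dom)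
  show ?thesis
    unfolding R
    by (rule quaternionic_sectional_curvature[where J="\<lambda>\<alpha>. J \<alpha> n", OF riemannian_manifoldD(2)[OF riem] J(1) ortho])
qed

section \<open>The warping function inequality\<close>

theorem theorem3p12:
  fixes AB :: "('b::{t2_space,second_countable_topology}, 'e::euclidean_space) atlas"
    and gB :: "'b \<Rightarrow> 'e \<Rightarrow> 'e \<Rightarrow> real"
    and DB :: "('b, 'e) connection"
    and AF :: "('f::{t2_space,second_countable_topology}, 'k::euclidean_space) atlas"
    and gF :: "'f \<Rightarrow> 'k \<Rightarrow> 'k \<Rightarrow> real"
    and f :: "'b \<Rightarrow> real"
    and AM :: "('b \<times> 'f, 'e \<times> 'k) atlas"
    and g :: "'b \<times> 'f \<Rightarrow> 'e \<times> 'k \<Rightarrow> 'e \<times> 'k \<Rightarrow> real"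
    and D :: "('b \<times> 'f, 'e \<times> 'k) connection"
    and N :: "('n::{t2_space,second_countable_topology}, 'q::euclidean_space) atlas"
    and gN :: "'n \<Rightarrow> 'q \<Rightarrow> 'q \<Rightarrow> real"
    and DN :: "('n, 'q) connection"
    and E :: "'n \<Rightarrow> ('q \<Rightarrow>\<^sub>L 'q) set"
    and c :: real
    and \<psi> :: "'b \<times> 'f \<Rightarrow> 'n"
    and p :: "'b \<times> 'f"
    and W :: "('b \<times> 'f) set" and v :: "nat \<Rightarrow> 'b \<times> 'f \<Rightarrow> 'e \<times> 'k"
    and V :: "'b set" and w :: "nat \<Rightarrow> 'b \<Rightarrow> 'e"
    and m1 m2 m H2 h2 Lf :: real
  assumes "riemannian_manifold AB gB" and "riemannian_manifold AF gF"
    and "smooth_fun AB UNIV f" and "\<forall>b. f b > 0"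
    and "AM = product_atlas AB AF" and "g = warped_metric gB f gF"
    and "quaternionic_space_form N gN DN E c"
    and "isometric_immersion AM g N gN \<psi>"
    and "levi_civita AM g D" and "levi_civita AB gB DB"
    and "open W" and "p \<in> W" and "orthonormal_frame AM g W v"
    and "open V" and "fst p \<in> V" and "orthonormal_frame AB gB V w"
    and "m1 = real DIM('e)" and "m2 = real DIM('k)" and "m = m1 + m2"
    and "H2 = gN (\<psi> p) (mean_curvature_vector AM D N DN \<psi> v p) (mean_curvature_vector AM D N DN \<psi> v p)"
    and "h2 = sff_norm_sq AM D N gN DN \<psi> v p"
    and "Lf = laplacian AB DB w f (fst p)"
  shows "(c \<ge> 0 \<longrightarrow>
            m1 * m\<^sup>2 / (2 * (m - 1)) * H2 - m1 / 2 * h2 + m1 * (c / 4) \<le> Lf / f (fst p) \<and>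
            Lf / f (fst p) \<le> m\<^sup>2 / (4 * m2) * H2 + m1 * c) \<and>
         (c < 0 \<longrightarrow>
            m1 * m\<^sup>2 / (2 * (m - 1)) * H2 - m1 / 2 * h2 + m1 * c \<le> Lf / f (fst p) \<and>
            Lf / f (fst p) \<le> m\<^sup>2 / (4 * m2) * H2 + m1 * (c / 4))"
proof -
  note AM = assms(5) and g = assms(6)
  have N: "riemannian_manifold N gN" "levi_civita N gN DN"
    using assms(7) by (simp_all add: quaternionic_space_form_def quaternionic_kaehler_def)
  interpret PM: product_manifold AB AF
    using assms(1,2)[THEN riemannian_manifoldD(1)] by unfold_locales
  interpret tangent: inner_form "warped_metric gB f gF p"
    using assms(1,2,4) by (intro inner_form_warped riemannian_manifoldD(2)) auto
  interpret warped_immersion AB gB DB AF gF f D N gN DN \<psi> p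
    by unfold_locales
      (use assms N PM.smooth_manifold_product riemannian_manifoldD(1)[OF N(1)] in \<open>simp_all add: AM g\<close>)
  let ?b = "fst p"
  have f0: "f ?b > 0" by (rule f_pos)
  \<comment> \<open>Frames are given on M and on B only; on the fibre an orthonormal basis at the
    single point \<open>snd p\<close> suffices.\<close>
  obtain z where z: "fibre.orthonormal {1..DIM('k)} z" by (rule fibre.orthonormal_exists)
  define I S :: "nat set" where "I = {1..DIM('e)}" and "S = {1..DIM('k)}"
  \<comment> \<open>A basis adapted to the product, with the sum type separating base and fibre
    indices. Division by f offsets the factor f^2 in the metric.\<close>
  define e :: "nat + nat \<Rightarrow> 'e \<times> 'k"
    where "e k = (case k of Inl i \<Rightarrow> (w i ?b, 0) | Inr s \<Rightarrow> (0, (1 / f ?b) *\<^sub>R z s))" for k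
  have cK: "card (I <+> S) = DIM('e \<times> 'k)" by (simp add: card_Plus I_def S_def)
  have w: "gB ?b (w i ?b) (w j ?b) = (if i = j then 1 else 0)" if "i \<in> I" "j \<in> I" for i j
    using assms(15,16) that by (simp add: orthonormal_frame_def I_def)
  have z': "gF (snd p) (z i) (z j) = (if i = j then 1 else 0)" if "i \<in> S" "j \<in> S" for i j
    using z that by (simp add: fibre.orthonormal_def S_def)
  have e: "tangent.orthonormal (I <+> S) e"
    unfolding tangent.orthonormal_def
  proof (intro conjI ballI)
    fix k l assume "k \<in> I <+> S" "l \<in> I <+> S"
    then show "warped_metric gB f gF p (e k) (e l) = (if k = l then 1 else 0)"
      using f0 by (auto simp: e_def metric_warped base.zero fibre.zero fibre.scale w z' power2_eq_square split: if_splits)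
  qed (simp add: I_def S_def)
  have v: "tangent.orthonormal {1..DIM('e \<times> 'k)} (\<lambda>i. v i p)"
    using assms(12,13) by (simp add: orthonormal_frame_def tangent.orthonormal_def AM g)
  have vs: "second_fundamental_form AM D N DN \<psi> (v i) (v j) p = sff (v i p) (v j p)"
    if "j \<in> {1..DIM('e \<times> 'k)}" for i j
    using second_fundamental_form_sff[OF assms(11,12)] assms(13) that by (simp add: orthonormal_frame_def AM)
  define tr where "tr = (\<Sum>k\<in>I <+> S. sff (e k) (e k))"
  define n where "n = (\<Sum>k\<in>I <+> S. \<Sum>l\<in>I <+> S. gN (\<psi> p) (sff (e k) (e l)) (sff (e k) (e l)))"
  have m: "m = real (card (I <+> S))" "m = real DIM('e \<times> 'k)" unfolding cK by (simp_all add: assms)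
  have m0: "m > 0" unfolding m(2) by (simp only: of_nat_0_less_iff DIM_positive)
  \<comment> \<open>m H is the trace of \<open>sff\<close>, hence the same in the frame
    \<open>v\<close> and in the adapted basis.\<close>
  have "mean_curvature_vector AM D N DN \<psi> v p = (1 / m) *\<^sub>R (\<Sum>i=1..DIM('e \<times> 'k). sff (v i p) (v i p))"
    unfolding mean_curvature_vector_def m(2) by (intro arg_cong2[where f=scaleR] sum.cong refl vs)
  also have "(\<Sum>i=1..DIM('e \<times> 'k). sff (v i p) (v i p)) = tr"
    unfolding tr_def by (rule tangent.orthonormal_trace[OF e cK v _ sff_bilinear]) simp
  finally have "H2 = gN (\<psi> p) ((1 / m) *\<^sub>R tr) ((1 / m) *\<^sub>R tr)" using assms(20) by simp
  then have H2: "gN (\<psi> p) tr tr = m\<^sup>2 * H2" using m0 by (simp add: ambient.scale power2_eq_square)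
  note sff_lin = sff_bilinear[THEN bilinear_ladd] sff_bilinear[THEN bilinear_radd]
    sff_bilinear[THEN bilinear_lmul] sff_bilinear[THEN bilinear_rmul]
  have bl: "bilinear (\<lambda>x y. gN (\<psi> p) (sff x a) (sff y a))" for a
    unfolding bilinear_def by (intro conjI allI linearI) (simp_all only: sff_lin ambient.add ambient.scale real_scaleR_def)
  have br: "bilinear (\<lambda>x y. gN (\<psi> p) (sff a x) (sff a y))" for a
    unfolding bilinear_def by (intro conjI allI linearI) (simp_all only: sff_lin ambient.add ambient.scale real_scaleR_def)
  \<comment> \<open>The frame is changed one slot at a time: with the other slot fixed, the sum is
    the trace of a bilinear form (\<open>br\<close>, then \<open>bl\<close>).\<close>
  have "h2 = (\<Sum>i=1..DIM('e \<times> 'k). \<Sum>j=1..DIM('e \<times> 'k). gN (\<psi> p) (sff (v i p) (v j p)) (sff (v i p) (v j p)))"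
    unfolding assms(21) sff_norm_sq_def by (intro sum.cong refl) (simp add: vs)
  also have "\<dots> = (\<Sum>i=1..DIM('e \<times> 'k). \<Sum>l\<in>I <+> S. gN (\<psi> p) (sff (v i p) (e l)) (sff (v i p) (e l)))"
    by (intro sum.cong refl tangent.orthonormal_trace[OF e cK v _ br]) simp
  also have "\<dots> = (\<Sum>l\<in>I <+> S. \<Sum>i=1..DIM('e \<times> 'k). gN (\<psi> p) (sff (v i p) (e l)) (sff (v i p) (e l)))"
    by (rule sum.swap)
  also have "\<dots> = (\<Sum>l\<in>I <+> S. \<Sum>k\<in>I <+> S. gN (\<psi> p) (sff (e k) (e l)) (sff (e k) (e l)))"
    by (intro sum.cong refl tangent.orthonormal_trace[OF e cK v _ bl]) simp
  also have "\<dots> = n" unfolding n_def by (rule sum.swap)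
  finally have h2: "h2 = n" .
  define \<delta> where "\<delta> i = fd \<phi> xb (\<Gamma>B (w i ?b) (w i ?b)) - fd (\<lambda>y. fd \<phi> y (w i ?b)) xb (w i ?b)" for i
  have Lf: "Lf = (\<Sum>i\<in>I. \<delta> i)"
    unfolding assms(22) \<delta>_def I_def \<phi>_def
    by (rule LB.laplacian_coord[OF assms(14,15) _ assms(3)]) (use assms(16) in \<open>simp add: orthonormal_frame_def\<close>)
  \<comment> \<open>Defined by solving the Gauss equation, so that \<open>L\<close> below is
    immediate; the content is that this number is the ambient sectional curvature of the plane of
    \<open>e (Inl i)\<close> and \<open>e (Inr s)\<close>.\<close>
  define \<kappa> where "\<kappa> i s = \<delta> i / f ?b - gN (\<psi> p) (sff (e (Inl i)) (e (Inl i))) (sff (e (Inr s)) (e (Inr s)))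
     + gN (\<psi> p) (sff (e (Inl i)) (e (Inr s))) (sff (e (Inl i)) (e (Inr s)))" for i s
  have \<kappa>: "\<exists>t. 0 \<le> t \<and> t \<le> 1 \<and> \<kappa> i s = c / 4 * (1 + 3 * t)" if "i \<in> I" "s \<in> S" for i s
  proof -
    have mem: "Inl i \<in> I <+> S" "Inr s \<in> I <+> S" using that by auto
    have "\<exists>t. 0 \<le> t \<and> t \<le> 1 \<and> gN (\<psi> p) (curvature N DN (coord_field N (\<psi> p) (fd \<Psi> x0 (e (Inl i))))
        (coord_field N (\<psi> p) (fd \<Psi> x0 (e (Inr s)))) (coord_field N (\<psi> p) (fd \<Psi> x0 (e (Inr s)))) (\<psi> p))
        (fd \<Psi> x0 (e (Inl i))) = c / 4 * (1 + 3 * t)"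
      by (rule quaternionic_space_form_curvature[OF assms(7)])
        (use e mem in \<open>simp_all add: metric_\<Psi> tangent.orthonormal_def\<close>)
    \<comment> \<open>The unit fibre vector has length 1 / f with respect to \<open>gF\<close>; this
      is where the division of the Laplacian by f arises.\<close>
    moreover have "f ?b * gF (snd p) ((1 / f ?b) *\<^sub>R z s) ((1 / f ?b) *\<^sub>R z s) * \<delta> i = \<delta> i / f ?b"
      using f0 by (simp add: fibre.scale z' that)
    ultimately show ?thesis
      using ambient.sym[of "sff (e (Inl i)) (e (Inl i))"] 
      by (simp add: \<kappa>_def e_def gauss_warped \<delta>_def)
  qed
  have L: "Lf / f ?b = (\<Sum>i\<in>I. \<kappa> i s + gN (\<psi> p) (sff (e (Inl i)) (e (Inl i))) (sff (e (Inr s)) (e (Inr s)))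
     - gN (\<psi> p) (sff (e (Inl i)) (e (Inr s))) (sff (e (Inl i)) (e (Inr s))))" for s
    by (simp add: \<kappa>_def Lf sum_divide_distrib)
  \<comment> \<open>Shared by both signs of c; only the range of \<kappa> changes.\<close>
  have bounds: "m1 * m\<^sup>2 / (2 * (m - 1)) * H2 - m1 / 2 * h2 + m1 * lo \<le> Lf / f ?b \<and>
      Lf / f ?b \<le> m\<^sup>2 / (4 * m2) * H2 + m1 * hi"
    if "\<And>i s. i \<in> I \<Longrightarrow> s \<in> S \<Longrightarrow> lo \<le> \<kappa> i s \<and> \<kappa> i s \<le> hi" for lo hi
  proof -
    have IS: "finite I" "finite S" "S \<noteq> {}" "real (card I) = m1" "real (card S) = m2"
      by (simp_all add: I_def S_def assms)
    from ambient.warped_sectional_sum_bounds[of I S "\<lambda>k l. sff (e k) (e l)", OF IS(1-3) sff_sym that L]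
    show ?thesis
      unfolding tr_def[symmetric] n_def[symmetric] m(1)[symmetric] IS(4,5) H2 h2
      by (simp add: mult_ac)
  qed
  show ?thesis
  proof (intro conjI impI)
    \<comment> \<open>For t from 0 to 1 the curvature c/4 (1 + 3 t) moves from c/4 to c. The sign of
      c decides which end is the lower one, and this alone separates the two cases.\<close>
    assume c: "c \<ge> 0"
    have "c / 4 \<le> \<kappa> i s \<and> \<kappa> i s \<le> c" if mem: "i \<in> I" "s \<in> S" for i s
    proof -
      obtain t where t: "0 \<le> t" "t \<le> 1" "\<kappa> i s = c / 4 * (1 + 3 * t)" using \<kappa>[OF mem] by blast
      have "0 \<le> c * t" "c * t \<le> c" using c t by (auto intro: mult_left_le)
      then show ?thesis unfolding t(3) by (simp add: algebra_simps)
    qed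
    from bounds[OF this]
    show "m1 * m\<^sup>2 / (2 * (m - 1)) * H2 - m1 / 2 * h2 + m1 * (c / 4) \<le> Lf / f ?b"
      "Lf / f ?b \<le> m\<^sup>2 / (4 * m2) * H2 + m1 * c" by blast+
  next
    assume c: "c < 0"
    have "c \<le> \<kappa> i s \<and> \<kappa> i s \<le> c / 4" if mem: "i \<in> I" "s \<in> S" for i s
    proof -
      obtain t where t: "0 \<le> t" "t \<le> 1" "\<kappa> i s = c / 4 * (1 + 3 * t)" using \<kappa>[OF mem] by blast
      have "c * t \<le> 0" "- c * t \<le> - c" using c t by (auto simp: mult_nonpos_nonneg intro: mult_left_le[of t "- c", simplified])
      then show ?thesis unfolding t(3) by (simp add: algebra_simps)
    qed
    from bounds[OF this]
    show "m1 * m\<^sup>2 / (2 * (m - 1)) * H2 - m1 / 2 * h2 + m1 * c \<le> Lf / f ?b"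
      "Lf / f ?b \<le> m\<^sup>2 / (4 * m2) * H2 + m1 * (c / 4)" by blast+
  qed
qed

end
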